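(* Let $s\in(0,1)$ and $\rho>1$, and consider the weighted fractional Laplacian $(-\Delta)^s_\omega$ in the interval $(-1,1)$. For each $f\in A_\rho$ we have $((-\Delta)^s_\omega)^{-1}f\in A_\rho$. Further, the mapping $((-\Delta)^s_\omega)^{-1}:A_\rho\to A_\rho$ is continuous.
   Context: Analytic functions: for $\rho>1$ the Bernstein ellipse $\mathcal{E}_\rho\subset\mathbb{C}$ is the ellipse with foci $\pm1$ whose minor and major semiaxial lengths add up to $\rho$; $\mathcal{B}_\rho$ is the closed region bounded by (and including) $\mathcal{E}_\rho$. $A_\rho$ is the normed space of functions analytic on the closed set $\mathcal{B}_\rho$ (i.e. on a neighborhood of it), with norm $\|\cdot\|_{L^\infty(\mathcal{B}_\rho)}$. Functions in $A_\rho$ are identified with their restrictions to $[-1,1]$. Weighted operator on $(-1,1)$: with $\omega^s(y)=(1-y^2)^s$, for $\phi\in C^2(-1,1)\cap C^1[-1,1]$, $$(-\Delta)^s_\omega[\phi](x)=C_s\frac{d}{dx}\int_{-1}^1|x-y|^{1-2s}\frac{d}{dy}\big(\omega^s(y)\phi(y)\big)\,dy\quad (s\neq1/2),$$ $$(-\Delta)^{1/2}_\omega[\phi](x)=\frac1\pi\frac{d}{dx}\int_{-1}^1\ln|x-y|\,\frac{d}{dy}\big(\omega^{1/2}(y)\phi(y)\big)\,dy\quad(s=1/2),$$ where $C_s=-\Gamma(2s-1)\sin(\pi s)/\pi$ for $s\ne1/2$. Inverse: let $L^2_s(-1,1)=\{\phi:\int_{-1}^1|\phi|^2\omega^s<\infty\}$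 and let $\tilde C_j^{(s+1/2)}$ ($j\ge0$) be its orthonormal basis of $L^2_s$-normalized Gegenbauer polynomials with parameter $s+1/2$. One has $(-\Delta)^s_\omega\tilde C_j^{(s+1/2)}=\lambda_j^s\tilde C_j^{(s+1/2)}$ with $\lambda_j^s=\Gamma(2s+j+1)/j!$, the operator extends to a bijection from $\{v\in L^2_s:\sum_j(1+j^2)^{2s}|v_j|^2<\infty\}$ (with $v_j=\int_{-1}^1v\,\tilde C_j^{(s+1/2)}\omega^s$) onto $L^2_s(-1,1)$, and $((-\Delta)^s_\omega)^{-1}f=\sum_j(\lambda_j^s)^{-1}f_j\tilde C_j^{(s+1/2)}$. *)

theory Defs
  imports "HOL-Analysis.Analysis"
begin

section \<open>Bernstein ellipses and the spaces of analytic functions\<close>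

text \<open>An ellipse with foci \<open>\<plusminus>1\<close> and semiaxes \<open>a > b\<close> satisfies \<open>a\<^sup>2 - b\<^sup>2 = 1\<close>, so \<open>a + b = \<rho>\<close> forces
  \<open>a - b = 1/\<rho>\<close>; the sum of the focal distances on it is \<open>2 * a = \<rho> + 1/\<rho>\<close>.\<close>

definition bernstein_region :: "real \<Rightarrow> complex set" where
  "bernstein_region \<rho> = {z. cmod (z - 1) + cmod (z + 1) \<le> \<rho> + 1 / \<rho>}"

text \<open>Elements are functions on the closed region; they are set to \<open>0\<close> off the region so that
  equality in the space is equality of functions. The extension \<open>F\<close> is holomorphic on an open
  neighbourhood of the region, by the definition of \<^const>\<open>analytic_on\<close>.\<close>

definition A_space :: "real \<Rightarrow> (complex \<Rightarrow> complex) set" where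
  "A_space \<rho> = {f. (\<exists>F. F analytic_on bernstein_region \<rho> \<and> (\<forall>z\<in>bernstein_region \<rho>. f z = F z))
                  \<and> (\<forall>z. z \<notin> bernstein_region \<rho> \<longrightarrow> f z = 0)}"

definition A_norm :: "real \<Rightarrow> (complex \<Rightarrow> complex) \<Rightarrow> real" where
  "A_norm \<rho> f = (SUP z\<in>bernstein_region \<rho>. cmod (f z))"

text \<open>The value \<open>0\<close> off \<open>A_space \<rho>\<close> only serves \<^locale>\<open>Metric_space\<close>, which wants a distance that is
  nonnegative at all arguments; \<^const>\<open>Sup\<close> of an unbounded set of reals is unspecified.\<close>

definition A_dist :: "real \<Rightarrow> (complex \<Rightarrow> complex) \<Rightarrow> (complex \<Rightarrow> complex) \<Rightarrow> real" where
  "A_dist \<rho> f g =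
     (if f \<in> A_space \<rho> \<and> g \<in> A_space \<rho> then A_norm \<rho> (\<lambda>z. f z - g z) else 0)"

definition A_topology :: "real \<Rightarrow> (complex \<Rightarrow> complex) topology" where
  "A_topology \<rho> = Metric_space.mtopology (A_space \<rho>) (A_dist \<rho>)"

definition on_real :: "(complex \<Rightarrow> complex) \<Rightarrow> real \<Rightarrow> complex" where
  "on_real f x = f (of_real x)"

lemma compact_bernstein_region: "compact (bernstein_region \<rho>)"
proof -
  have "closed (bernstein_region \<rho>)"
    unfolding bernstein_region_def by (intro closed_Collect_le continuous_intros)
  moreover have "cmod z \<le> (\<rho> + 1 / \<rho>) / 2" if "z \<in> bernstein_region \<rho>" for z
  proof -
    have "2 * cmod z = cmod ((z - 1) + (z + 1))"
      by (simp flip: mult_2 add: norm_mult)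
    also have "\<dots> \<le> cmod (z - 1) + cmod (z + 1)"
      by (rule norm_triangle_ineq)
    finally show ?thesis
      using that by (simp add: bernstein_region_def)
  qed
  then have "bounded (bernstein_region \<rho>)"
    unfolding bounded_iff by blast
  ultimately show ?thesis
    by (simp add: compact_eq_bounded_closed)
qed

lemma real_mem_bernstein_region:
  assumes "\<rho> > 1" and "x \<in> {-1..1}"
  shows "complex_of_real x \<in> bernstein_region \<rho>"
proof -
  have "cmod (complex_of_real x - 1) = 1 - x"
    using assms(2) norm_of_real[of "x - 1", where 'a = complex] by simp
  moreover have "cmod (complex_of_real x + 1) = 1 + x"
    using assms(2) norm_of_real[of "x + 1", where 'a = complex] by simp
  moreover have "2 \<le> \<rho> + 1 / \<rho>"
  proof -
    have "0 \<le> (\<rho> - 1)\<^sup>2 / \<rho>" using assms(1) by simp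
    also have "\<dots> = \<rho> + 1 / \<rho> - 2"
      using assms(1) by (simp add: field_simps power2_eq_square)
    finally show ?thesis by simp
  qed
  ultimately show ?thesis by (simp add: bernstein_region_def)
qed

lemma bdd_above_A_space:
  assumes "f \<in> A_space \<rho>" "g \<in> A_space \<rho>"
  shows "bdd_above ((\<lambda>z. cmod (f z - g z)) ` bernstein_region \<rho>)"
proof -
  have cont: "continuous_on (bernstein_region \<rho>) h" if h: "h \<in> A_space \<rho>" for h
  proof -
    obtain F where "F analytic_on bernstein_region \<rho>" "\<forall>z\<in>bernstein_region \<rho>. h z = F z"
      using h by (auto simp: A_space_def)
    then show ?thesis
      using analytic_imp_holomorphic holomorphic_on_imp_continuous_on
      by (simp cong: continuous_on_cong)
  qed
  have "compact ((\<lambda>z. cmod (f z - g z)) ` bernstein_region \<rho>)"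
    using cont[OF assms(1)] cont[OF assms(2)]
    by (intro compact_continuous_image compact_bernstein_region continuous_intros)
  then show ?thesis
    by (intro bounded_imp_bdd_above compact_imp_bounded)
qed

lemma Metric_space_A_space:
  assumes \<rho>: "\<rho> > 1"
  shows "Metric_space (A_space \<rho>) (A_dist \<rho>)"
proof
  have ne: "bernstein_region \<rho> \<noteq> {}"
    using real_mem_bernstein_region[OF \<rho>, of 0] by auto
  have le: "cmod (f z - g z) \<le> A_dist \<rho> f g"
    if "f \<in> A_space \<rho>" "g \<in> A_space \<rho>" "z \<in> bernstein_region \<rho>" for f g z
    unfolding A_dist_def A_norm_def
    using that bdd_above_A_space[OF that(1,2)] by (auto intro: cSUP_upper)
  show sym: "A_dist \<rho> f g = A_dist \<rho> g f" for f g
    by (simp add: A_dist_def A_norm_def norm_minus_commute)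
  show "0 \<le> A_dist \<rho> f g" for f g
  proof (cases "f \<in> A_space \<rho> \<and> g \<in> A_space \<rho>")
    case True
    obtain z where "z \<in> bernstein_region \<rho>" using ne by blast
    with True le[of f g z] show ?thesis
      using norm_ge_zero[of "f z - g z"] by linarith
  next
    case False
    then show ?thesis by (auto simp: A_dist_def)
  qed
  show "A_dist \<rho> f g = 0 \<longleftrightarrow> f = g" if fg: "f \<in> A_space \<rho>" "g \<in> A_space \<rho>" for f g
  proof
    assume "A_dist \<rho> f g = 0"
    then have "f z = g z" if "z \<in> bernstein_region \<rho>" for z
      using le[OF fg that] by simp
    moreover have "f z = g z" if "z \<notin> bernstein_region \<rho>" for z
      using fg that by (simp add: A_space_def)
    ultimately show "f = g" by blast
  next
    assume "f = g"
    then show "A_dist \<rho> f g = 0"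
      using ne by (simp add: A_dist_def A_norm_def)
  qed
  show "A_dist \<rho> f h \<le> A_dist \<rho> f g + A_dist \<rho> g h"
    if "f \<in> A_space \<rho>" "g \<in> A_space \<rho>" "h \<in> A_space \<rho>" for f g h
  proof -
    have "cmod (f z - h z) \<le> A_dist \<rho> f g + A_dist \<rho> g h" if "z \<in> bernstein_region \<rho>" for z
    proof -
      have "cmod (f z - h z) \<le> cmod (f z - g z) + cmod (g z - h z)"
        using norm_triangle_ineq[of "f z - g z" "g z - h z"] by simp
      with le[OF \<open>f \<in> _\<close> \<open>g \<in> _\<close> that] le[OF \<open>g \<in> _\<close> \<open>h \<in> _\<close> that] show ?thesis
        by linarith
    qed
    then show ?thesis
      using that ne by (auto simp: A_dist_def[of \<rho> f h] A_norm_def intro!: cSUP_least)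
  qed
qed


section \<open>The weighted fractional Laplacian on smooth functions\<close>

definition omega :: "real \<Rightarrow> real \<Rightarrow> real" where
  "omega s y = (1 - y\<^sup>2) powr s"

definition C_const :: "real \<Rightarrow> real" where
  "C_const s = - Gamma (2 * s - 1) * sin (pi * s) / pi"

definition riesz_kernel :: "real \<Rightarrow> real \<Rightarrow> real" where
  "riesz_kernel s t = (if s = 1/2 then ln \<bar>t\<bar> / pi else C_const s * \<bar>t\<bar> powr (1 - 2 * s))"

definition riesz_potential :: "real \<Rightarrow> (real \<Rightarrow> complex) \<Rightarrow> real \<Rightarrow> complex" where
  "riesz_potential s \<phi> x =
     (LINT y:{-1<..<1}|lborel.
        riesz_kernel s (x - y) *\<^sub>R vector_derivative (\<lambda>t. omega s t *\<^sub>R \<phi> t) (at y))"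

definition C2_open_C1_closed :: "(real \<Rightarrow> complex) \<Rightarrow> bool" where
  "C2_open_C1_closed \<phi> \<longleftrightarrow>
     (\<exists>\<phi>' \<phi>''.
        (\<forall>x\<in>{-1..1}. (\<phi> has_vector_derivative \<phi>' x) (at x within {-1..1})) \<and>
        continuous_on {-1..1} \<phi>' \<and>
        (\<forall>x\<in>{-1<..<1}. (\<phi>' has_vector_derivative \<phi>'' x) (at x)) \<and>
        continuous_on {-1<..<1} \<phi>'')"

text \<open>\<open>weighted_frac_lap s \<phi> g\<close>: \<open>\<phi>\<close> lies in \<open>C\<^sup>2(-1,1) \<inter> C\<^sup>1[-1,1]\<close> and the function \<open>g\<close> is the image of \<open>\<phi>\<close>
  under the weighted operator on \<open>(-1,1)\<close>. The constant in front of the outer derivative has been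
  moved into the kernel.\<close>

definition weighted_frac_lap :: "real \<Rightarrow> (real \<Rightarrow> complex) \<Rightarrow> (real \<Rightarrow> complex) \<Rightarrow> bool" where
  "weighted_frac_lap s \<phi> g \<longleftrightarrow>
     C2_open_C1_closed \<phi> \<and>
     (\<forall>x\<in>{-1<..<1}. (riesz_potential s \<phi> has_vector_derivative g x) (at x))"


section \<open>Weighted spaces, and the extended operator and its inverse\<close>

definition L2_weighted :: "real \<Rightarrow> (real \<Rightarrow> complex) set" where
  "L2_weighted s =
     {v. set_borel_measurable lborel {-1<..<1} v \<and>
         set_integrable lborel {-1<..<1} (\<lambda>x. (cmod (v x))\<^sup>2 * omega s x)}"

definition L2_weighted_norm :: "real \<Rightarrow> (real \<Rightarrow> complex) \<Rightarrow> real" where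
  "L2_weighted_norm s v = sqrt (LINT x:{-1<..<1}|lborel. (cmod (v x))\<^sup>2 * omega s x)"

text \<open>The usual three-term recurrence; the parameter \<open>a\<close> belongs to the weight \<open>omega (a - 1/2)\<close>.\<close>

fun gegenbauer :: "real \<Rightarrow> nat \<Rightarrow> real \<Rightarrow> real" where
  "gegenbauer a 0 x = 1"
| "gegenbauer a (Suc 0) x = 2 * a * x"
| "gegenbauer a (Suc (Suc n)) x =
     (2 * (real n + 1 + a) * x * gegenbauer a (Suc n) x - (real n + 2 * a) * gegenbauer a n x)
       / (real n + 2)"

definition normalized_gegenbauer :: "real \<Rightarrow> nat \<Rightarrow> real \<Rightarrow> real" where
  "normalized_gegenbauer s j x =
     gegenbauer (s + 1/2) j x /
       sqrt (LINT y:{-1<..<1}|lborel. (gegenbauer (s + 1/2) j y)\<^sup>2 * omega s y)"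

definition gegenbauer_coeff :: "real \<Rightarrow> (real \<Rightarrow> complex) \<Rightarrow> nat \<Rightarrow> complex" where
  "gegenbauer_coeff s v j =
     (LINT x:{-1<..<1}|lborel. (normalized_gegenbauer s j x * omega s x) *\<^sub>R v x)"

text \<open>The space of all \<open>v\<close> in \<open>L2_weighted s\<close> with \<open>(\<Sum>j. (1 + j\<^sup>2) powr (2 * s) * \<bar>v\<^sub>j\<bar>\<^sup>2)\<close> finite. As in
  \<open>L2_weighted\<close>, its elements are functions, to be read up to null sets.\<close>

definition sobolev :: "real \<Rightarrow> (real \<Rightarrow> complex) set" where
  "sobolev s =
     {v \<in> L2_weighted s.
        summable (\<lambda>j. (1 + (real j)\<^sup>2) powr (2 * s) * (cmod (gegenbauer_coeff s v j))\<^sup>2)}"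

definition sobolev_norm :: "real \<Rightarrow> (real \<Rightarrow> complex) \<Rightarrow> real" where
  "sobolev_norm s v =
     sqrt (\<Sum>j. (1 + (real j)\<^sup>2) powr (2 * s) * (cmod (gegenbauer_coeff s v j))\<^sup>2)"

text \<open>The extension by continuity to \<open>sobolev s\<close>, with values in \<open>L2_weighted s\<close>:
  \<open>weighted_frac_lap_ext s v g\<close> states that \<open>g\<close> is the image of \<open>v\<close>. Its graph is the closure of the
  part of the graph of \<open>weighted_frac_lap s\<close> lying in \<open>sobolev s \<times> L2_weighted s\<close>.\<close>

definition weighted_frac_lap_ext :: "real \<Rightarrow> (real \<Rightarrow> complex) \<Rightarrow> (real \<Rightarrow> complex) \<Rightarrow> bool" where
  "weighted_frac_lap_ext s v g \<longleftrightarrow>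
     v \<in> sobolev s \<and> g \<in> L2_weighted s \<and>
     (\<exists>\<phi> h. (\<forall>n::nat. \<phi> n \<in> sobolev s \<and> h n \<in> L2_weighted s \<and> weighted_frac_lap s (\<phi> n) (h n)) \<and>
        (\<lambda>n. sobolev_norm s (\<lambda>x. \<phi> n x - v x)) \<longlonglongrightarrow> 0 \<and>
        (\<lambda>n. L2_weighted_norm s (\<lambda>x. h n x - g x)) \<longlonglongrightarrow> 0)"

text \<open>The extended operator is bijective modulo null sets, so the choice below only selects a
  representative of the preimage of \<open>f\<close>.\<close>

definition weighted_frac_lap_inv :: "real \<Rightarrow> (real \<Rightarrow> complex) \<Rightarrow> real \<Rightarrow> complex" where
  "weighted_frac_lap_inv s f = (SOME v. weighted_frac_lap_ext s v f)"

end

theory Submission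
  imports Defs "HOL-Complex_Analysis.Complex_Analysis" "HOL-Real_Asymp.Real_Asymp"
begin

text \<open>
  Let \<open>L\<close> be the weighted operator. It can be computed explicitly on polynomials and inverted there in the
  Chebyshev basis; the inverse is then summed along the Chebyshev series of a function in \<open>A_space \<rho>\<close>.

  \<^emph>\<open>Polynomials.\<close> For a polynomial \<open>p\<close> put \<open>U p x = \<integral> k(x - y) (\<omega>\<^sup>s p)'(y) dy\<close>, where \<open>k\<close> is the
  kernel including its constant, so that \<open>L p = (U p)'\<close>. Since \<open>t k'(t) = (1 - 2s) k(t) + \<delta>\<close> with a
  constant \<open>\<delta>\<close> (nonzero only for \<open>s = 1/2\<close>), and since differentiation commutes with the potential of
  a function vanishing at the end points (\<open>Npot_deriv\<close>), there are rules for \<open>U (X p)\<close> and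
  \<open>U ((1 - X\<^sup>2) p)\<close>. For \<open>p = 1\<close> and \<open>p = X\<close> they combine to a differential equation, which
  forces \<open>U 1 x = ell0 * x\<close> (\<open>U_1\<close>); it follows that \<open>L\<close> maps polynomials to polynomials, and that
  \<open>L (X q - 2s (1 - X\<^sup>2) p) = X L q\<close> for \<open>q = (1 - X\<^sup>2) p' - (2s + 2) X p\<close> (\<open>LP_recursion\<close>). All values of
  \<open>L\<close> on polynomials follow from this relation and from \<open>L 1\<close> and \<open>L X\<close>.

  \<^emph>\<open>The extended operator.\<close> The relation shows that the Gegenbauer polynomials are eigenfunctions,
  with eigenvalues \<open>ell0 * gam n\<close> where \<open>gam n = (1 + 2s)\<^sub>n / n!\<close> (\<open>LP_gpol\<close>). As \<open>L\<close> is symmetric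
  for the weight (\<open>weighted_frac_lap_symmetric\<close>), the extended operator acts diagonally on Gegenbauer
  coefficients, and completeness makes it injective up to null sets (\<open>ext_unique\<close>). Therefore it
  suffices to exhibit one preimage of \<open>f\<close>, as a uniform limit of polynomials whose images converge
  uniformly to \<open>f\<close> (\<open>ext_from_uniform_limits\<close>, \<open>inv_eq_AE\<close>).

  \<^emph>\<open>The Chebyshev basis.\<close> Let \<open>E\<^sub>0 = 1\<close> and \<open>E\<^sub>n = 2 T\<^sub>n\<close>. With \<open>x = (w + 1/w)/2\<close> one has
  \<open>\<Sum>\<^sub>n (L E\<^sub>n)(x) z\<^sup>n = ell0 * ((1 - z\<^sup>2) / (1 - 2xz + z\<^sup>2)) powr (1 + 2s)\<close> (\<open>LP_Epol_eq_LPgen\<close>), because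
  both sides obey the same recursion. Expanding the right-hand side gives the triangular matrix of \<open>L\<close>
  (\<open>LP_Epol\<close>). Its diagonal is \<open>ell0 * gam n\<close>, and since \<open>(1 - z) powr (1 + 2s)\<close> and
  \<open>(1 - z) powr -(1 + 2s)\<close> cancel, the entries on each further diagonal are smaller by a factor of the order
  of the degree (\<open>lcoef_bound\<close>). So the solution \<open>Q\<^sub>n\<close> of \<open>L Q\<^sub>n = E\<^sub>n\<close> is \<open>E\<^sub>n / (ell0 * gam n)\<close> plus terms of lower
  degree which on \<open>1 \<le> \<bar>w\<bar> \<le> \<rho>\<close> are of size \<open>\<rho>\<^sup>n / ((n + 1) gam n)\<close> (\<open>qc_bound\<close>, \<open>Qc_tail_bound\<close>).

  \<^emph>\<open>Analytic functions.\<close> The Joukowski map \<open>w \<mapsto> (w + 1/w)/2\<close> sends \<open>1 \<le> \<bar>w\<bar> \<le> \<rho>\<close> onto the Bernstein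
  region, and \<open>f\<close> in \<open>A_space \<rho>\<close> is the sum of \<open>c\<^sub>n E\<^sub>n\<close> with \<open>\<bar>c\<^sub>n\<bar> \<le> \<parallel>f\<parallel> \<rho> powr -n\<close> (\<open>A_space_cheb\<close>).
  Set \<open>T f = \<Sum>\<^sub>n c\<^sub>n Q\<^sub>n\<close>. In fact \<open>c\<^sub>n\<close> decays like \<open>\<rho>' powr -n\<close> for some \<open>\<rho>' > \<rho>\<close>, so the series
  converges on a neighbourhood of the region, and \<open>T f\<close> is analytic there. For the bound by \<open>\<parallel>f\<parallel>\<close> the
  lower order terms cause no problem, as \<open>\<Sum>\<^sub>n 1 / ((n + 1) gam n)\<close> is finite. In the leading part
  \<open>\<Sum>\<^sub>n c\<^sub>n (w\<^sup>n + w powr -n) / gam n\<close> absolute convergence is not enough when \<open>s\<close> is small, but \<open>1 / gam n\<close>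
  is the \<open>n\<close>-th moment of a probability measure on \<open>[0, 1]\<close> (\<open>inv_gam_integral\<close>); so each of
  the two parts is an average of values of \<open>\<Sum>\<^sub>n c\<^sub>n u\<^sup>n\<close>, at \<open>u = tw\<close> or \<open>u = t/w\<close>, and these are bounded by a
  multiple of \<open>\<parallel>f\<parallel>\<close> for \<open>\<bar>u\<bar> \<le> \<rho>\<close> (\<open>gam_multiplier\<close>, \<open>plus_part_bound\<close>). Thus the linear map \<open>T\<close> is bounded (\<open>Tser_bound\<close>).
\<close>

section \<open>Integrals of weakly singular functions\<close>

text \<open>The fundamental theorem of calculus for integrands that may be unbounded at the end points.\<close>

lemma set_integral_FTC:
  fixes f f' :: "real \<Rightarrow> 'a::euclidean_space"
  assumes "a \<le> b" "continuous_on {a..b} f" "finite S"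
    and der: "\<And>x. x \<in> {a<..<b} - S \<Longrightarrow> (f has_vector_derivative f' x) (at x)"
    and int: "set_integrable lborel {a<..<b} f'"
  shows "(LINT x:{a<..<b}|lborel. f' x) = f b - f a"
proof -
  have "(f' has_integral (f b - f a)) {a..b}"
    using assms by (intro fundamental_theorem_of_calculus_interior_strong[of S]) auto
  then have "(f' has_integral (f b - f a)) {a<..<b}"
    by (simp add: has_integral_Icc_iff_Ioo)
  with set_borel_integral_eq_integral(2)[OF int] show ?thesis
    by (simp add: integral_unique)
qed

lemma set_integral_dominated:
  fixes f :: "real \<Rightarrow> 'a::{banach,second_countable_topology}"
  assumes "set_integrable lborel A g" "set_borel_measurable lborel A f"
    and "\<And>x. x \<in> A \<Longrightarrow> norm (f x) \<le> g x"
  shows "set_integrable lborel A f" "norm (LINT x:A|lborel. f x) \<le> (LINT x:A|lborel. g x)"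
proof -
  show 1: "set_integrable lborel A f"
    using assms unfolding set_integrable_def set_borel_measurable_def
    by (elim Bochner_Integration.integrable_bound) (auto simp: indicator_def intro: order_trans[OF _ abs_ge_self])
  have "norm (LINT x:A|lborel. f x) \<le> (LINT x|lborel. norm (indicator A x *\<^sub>R f x))"
    unfolding set_lebesgue_integral_def by (rule integral_norm_bound)
  also have "\<dots> \<le> (LINT x|lborel. indicator A x *\<^sub>R g x)"
    using 1 assms unfolding set_integrable_def
    by (intro integral_mono integrable_norm) (auto simp: indicator_def)
  finally show "norm (LINT x:A|lborel. f x) \<le> (LINT x:A|lborel. g x)"
    by (simp add: set_lebesgue_integral_def)
qed

text \<open>The point of the bound is that it is uniform in the position \<open>c\<close> of the singularity.\<close>

lemma powr_singularity_integrable: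
  fixes c \<theta> :: real
  assumes "0 \<le> \<theta>" "\<theta> < 1" "\<bar>c\<bar> \<le> 1"
  shows "set_integrable lborel {-1<..<1} (\<lambda>y. \<bar>c - y\<bar> powr - \<theta>)"
    and "(LINT y:{-1<..<1}|lborel. \<bar>c - y\<bar> powr - \<theta>) \<le> 4 / (1 - \<theta>)"
proof -
  define F where "F y = sgn (y - c) * \<bar>y - c\<bar> powr (1 - \<theta>) / (1 - \<theta>)" for y
  have der: "(F has_real_derivative \<bar>c - y\<bar> powr - \<theta>) (at y)" if "y \<noteq> c" for y
  proof (cases "y > c")
    case True
    have "((\<lambda>y. (y - c) powr (1 - \<theta>) / (1 - \<theta>)) has_real_derivative \<bar>c - y\<bar> powr - \<theta>) (at y)"
      using True assms by (auto intro!: derivative_eq_intros simp: divide_simps)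
    moreover have "\<forall>\<^sub>F z in nhds y. F z = (z - c) powr (1 - \<theta>) / (1 - \<theta>)"
      by (rule eventually_mono[OF eventually_nhds_in_open[of "{c<..}" y]]) (use True in \<open>auto simp: F_def\<close>)
    ultimately show ?thesis by (subst DERIV_cong_ev[OF refl _ refl])
  next
    case False
    with that have lt: "y < c" by simp
    have "((\<lambda>y. - ((c - y) powr (1 - \<theta>)) / (1 - \<theta>)) has_real_derivative \<bar>c - y\<bar> powr - \<theta>) (at y)"
      using lt assms by (auto intro!: derivative_eq_intros simp: divide_simps)
    moreover have "\<forall>\<^sub>F z in nhds y. F z = - ((c - z) powr (1 - \<theta>)) / (1 - \<theta>)"
      by (rule eventually_mono[OF eventually_nhds_in_open[of "{..<c}" y]]) (use lt in \<open>auto simp: F_def\<close>)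
    ultimately show ?thesis by (subst DERIV_cong_ev[OF refl _ refl])
  qed
  have "isCont F y" for y
  proof (cases "y = c")
    case False then show ?thesis using der DERIV_isCont by blast
  next
    case True
    have "((\<lambda>y. \<bar>y - c\<bar> powr (1 - \<theta>) / (1 - \<theta>)) \<longlongrightarrow> \<bar>c - c\<bar> powr (1 - \<theta>) / (1 - \<theta>)) (at c)"
      using assms by (intro tendsto_intros tendsto_powr2) (auto)
    then have "((\<lambda>y. \<bar>y - c\<bar> powr (1 - \<theta>) / (1 - \<theta>)) \<longlongrightarrow> 0) (at c)" by simp
    then have "(F \<longlongrightarrow> 0) (at c)"
      by (rule Lim_null_comparison[rotated])
        (use assms in \<open>auto simp: F_def abs_mult sgn_if intro!: always_eventually divide_right_mono\<close>)
    then show ?thesis using True by (simp add: isCont_def F_def)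
  qed
  then have cont: "continuous_on {-1..1} F"
    by (simp add: continuous_at_imp_continuous_on)
  have hi: "((\<lambda>y. \<bar>c - y\<bar> powr - \<theta>) has_integral (F 1 - F (-1))) {-1..1}"
    using der cont
    by (intro fundamental_theorem_of_calculus_interior_strong[of "{c}"])
      (auto simp: has_real_derivative_iff_has_vector_derivative)
  then have hi': "((\<lambda>y. \<bar>c - y\<bar> powr - \<theta>) has_integral (F 1 - F (-1))) {-1<..<1}"
    by (simp add: has_integral_Icc_iff_Ioo)
  then have "(\<lambda>y. \<bar>c - y\<bar> powr - \<theta>) absolutely_integrable_on {-1<..<1}"
    by (intro nonnegative_absolutely_integrable_1) (auto simp: integrable_on_def)
  then show int: "set_integrable lborel {-1<..<1} (\<lambda>y. \<bar>c - y\<bar> powr - \<theta>)"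
    unfolding set_integrable_def
    by (subst (asm) integrable_completion) auto
  have Fb: "\<bar>F y\<bar> \<le> 2 / (1 - \<theta>)" if "\<bar>y\<bar> \<le> 1" for y
  proof -
    have "\<bar>y - c\<bar> powr (1 - \<theta>) \<le> 2 powr (1 - \<theta>)"
      using that assms by (intro powr_mono2) auto
    also have "\<dots> \<le> 2 powr 1" using assms by (intro powr_mono) auto
    finally have "\<bar>y - c\<bar> powr (1 - \<theta>) \<le> 2" by simp
    then show ?thesis using assms unfolding F_def
      by (auto simp: abs_mult sgn_if divide_right_mono)
  qed
  have "(LINT y:{-1<..<1}|lborel. \<bar>c - y\<bar> powr - \<theta>) = F 1 - F (-1)"
    using hi' set_borel_integral_eq_integral(2)[OF int] by (simp add: integral_unique)
  also have "\<dots> \<le> 2 / (1 - \<theta>) + 2 / (1 - \<theta>)" using Fb[of 1] Fb[of "-1"] by simp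
  finally show "(LINT y:{-1<..<1}|lborel. \<bar>c - y\<bar> powr - \<theta>) \<le> 4 / (1 - \<theta>)" by simp
qed

section \<open>The Riesz kernel and its antiderivative\<close>

text \<open>The order \<open>s\<close> of the operator is fixed from here on.\<close>

locale fractional_order =
  fixes s :: real
  assumes s_pos: "0 < s" and s_less: "s < 1"
begin

abbreviation kern where "kern \<equiv> riesz_kernel s"

text \<open>The derivative of the kernel \<open>k\<close> is \<open>hker t / t\<close>, where \<open>hker t = (1 - 2s) k(t) + delta\<close> is a multiple, by
  \<open>kappa\<close>, of \<open>\<bar>t\<bar> powr (1 - 2s)\<close>. The logarithmic kernel at \<open>s = 1/2\<close> is the only one with \<open>delta \<noteq> 0\<close>.
  \<open>KK\<close> is an antiderivative of \<open>k\<close>.\<close>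

definition kappa :: real where "kappa = (if s = 1/2 then 1 / pi else (1 - 2 * s) * C_const s)"
definition delta :: real where "delta = (if s = 1/2 then 1 / pi else 0)"
definition hker :: "real \<Rightarrow> real" where "hker t = kappa * \<bar>t\<bar> powr (1 - 2 * s)"
definition KK :: "real \<Rightarrow> real" where "KK t = (t * kern t - delta * t) / (2 - 2 * s)"
text \<open>All estimates for the kernel have the form \<open>\<bar>k(t)\<bar> \<le> C \<bar>t\<bar> powr -gexp\<close>, with \<open>gexp > 0\<close> also where the kernel
  is bounded or logarithmic. The weight contributes a factor \<open>(1 - y\<^sup>2) powr (s - 1)\<close>; the product of both
  singularities is integrable because the total exponent \<open>theta = gexp + (1 - s)\<close> is less than \<open>1\<close>.\<close>

definition gexp :: real where "gexp = max (2 * s - 1) (s / 2)"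
definition theta :: real where "theta = gexp + 1 - s"

lemma gexp_bounds: "0 < gexp" "gexp < s" "gexp < 1" "0 \<le> theta" "theta < 1" "2 * s - 1 \<le> gexp"
  using s_pos s_less by (auto simp: gexp_def theta_def max_def)

lemma kappa_nonzero: "kappa \<noteq> 0"
proof (cases "s = 1/2")
  case False
  have "2 * s - 1 \<notin> \<int>\<^sub>\<le>\<^sub>0"
  proof
    assume "2 * s - 1 \<in> \<int>\<^sub>\<le>\<^sub>0"
    then obtain n where "2 * s - 1 = - real n" by (auto elim!: nonpos_Ints_cases')
    moreover have "-1 < 2 * s - 1" using s_pos by simp
    ultimately have "n = 0" by auto
    then show False using \<open>2 * s - 1 = _\<close> False by simp
  qed
  then have "Gamma (2 * s - 1) \<noteq> 0" by (simp add: Gamma_eq_zero_iff)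
  moreover have "sin (pi * s) > 0" using s_pos s_less by (intro sin_gt_zero) auto
  ultimately show ?thesis using False by (simp add: kappa_def C_const_def)
qed (simp add: kappa_def)

lemma kern_minus [simp]: "kern (- t) = kern t"
  by (simp add: riesz_kernel_def)

lemma kern_0 [simp]: "kern 0 = 0"
  by (simp add: riesz_kernel_def)

lemma hker_eq: "t \<noteq> 0 \<Longrightarrow> hker t = (1 - 2 * s) * kern t + delta"
  proof (cases "s = 1/2")
  case True
  then have z: "1 - 2 * s = 0" by simp
  have "kappa = 1 / pi" "delta = 1 / pi" using True by (simp_all add: kappa_def delta_def)
  moreover assume "t \<noteq> 0"
  ultimately show ?thesis unfolding hker_def z by simp
qed (simp add: hker_def kappa_def delta_def riesz_kernel_def)

lemma kern_deriv:
  assumes "t \<noteq> 0"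
  shows "(kern has_real_derivative hker t / t) (at t)"
proof -
  have *: "((\<lambda>t. \<bar>t\<bar>) has_real_derivative sgn t) (at t)"
  proof (cases "t > 0")
    case True
    have "((\<lambda>t. t) has_real_derivative sgn t) (at t)" using True by simp
    then show ?thesis by (rule has_field_derivative_transform_within_open[of _ _ _ "{0<..}"]) (use True in auto)
  next
    case False
    with assms have "t < 0" by simp
    then have "((\<lambda>t. - t) has_real_derivative sgn t) (at t)" by (auto intro!: derivative_eq_intros)
    then show ?thesis by (rule has_field_derivative_transform_within_open[of _ _ _ "{..<0}"]) (use \<open>t < 0\<close> in auto)
  qed
  show ?thesis
  proof (cases "s = 1/2")
    case True
    have "((\<lambda>t. ln \<bar>t\<bar> / pi) has_real_derivative (sgn t / \<bar>t\<bar>) / pi) (at t)"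
      using assms * by (auto intro!: derivative_eq_intros DERIV_chain2[OF DERIV_ln] simp: divide_simps)
    moreover have "(sgn t / \<bar>t\<bar>) / pi = hker t / t"
    proof -
      have z: "1 - 2 * s = 0" "delta = 1 / pi" using True by (simp_all add: delta_def)
      show ?thesis using assms unfolding hker_eq[OF assms] z by (simp add: sgn_if)
    qed
    moreover have "kern = (\<lambda>t. ln \<bar>t\<bar> / pi)" using True by (simp add: riesz_kernel_def fun_eq_iff)
    ultimately show ?thesis by metis
  next
    case False
    have "((\<lambda>t. C_const s * \<bar>t\<bar> powr (1 - 2 * s)) has_real_derivative
            C_const s * ((1 - 2 * s) * \<bar>t\<bar> powr (1 - 2 * s - 1) * sgn t)) (at t)"
      using DERIV_chain2[OF has_real_derivative_powr * , of "1 - 2 * s"] assms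
      by (intro DERIV_cmult) auto
    moreover have "C_const s * ((1 - 2 * s) * \<bar>t\<bar> powr (1 - 2 * s - 1) * sgn t) = hker t / t"
    proof -
      have "\<bar>t\<bar> powr (1 - 2 * s - 1) = \<bar>t\<bar> powr (1 - 2 * s) / \<bar>t\<bar>"
        using assms by (subst powr_diff) auto
      then show ?thesis using assms False
        by (simp only: hker_def kappa_def if_False) (simp add: sgn_if)
    qed
    ultimately show ?thesis using False by (simp add: riesz_kernel_def[abs_def])
  qed
qed

lemma KK_deriv:
  assumes "t \<noteq> 0"
  shows "(KK has_real_derivative kern t) (at t)"
proof -
  have "((\<lambda>t. (t * kern t - delta * t) / (2 - 2 * s)) has_real_derivative
      (kern t + t * (hker t / t) - delta) / (2 - 2 * s)) (at t)"
    using s_less assms by (auto intro!: derivative_eq_intros kern_deriv)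
  moreover have "(kern t + t * (hker t / t) - delta) / (2 - 2 * s) = kern t"
    using assms s_less by (simp add: hker_eq divide_simps) (simp add: algebra_simps)
  ultimately show ?thesis by (simp add: KK_def[abs_def])
qed

lemma kern_bound_ex: "\<exists>C>0. \<forall>t. \<bar>t\<bar> \<le> 2 \<longrightarrow> \<bar>kern t\<bar> \<le> C * \<bar>t\<bar> powr - gexp"
proof (cases "s = 1/2")
  case True
  then have g: "gexp = 1/4" by (simp add: gexp_def)
  have "\<bar>ln \<bar>t\<bar>\<bar> \<le> 4 * \<bar>t\<bar> powr - gexp" if "\<bar>t\<bar> \<le> 2" "t \<noteq> 0" for t :: real
  proof (cases "\<bar>t\<bar> \<le> 1")
    case True
    have "ln (\<bar>t\<bar> powr (-1/4)) \<le> \<bar>t\<bar> powr (-1/4) - 1"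
      using that by (intro ln_le_minus_one) auto
    then have "- (1/4) * ln \<bar>t\<bar> \<le> \<bar>t\<bar> powr (-1/4)"
      using that by (simp add: ln_powr)
    moreover have "ln \<bar>t\<bar> \<le> 0" using True that by simp
    ultimately show ?thesis by (simp add: g)
  next
    case False
    then have "ln \<bar>t\<bar> \<ge> 0" by simp
    moreover have "ln \<bar>t\<bar> \<le> \<bar>t\<bar> - 1" using that by (intro ln_le_minus_one) auto
    moreover have "\<bar>t\<bar> powr -(1/4) \<ge> \<bar>t\<bar> powr - 1" using False by (intro powr_mono) auto
    then have "\<bar>t\<bar> powr -(1/4) \<ge> 1/2" using that False
      by (simp add: powr_minus divide_simps)
    ultimately show ?thesis using that by (simp add: g)
  qed
  then have "\<bar>kern t\<bar> \<le> 4 * \<bar>t\<bar> powr - gexp" if "\<bar>t\<bar> \<le> 2" for t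
    using that True pi_ge_two
    by (cases "t = 0") (force simp: riesz_kernel_def divide_simps intro: order_trans[OF _ mult_left_mono[of 1 pi]])+
  then show ?thesis by (intro exI[of _ 4]) auto
next
  case False
  have "\<bar>kern t\<bar> \<le> (\<bar>C_const s\<bar> * 4 + 1) * \<bar>t\<bar> powr - gexp" if "\<bar>t\<bar> \<le> 2" for t
  proof (cases "t = 0")
    case False
    have e: "\<bar>t\<bar> powr (1 - 2 * s) = \<bar>t\<bar> powr (1 - 2 * s + gexp) * \<bar>t\<bar> powr - gexp"
      using False by (simp flip: powr_add)
    have "\<bar>t\<bar> powr (1 - 2 * s + gexp) \<le> 2 powr (1 - 2 * s + gexp)"
      using that gexp_bounds by (intro powr_mono2) auto
    also have "\<dots> \<le> 2 powr 2" using gexp_bounds s_pos by (intro powr_mono) auto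
    also have "2 powr 2 = (4::real)" by (simp add: powr_numeral)
    finally have "\<bar>t\<bar> powr (1 - 2 * s) \<le> 4 * \<bar>t\<bar> powr - gexp"
      unfolding e by (intro mult_right_mono) auto
    then have "\<bar>C_const s\<bar> * \<bar>t\<bar> powr (1 - 2 * s) \<le> \<bar>C_const s\<bar> * (4 * \<bar>t\<bar> powr - gexp)"
      by (intro mult_left_mono) auto
    also have "\<dots> \<le> (\<bar>C_const s\<bar> * 4 + 1) * \<bar>t\<bar> powr - gexp" by (simp add: algebra_simps)
    finally show ?thesis using \<open>s \<noteq> 1/2\<close> by (simp add: riesz_kernel_def abs_mult)
  qed auto
  then show ?thesis by (intro exI[of _ "\<bar>C_const s\<bar> * 4 + 1"]) (auto simp: add_nonneg_pos)
qed

text \<open>A constant for which the bound of the kernel on \<open>[-2, 2]\<close> holds.\<close>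

definition kC :: real where "kC = (SOME C. C > 0 \<and> (\<forall>t. \<bar>t\<bar> \<le> 2 \<longrightarrow> \<bar>kern t\<bar> \<le> C * \<bar>t\<bar> powr - gexp))"

lemma kC_pos: "kC > 0" and kern_bound: "\<bar>t\<bar> \<le> 2 \<Longrightarrow> \<bar>kern t\<bar> \<le> kC * \<bar>t\<bar> powr - gexp"
  using someI_ex[OF kern_bound_ex] by (auto simp: kC_def)

lemma KK_bound: "\<exists>C>0. \<forall>t. \<bar>t\<bar> \<le> 2 \<longrightarrow> \<bar>KK t\<bar> \<le> C * \<bar>t\<bar> powr (1 - gexp)"
proof -
  have "\<bar>KK t\<bar> \<le> ((kC + 2 * \<bar>delta\<bar>) / (2 - 2 * s)) * \<bar>t\<bar> powr (1 - gexp)" if "\<bar>t\<bar> \<le> 2" for t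
  proof (cases "t = 0")
    case False
    have 1: "\<bar>t * kern t\<bar> \<le> kC * \<bar>t\<bar> powr (1 - gexp)"
      using mult_left_mono[OF kern_bound[OF that], of "\<bar>t\<bar>"] False
      by (simp add: abs_mult powr_diff powr_minus divide_simps)
    have "\<bar>t\<bar> = \<bar>t\<bar> powr gexp * \<bar>t\<bar> powr (1 - gexp)" using False by (simp flip: powr_add)
    also have "\<dots> \<le> 2 powr gexp * \<bar>t\<bar> powr (1 - gexp)"
      using that gexp_bounds by (intro mult_right_mono powr_mono2) auto
    also have "\<dots> \<le> 2 powr 1 * \<bar>t\<bar> powr (1 - gexp)"
      using that gexp_bounds by (intro mult_right_mono powr_mono) auto
    finally have "\<bar>t\<bar> \<le> 2 * \<bar>t\<bar> powr (1 - gexp)" by simp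
    then have "\<bar>delta\<bar> * \<bar>t\<bar> \<le> \<bar>delta\<bar> * (2 * \<bar>t\<bar> powr (1 - gexp))" by (rule mult_left_mono) simp
    then have "\<bar>t * kern t - delta * t\<bar> \<le> (kC + 2 * \<bar>delta\<bar>) * \<bar>t\<bar> powr (1 - gexp)"
      using 1 abs_triangle_ineq4[of "t * kern t" "delta * t"] by (simp add: abs_mult algebra_simps)
    then show ?thesis using s_less by (simp add: KK_def divide_simps)
  qed (simp add: KK_def)
  moreover have "(kC + 2 * \<bar>delta\<bar>) / (2 - 2 * s) > 0" using kC_pos s_less by (simp add: add_pos_nonneg)
  ultimately show ?thesis by blast
qed

lemma isCont_KK: "isCont KK t"
proof (cases "t = 0")
  case False then show ?thesis using KK_deriv DERIV_isCont by blast
next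
  case True
  obtain C where C: "C > 0" "\<And>t. \<bar>t\<bar> \<le> 2 \<Longrightarrow> \<bar>KK t\<bar> \<le> C * \<bar>t\<bar> powr (1 - gexp)"
    using KK_bound by blast
  have "((\<lambda>t. C * \<bar>t\<bar> powr (1 - gexp)) \<longlongrightarrow> C * \<bar>0\<bar> powr (1 - gexp)) (at 0)"
    using gexp_bounds by (intro tendsto_intros tendsto_powr2) auto
  then have "((\<lambda>t. C * \<bar>t\<bar> powr (1 - gexp)) \<longlongrightarrow> 0) (at 0)" by simp
  moreover have "\<forall>\<^sub>F t in at 0. norm (KK t) \<le> C * \<bar>t\<bar> powr (1 - gexp)"
    using C(2) by (auto simp: eventually_at dist_real_def intro!: exI[of _ 1])
  ultimately have "(KK \<longlongrightarrow> 0) (at 0)" by (rule Lim_null_comparison[rotated])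
  then show ?thesis using True by (simp add: isCont_def KK_def)
qed

text \<open>The difference quotients of \<open>KK\<close> are dominated by the singularity of the kernel itself, uniformly in
  the increment \<open>d\<close>; this allows differentiation under the integral sign.\<close>

lemma KK_diff_bound:
  "\<exists>C>0. \<forall>t d. t \<noteq> 0 \<longrightarrow> \<bar>t\<bar> \<le> 2 \<longrightarrow> \<bar>t + d\<bar> \<le> 2 \<longrightarrow> \<bar>KK (t + d) - KK t\<bar> \<le> C * \<bar>d\<bar> * \<bar>t\<bar> powr - gexp"
proof -
  obtain C where C: "C > 0" "\<And>t. \<bar>t\<bar> \<le> 2 \<Longrightarrow> \<bar>KK t\<bar> \<le> C * \<bar>t\<bar> powr (1 - gexp)"
    using KK_bound by blast
  have p2: "2 powr gexp \<le> (2::real)" using powr_mono[of gexp 1 "2::real"] gexp_bounds by simp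
  have "\<bar>KK (t + d) - KK t\<bar> \<le> (2 * kC + 10 * C) * \<bar>d\<bar> * \<bar>t\<bar> powr - gexp"
    if t: "t \<noteq> 0" "\<bar>t\<bar> \<le> 2" "\<bar>t + d\<bar> \<le> 2" for t d
  \<comment> \<open>the segment from \<open>t\<close> to \<open>t + d\<close> stays away from \<open>0\<close> in the first case; in the second, both values are small\<close>
  proof (cases "\<bar>d\<bar> \<le> \<bar>t\<bar> / 2")
    case True
    have *: "z \<in> closed_segment t (t + d) \<Longrightarrow> \<bar>t\<bar> / 2 \<le> \<bar>z\<bar> \<and> \<bar>z\<bar> \<le> 2" for z
      using True t by (auto simp: closed_segment_eq_real_ivl split: if_splits)
    have "norm (KK (t + d) - KK t) \<le> (2 * kC * \<bar>t\<bar> powr - gexp) * norm (t + d - t)"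
    proof (rule field_differentiable_bound[of "closed_segment t (t + d)" KK kern])
      fix z assume z: "z \<in> closed_segment t (t + d)"
      note z' = *[OF z]
      then have "z \<noteq> 0" using t by auto
      then show "(KK has_field_derivative kern z) (at z within closed_segment t (t + d))"
        using KK_deriv has_field_derivative_at_within by blast
      have "\<bar>kern z\<bar> \<le> kC * \<bar>z\<bar> powr - gexp" using z' by (intro kern_bound) auto
      also have "\<dots> \<le> kC * (\<bar>t\<bar> / 2) powr - gexp"
        using z' t kC_pos gexp_bounds by (intro mult_left_mono powr_mono2') auto
      also have "\<dots> = kC * (\<bar>t\<bar> powr - gexp * 2 powr gexp)"
        using t by (simp add: powr_divide powr_minus divide_simps)
      also have "\<dots> \<le> kC * (\<bar>t\<bar> powr - gexp * 2)"
        using p2 kC_pos by (intro mult_left_mono) auto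
      finally show "norm (kern z) \<le> 2 * kC * \<bar>t\<bar> powr - gexp" by (simp add: mult_ac)
    qed auto
    also have "\<dots> \<le> (2 * kC + 10 * C) * \<bar>d\<bar> * \<bar>t\<bar> powr - gexp"
      using C(1) kC_pos by (simp add: algebra_simps)
    finally show ?thesis by simp
  next
    case False
    have m: "\<bar>z\<bar> powr (1 - gexp) \<le> 3 * \<bar>d\<bar> powr (1 - gexp)" if "\<bar>z\<bar> \<le> 3 * \<bar>d\<bar>" for z
    proof -
      have "\<bar>z\<bar> powr (1 - gexp) \<le> (3 * \<bar>d\<bar>) powr (1 - gexp)"
        using that gexp_bounds by (intro powr_mono2) auto
      also have "\<dots> = 3 powr (1 - gexp) * \<bar>d\<bar> powr (1 - gexp)" by (simp add: powr_mult)
      also have "\<dots> \<le> 3 powr 1 * \<bar>d\<bar> powr (1 - gexp)"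
        using gexp_bounds by (intro mult_right_mono powr_mono) auto
      finally show ?thesis by simp
    qed
    have d: "d \<noteq> 0" using False t by auto
    have "\<bar>KK (t + d) - KK t\<bar> \<le> \<bar>KK (t + d)\<bar> + \<bar>KK t\<bar>" by simp
    also have "\<dots> \<le> C * \<bar>t + d\<bar> powr (1 - gexp) + C * \<bar>t\<bar> powr (1 - gexp)"
      using C(2) t by (intro add_mono) auto
    also have "\<dots> \<le> C * (3 * \<bar>d\<bar> powr (1 - gexp)) + C * (2 * \<bar>d\<bar> powr (1 - gexp))"
    proof (intro add_mono mult_left_mono m)
      have "\<bar>t\<bar> powr (1 - gexp) \<le> (2 * \<bar>d\<bar>) powr (1 - gexp)"
        using False gexp_bounds by (intro powr_mono2) auto
      also have "\<dots> = 2 powr (1 - gexp) * \<bar>d\<bar> powr (1 - gexp)" by (simp add: powr_mult)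
      also have "\<dots> \<le> 2 powr 1 * \<bar>d\<bar> powr (1 - gexp)"
        using gexp_bounds by (intro mult_right_mono powr_mono) auto
      finally show "\<bar>t\<bar> powr (1 - gexp) \<le> 2 * \<bar>d\<bar> powr (1 - gexp)" by simp
    qed (use False C(1) in auto)
    also have "\<dots> = 5 * C * (\<bar>d\<bar> * \<bar>d\<bar> powr - gexp)" using d by (simp add: powr_diff powr_minus divide_simps)
    also have "\<dots> \<le> 5 * C * (\<bar>d\<bar> * (\<bar>t\<bar> / 2) powr - gexp)"
      using False t C(1) gexp_bounds by (intro mult_left_mono powr_mono2') auto
    also have "(\<bar>t\<bar> / 2) powr - gexp = \<bar>t\<bar> powr - gexp * 2 powr gexp"
      using t by (simp add: powr_divide powr_minus divide_simps)
    also have "5 * C * (\<bar>d\<bar> * (\<bar>t\<bar> powr - gexp * 2 powr gexp)) \<le> 5 * C * (\<bar>d\<bar> * (\<bar>t\<bar> powr - gexp * 2))"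
      using p2 C(1) by (intro mult_left_mono) auto
    also have "\<dots> \<le> (2 * kC + 10 * C) * \<bar>d\<bar> * \<bar>t\<bar> powr - gexp"
      using C(1) kC_pos by (simp add: algebra_simps)
    finally show ?thesis .
  qed
  moreover have "2 * kC + 10 * C > 0" using kC_pos C(1) by simp
  ultimately show ?thesis by blast
qed

text \<open>An integrable majorant, with integral bounded uniformly in \<open>x\<close>, of the product of the kernel singularity at
  \<open>x\<close> and the weight singularities at the end points.\<close>

definition majorant :: "real \<Rightarrow> real \<Rightarrow> real" where
  "majorant x y = \<bar>x - y\<bar> powr - theta + \<bar>1 - y\<bar> powr - theta + \<bar>-1 - y\<bar> powr - theta"

lemma majorant_integrable:
  assumes "\<bar>x\<bar> \<le> 1"
  shows "set_integrable lborel {-1<..<1} (majorant x)"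
    and "(LINT y:{-1<..<1}|lborel. majorant x y) \<le> 12 / (1 - theta)"
proof -
  note i = powr_singularity_integrable[OF gexp_bounds(4,5)]
  have a: "set_integrable lborel {-1<..<1} (\<lambda>y. \<bar>x - y\<bar> powr - theta)"
     "set_integrable lborel {-1<..<1} (\<lambda>y. \<bar>1 - y\<bar> powr - theta)"
     "set_integrable lborel {-1<..<1} (\<lambda>y. \<bar>-1 - y\<bar> powr - theta)"
    using assms by (intro i; simp)+
  then show "set_integrable lborel {-1<..<1} (majorant x)"
    unfolding majorant_def by (intro set_integral_add)
  have "(LINT y:{-1<..<1}|lborel. majorant x y) = (LINT y:{-1<..<1}|lborel. \<bar>x - y\<bar> powr - theta) +
     (LINT y:{-1<..<1}|lborel. \<bar>1 - y\<bar> powr - theta) + (LINT y:{-1<..<1}|lborel. \<bar>-1 - y\<bar> powr - theta)"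
    unfolding majorant_def using a by (subst set_integral_add; (intro set_integral_add)?; simp)+
  also have "\<dots> \<le> 4 / (1 - theta) + 4 / (1 - theta) + 4 / (1 - theta)"
    using assms by (intro add_mono i) auto
  finally show "(LINT y:{-1<..<1}|lborel. majorant x y) \<le> 12 / (1 - theta)" by simp
qed

lemma weight_le_majorant:
  assumes y: "y \<in> {-1<..<1}" and "0 \<le> \<alpha>" "\<alpha> \<le> theta"
  shows "(1 - y\<^sup>2) powr - \<alpha> \<le> \<bar>1 - y\<bar> powr - theta + \<bar>-1 - y\<bar> powr - theta"
proof -
  have w: "0 < 1 - y\<^sup>2" "1 - y\<^sup>2 \<le> 1" using y by (auto simp: power2_less_1_iff abs_square_less_1)
  have "(1 - y\<^sup>2) powr - \<alpha> \<le> (1 - y\<^sup>2) powr - theta"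
    using w assms by (intro powr_mono') auto
  also have "\<dots> \<le> \<bar>1 - y\<bar> powr - theta + \<bar>-1 - y\<bar> powr - theta"
  proof (cases "y \<ge> 0")
    case True
    have "(1 - y) * 1 \<le> (1 - y) * (1 + y)" using True y by (intro mult_left_mono) auto
    then have "\<bar>1 - y\<bar> \<le> 1 - y\<^sup>2" using y by (simp add: power2_eq_square algebra_simps)
    then have "(1 - y\<^sup>2) powr - theta \<le> \<bar>1 - y\<bar> powr - theta"
      using gexp_bounds y by (intro powr_mono2') auto
    then show ?thesis by (smt (verit) powr_ge_zero)
  next
    case False
    have "1 * (1 + y) \<le> (1 - y) * (1 + y)" using False y by (intro mult_right_mono) auto
    then have "\<bar>-1 - y\<bar> \<le> 1 - y\<^sup>2" using y by (simp add: power2_eq_square algebra_simps)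
    then have "(1 - y\<^sup>2) powr - theta \<le> \<bar>-1 - y\<bar> powr - theta"
      using gexp_bounds y by (intro powr_mono2') auto
    then show ?thesis by (smt (verit) powr_ge_zero)
  qed
  finally show ?thesis .
qed

text \<open>The smaller of the distances \<open>\<bar>x - y\<bar>\<close> and \<open>1 - y\<^sup>2\<close> takes the place of the other one.\<close>

lemma majorant_bound:
  assumes y: "y \<in> {-1<..<1}"
  shows "\<bar>x - y\<bar> powr - gexp * (1 - y\<^sup>2) powr (s - 1) \<le> majorant x y"
proof -
  have w: "0 < 1 - y\<^sup>2" "1 - y\<^sup>2 \<le> 1" using y by (auto simp: power2_less_1_iff abs_square_less_1)
  show ?thesis
  proof (cases "\<bar>x - y\<bar> \<le> 1 - y\<^sup>2 \<and> x \<noteq> y")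
    case True
    then have "\<bar>x - y\<bar> powr - gexp * (1 - y\<^sup>2) powr (s - 1) \<le> \<bar>x - y\<bar> powr - gexp * \<bar>x - y\<bar> powr (s - 1)"
      using s_less by (intro mult_left_mono powr_mono2') auto
    also have "\<dots> = \<bar>x - y\<bar> powr - theta"
      unfolding powr_add[symmetric] by (simp add: theta_def algebra_simps)
    finally show ?thesis unfolding majorant_def by (smt (verit) powr_ge_zero)
  next
    case False
    then have "\<bar>x - y\<bar> powr - gexp \<le> (1 - y\<^sup>2) powr - gexp"
      using w gexp_bounds by (cases "x = y") (auto intro!: powr_mono2')
    then have "\<bar>x - y\<bar> powr - gexp * (1 - y\<^sup>2) powr (s - 1) \<le> (1 - y\<^sup>2) powr - gexp * (1 - y\<^sup>2) powr (s - 1)"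
      by (intro mult_right_mono) auto
    also have "\<dots> = (1 - y\<^sup>2) powr - theta"
      unfolding powr_add[symmetric] by (simp add: theta_def algebra_simps)
    also have "\<dots> \<le> \<bar>1 - y\<bar> powr - theta + \<bar>-1 - y\<bar> powr - theta"
      using y gexp_bounds by (intro weight_le_majorant) auto
    finally show ?thesis unfolding majorant_def by (smt (verit) powr_ge_zero)
  qed
qed

end

section \<open>Potentials of densities\<close>

context fractional_order
begin

text \<open>A density: continuous on the open interval, with at most the end point singularities of the derivative
  of \<open>\<omega>\<^sup>s \<phi>\<close> for a smooth function \<open>\<phi>\<close>. \<open>Npot\<close> is the potential of a density.\<close>

definition dens :: "(real \<Rightarrow> 'a::euclidean_space) \<Rightarrow> real \<Rightarrow> bool" where
  "dens \<psi> C \<longleftrightarrow> C \<ge> 0 \<and> continuous_on {-1<..<1} \<psi> \<and> (\<forall>y\<in>{-1<..<1}. norm (\<psi> y) \<le> C * (1 - y\<^sup>2) powr (s - 1))"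

definition Npot :: "(real \<Rightarrow> 'a::euclidean_space) \<Rightarrow> real \<Rightarrow> 'a" where
  "Npot \<psi> x = (LINT y:{-1<..<1}|lborel. kern (x - y) *\<^sub>R \<psi> y)"

lemma kern_measurable [measurable]: "kern \<in> borel_measurable borel"
  unfolding riesz_kernel_def[abs_def] by measurable

lemma set_measurable_continuous:
  fixes f :: "real \<Rightarrow> 'a::real_normed_vector"
  assumes "continuous_on A f" "A \<in> sets borel"
  shows "set_borel_measurable lborel A f"
  unfolding set_borel_measurable_def measurable_lborel2
  by (rule borel_measurable_continuous_on_indicator[OF assms(2,1)])

lemma dens_measurable: "dens \<psi> C \<Longrightarrow> set_borel_measurable lborel {-1<..<1} \<psi>"
  by (rule set_measurable_continuous) (auto simp: dens_def)

lemma set_measurable_scaleR: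
  fixes f :: "real \<Rightarrow> real" and g :: "real \<Rightarrow> 'a::{second_countable_topology,real_normed_vector}"
  assumes [measurable]: "f \<in> borel_measurable borel" and g: "set_borel_measurable lborel A g"
  shows "set_borel_measurable lborel A (\<lambda>x. f x *\<^sub>R g x)"
proof -
  have "(\<lambda>x. f x *\<^sub>R (indicator A x *\<^sub>R g x)) \<in> borel_measurable lborel"
    using g unfolding set_borel_measurable_def by measurable
  then show ?thesis unfolding set_borel_measurable_def by (simp add: mult.commute)
qed

lemma one_minus_sq_pos: "y \<in> {-1<..<1::real} \<Longrightarrow> 0 < 1 - y\<^sup>2" "y \<in> {-1<..<1::real} \<Longrightarrow> 1 - y\<^sup>2 \<le> 1"
  by (auto simp: power2_less_1_iff abs_square_less_1)

lemma dens_kernel_bound: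
  assumes "dens \<psi> C" "\<bar>x\<bar> \<le> 1" "y \<in> {-1<..<1}"
  shows "norm (kern (x - y) *\<^sub>R \<psi> y) \<le> C * kC * majorant x y"
proof -
  have "norm (kern (x - y) *\<^sub>R \<psi> y) \<le> (kC * \<bar>x - y\<bar> powr - gexp) * (C * (1 - y\<^sup>2) powr (s - 1))"
    using assms kern_bound[of "x - y"] kC_pos by (auto simp: dens_def intro!: mult_mono)
  also have "\<dots> = C * kC * (\<bar>x - y\<bar> powr - gexp * (1 - y\<^sup>2) powr (s - 1))" by simp
  also have "\<dots> \<le> C * kC * majorant x y"
    using assms kC_pos by (intro mult_left_mono majorant_bound) (auto simp: dens_def)
  finally show ?thesis .
qed

lemma dens_kernel_integrable:
  assumes "dens \<psi> C" "\<bar>x\<bar> \<le> 1"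
  shows "set_integrable lborel {-1<..<1} (\<lambda>y. kern (x - y) *\<^sub>R \<psi> y)"
    and "norm (Npot \<psi> x) \<le> C * kC * (12 / (1 - theta))"
proof -
  have i: "set_integrable lborel {-1<..<1} (\<lambda>y. C * kC * majorant x y)"
    using majorant_integrable[OF assms(2)] by simp
  have m: "set_borel_measurable lborel {-1<..<1} (\<lambda>y. kern (x - y) *\<^sub>R \<psi> y)"
    by (rule set_measurable_scaleR[OF _ dens_measurable[OF assms(1)]]) measurable
  show "set_integrable lborel {-1<..<1} (\<lambda>y. kern (x - y) *\<^sub>R \<psi> y)"
    using set_integral_dominated(1)[OF i m] dens_kernel_bound[OF assms] by blast
  have "norm (Npot \<psi> x) \<le> (LINT y:{-1<..<1}|lborel. C * kC * majorant x y)"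
    unfolding Npot_def using set_integral_dominated(2)[OF i m] dens_kernel_bound[OF assms] by blast
  also have "\<dots> = C * kC * (LINT y:{-1<..<1}|lborel. majorant x y)" by simp
  also have "\<dots> \<le> C * kC * (12 / (1 - theta))"
    using assms kC_pos by (intro mult_left_mono majorant_integrable) (auto simp: dens_def)
  finally show "norm (Npot \<psi> x) \<le> C * kC * (12 / (1 - theta))" .
qed

lemma dens_mult_integrable:
  assumes \<psi>: "dens \<psi> C" and f: "continuous_on {-1..1} f"
  shows "set_integrable lborel {-1<..<1} (\<lambda>y. f y *\<^sub>R \<psi> y)"
proof -
  have "bounded (f ` {-1..1})" using f by (intro compact_imp_bounded compact_continuous_image) auto
  then obtain B where B: "\<And>y. y \<in> {-1..1} \<Longrightarrow> norm (f y) \<le> B" "B > 0"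
    by (metis bounded_pos imageI)
  have i: "set_integrable lborel {-1<..<1} (\<lambda>y. B * C * majorant 0 y)"
    using majorant_integrable[of 0] by simp
  have "continuous_on {-1<..<1} (\<lambda>y. f y *\<^sub>R \<psi> y)"
    using f \<psi> by (intro continuous_intros) (auto simp: dens_def intro: continuous_on_subset)
  then have m: "set_borel_measurable lborel {-1<..<1} (\<lambda>y. f y *\<^sub>R \<psi> y)"
    by (rule set_measurable_continuous) auto
  have "norm (f y *\<^sub>R \<psi> y) \<le> B * C * majorant 0 y" if y: "y \<in> {-1<..<1}" for y
  proof -
    have "norm (f y *\<^sub>R \<psi> y) \<le> B * (C * (1 - y\<^sup>2) powr (s - 1))"
      using \<psi> y B(1)[of y] B(2) by (auto simp: dens_def intro!: mult_mono)
    also have "\<dots> \<le> B * (C * majorant 0 y)"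
    proof (intro mult_left_mono)
      have "(1 - y\<^sup>2) powr - (1 - s) \<le> \<bar>1 - y\<bar> powr - theta + \<bar>-1 - y\<bar> powr - theta"
        using gexp_bounds s_less y by (intro weight_le_majorant) (auto simp: theta_def)
      then show "(1 - y\<^sup>2) powr (s - 1) \<le> majorant 0 y"
        unfolding majorant_def by (smt (verit) powr_ge_zero)
    qed (use \<psi> B in \<open>auto simp: dens_def\<close>)
    finally show ?thesis by (simp add: mult_ac)
  qed
  then show ?thesis using set_integral_dominated(1)[OF i m] by blast
qed

lemma dens_integrable: "dens \<psi> C \<Longrightarrow> set_integrable lborel {-1<..<1} \<psi>"
  using dens_mult_integrable[of \<psi> C "\<lambda>_. 1"] by simp

lemma continuous_imp_dens:
  assumes "continuous_on {-1..1} \<Psi>"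
  shows "\<exists>C. dens \<Psi> C"
proof -
  have "bounded (\<Psi> ` {-1..1})" using assms by (intro compact_imp_bounded compact_continuous_image) auto
  then obtain B where B: "\<And>y. y \<in> {-1..1} \<Longrightarrow> norm (\<Psi> y) \<le> B" "B > 0"
    by (metis bounded_pos imageI)
  have "norm (\<Psi> y) \<le> B * (1 - y\<^sup>2) powr (s - 1)" if y: "y \<in> {-1<..<1}" for y
  proof -
    have "1 \<le> (1 - y\<^sup>2) powr (s - 1)"
      using one_minus_sq_pos[OF y] s_less powr_mono2'[of "s - 1" "1 - y\<^sup>2" 1] by simp
    then have "B * 1 \<le> B * (1 - y\<^sup>2) powr (s - 1)" using B by (intro mult_left_mono) auto
    with B(1)[of y] y show ?thesis by simp
  qed
  then show ?thesis using B assms by (intro exI[of _ B]) (auto simp: dens_def intro: continuous_on_subset)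
qed

lemma continuous_KK: "continuous_on A (\<lambda>y. KK (x - y))"
  by (intro continuous_at_imp_continuous_on ballI continuous_intros isCont_o2[OF _ isCont_KK])

text \<open>A potential is turned into an integral with the smoother kernel \<open>KK\<close>; the boundary terms vanish.\<close>

lemma Npot_by_parts:
  assumes \<psi>: "dens \<psi> C" and cont: "continuous_on {-1..1} \<Psi>" and ends: "\<Psi> (-1) = 0" "\<Psi> 1 = 0"
    and der: "\<And>y. y \<in> {-1<..<1} \<Longrightarrow> (\<Psi> has_vector_derivative \<psi> y) (at y)"
    and x: "\<bar>x\<bar> \<le> 1"
  shows "Npot \<Psi> x = (LINT y:{-1<..<1}|lborel. KK (x - y) *\<^sub>R \<psi> y)"
proof -
  obtain B where B: "dens \<Psi> B" using continuous_imp_dens[OF cont] by blast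
  have i1: "set_integrable lborel {-1<..<1} (\<lambda>y. KK (x - y) *\<^sub>R \<psi> y)"
    by (rule dens_mult_integrable[OF \<psi> continuous_KK])
  have i2: "set_integrable lborel {-1<..<1} (\<lambda>y. kern (x - y) *\<^sub>R \<Psi> y)"
    by (rule dens_kernel_integrable[OF B x])
  have "(LINT y:{-1<..<1}|lborel. KK (x - y) *\<^sub>R \<psi> y - kern (x - y) *\<^sub>R \<Psi> y)
      = KK (x - 1) *\<^sub>R \<Psi> 1 - KK (x - (-1)) *\<^sub>R \<Psi> (-1)"
  proof (rule set_integral_FTC[of _ _ _ "{x}"])
    show "continuous_on {-1..1} (\<lambda>y. KK (x - y) *\<^sub>R \<Psi> y)"
      by (intro continuous_intros continuous_KK cont)
    fix y assume y: "y \<in> {-1<..<1} - {x}"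
    have "((\<lambda>y. KK (x - y)) has_real_derivative kern (x - y) * (0 - 1)) (at y)"
      using y by (intro DERIV_chain2[OF KK_deriv] derivative_eq_intros) auto
    then show "((\<lambda>y. KK (x - y) *\<^sub>R \<Psi> y) has_vector_derivative
        KK (x - y) *\<^sub>R \<psi> y - kern (x - y) *\<^sub>R \<Psi> y) (at y)"
      using has_vector_derivative_scaleR[of "\<lambda>y. KK (x - y)", OF _ der[of y]] y by fastforce
  qed (use i1 i2 in \<open>auto intro: set_integral_diff\<close>)
  then show ?thesis using ends i1 i2 by (simp add: Npot_def set_integral_diff)
qed

text \<open>The sequential form of differentiability makes dominated convergence applicable.\<close>

lemma has_vector_derivative_via_sequences:
  fixes f :: "real \<Rightarrow> 'a::real_normed_vector"
  assumes "\<And>X. (\<And>n. X n \<noteq> x) \<Longrightarrow> X \<longlonglongrightarrow> x \<Longrightarrow> (\<lambda>n. (f (X n) - f x) /\<^sub>R (X n - x)) \<longlonglongrightarrow> D"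
  shows "(f has_vector_derivative D) (at x)"
proof -
  have "((\<lambda>z. (f z - f x) /\<^sub>R (z - x)) \<longlongrightarrow> D) (at x)"
    unfolding tendsto_at_iff_sequentially using assms by (auto simp: o_def)
  then have "((\<lambda>z. (f z - f x) /\<^sub>R (z - x) - D) \<longlongrightarrow> 0) (at x)"
    by (rule LIM_zero)
  then have "((\<lambda>z. norm ((f z - f x) /\<^sub>R (z - x) - D)) \<longlongrightarrow> 0) (at x)"
    by (rule tendsto_norm_zero)
  moreover have "\<forall>\<^sub>F z in at x. norm ((f z - f x) /\<^sub>R (z - x) - D)
       = norm (f z - f x - (z - x) *\<^sub>R D) / norm (z - x)"
  proof (rule eventually_at_filter[THEN iffD2, OF always_eventually], intro allI impI)
    fix z assume "z \<noteq> x"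
    then have "(f z - f x) /\<^sub>R (z - x) - D = (f z - f x - (z - x) *\<^sub>R D) /\<^sub>R (z - x)"
      by (simp add: scaleR_diff_right)
    then show "norm ((f z - f x) /\<^sub>R (z - x) - D) = norm (f z - f x - (z - x) *\<^sub>R D) / norm (z - x)"
      by (simp add: divide_inverse)
  qed
  ultimately have "((\<lambda>z. norm (f z - f x - (z - x) *\<^sub>R D) / norm (z - x)) \<longlongrightarrow> 0) (at x)"
    by (simp cong: tendsto_cong)
  then show ?thesis
    by (simp add: has_vector_derivative_def has_derivative_iff_norm bounded_linear_scaleR_left)
qed

text \<open>Differentiation commutes with the potential of a function vanishing at \<open>\<plusminus>1\<close>.\<close>

lemma Npot_deriv:
  assumes \<psi>: "dens \<psi> C" and cont: "continuous_on {-1..1} \<Psi>" and ends: "\<Psi> (-1) = 0" "\<Psi> 1 = 0"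
    and der: "\<And>y. y \<in> {-1<..<1} \<Longrightarrow> (\<Psi> has_vector_derivative \<psi> y) (at y)"
    and x: "x \<in> {-1<..<1}"
  shows "(Npot \<Psi> has_vector_derivative Npot \<psi> x) (at x)"
proof -
  define G where "G z = (LINT y:{-1<..<1}|lborel. KK (z - y) *\<^sub>R \<psi> y)" for z
  obtain B where B: "B > 0" "\<And>t d. t \<noteq> 0 \<Longrightarrow> \<bar>t\<bar> \<le> 2 \<Longrightarrow> \<bar>t + d\<bar> \<le> 2 \<Longrightarrow> \<bar>KK (t + d) - KK t\<bar> \<le> B * \<bar>d\<bar> * \<bar>t\<bar> powr - gexp"
    using KK_diff_bound by blast
  have "(G has_vector_derivative Npot \<psi> x) (at x)"
  proof (rule has_vector_derivative_via_sequences)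
    fix X :: "nat \<Rightarrow> real" assume X: "\<And>n. X n \<noteq> x" "X \<longlonglongrightarrow> x"
    obtain N where N: "\<And>n. n \<ge> N \<Longrightarrow> X n \<in> {-1<..<1}"
      using topological_tendstoD[OF X(2), of "{-1<..<1}"] x by (auto simp: eventually_sequentially)
    define Y where "Y n = X (n + N)" for n
    have Y: "Y n \<noteq> x" "Y n \<in> {-1<..<1}" for n using X N by (auto simp: Y_def)
    have Ylim: "Y \<longlonglongrightarrow> x" unfolding Y_def using X(2) by (rule LIMSEQ_ignore_initial_segment)
    define q where "q n y = indicator {-1<..<1} y *\<^sub>R (((KK (Y n - y) - KK (x - y)) / (Y n - x)) *\<^sub>R \<psi> y)" for n y
    have int: "set_integrable lborel {-1<..<1} (\<lambda>y. KK (z - y) *\<^sub>R \<psi> y)" for z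
      by (rule dens_mult_integrable[OF \<psi> continuous_KK])
    have eq: "(G (Y n) - G x) /\<^sub>R (Y n - x) = (LINT y|lborel. q n y)" for n
    proof -
      have "(G (Y n) - G x) /\<^sub>R (Y n - x) =
         (LINT y:{-1<..<1}|lborel. (KK (Y n - y) *\<^sub>R \<psi> y - KK (x - y) *\<^sub>R \<psi> y) /\<^sub>R (Y n - x))"
        unfolding G_def by (simp add: int set_integral_diff)
      also have "\<dots> = (LINT y|lborel. q n y)"
        unfolding set_lebesgue_integral_def q_def
        by (intro Bochner_Integration.integral_cong) (auto simp: divide_inverse algebra_simps)
      finally show ?thesis .
    qed
    have "(\<lambda>n. LINT y|lborel. q n y) \<longlonglongrightarrow> (LINT y|lborel. indicator {-1<..<1} y *\<^sub>R (kern (x - y) *\<^sub>R \<psi> y))"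
    proof (rule integral_dominated_convergence[where w = "\<lambda>y. indicator {-1<..<1} y *\<^sub>R (B * C * majorant x y)"])
      show "(\<lambda>y. indicator {-1<..<1} y *\<^sub>R (kern (x - y) *\<^sub>R \<psi> y)) \<in> borel_measurable lborel"
        using dens_kernel_integrable(1)[OF \<psi>, of x] x by (auto simp: set_integrable_def)
      show "integrable lborel (\<lambda>y. indicator {-1<..<1} y *\<^sub>R (B * C * majorant x y))"
        unfolding set_integrable_def[symmetric]
        using majorant_integrable(1)[of x] x by (intro set_integrable_mult_right) auto
      show "q n \<in> borel_measurable lborel" for n
      proof -
        have "continuous_on {-1..1} (\<lambda>y. (KK (Y n - y) - KK (x - y)) / (Y n - x))"
          using Y by (intro continuous_intros continuous_KK) auto
        from dens_mult_integrable[OF \<psi> this] show ?thesis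
          unfolding q_def[abs_def] set_integrable_def by (rule borel_measurable_integrable)
      qed
      have ae: "AE y in lborel. y \<noteq> x" by (rule AE_lborel_singleton)
      show "AE y in lborel. (\<lambda>n. q n y) \<longlonglongrightarrow> indicator {-1<..<1} y *\<^sub>R (kern (x - y) *\<^sub>R \<psi> y)"
        using ae
      proof eventually_elim
        case (elim y)
        have "((\<lambda>z. KK (z - y)) has_real_derivative kern (x - y) * 1) (at x)"
          using elim by (intro DERIV_chain2[OF KK_deriv]) (auto intro!: derivative_eq_intros)
        then have "((\<lambda>z. (KK (z - y) - KK (x - y)) / (z - x)) \<longlongrightarrow> kern (x - y)) (at x)"
          by (simp add: has_field_derivative_iff)
        then have "(\<lambda>n. (KK (Y n - y) - KK (x - y)) / (Y n - x)) \<longlonglongrightarrow> kern (x - y)"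
          using Y Ylim unfolding tendsto_at_iff_sequentially by (auto simp: o_def)
        then show ?case unfolding q_def by (intro tendsto_intros)
      qed
      show "AE y in lborel. norm (q n y) \<le> indicator {-1<..<1} y *\<^sub>R (B * C * majorant x y)" for n
        using ae
      proof eventually_elim
        case (elim y)
        show ?case
        proof (cases "y \<in> {-1<..<1}")
          case True
          have "\<bar>KK ((x - y) + (Y n - x)) - KK (x - y)\<bar> \<le> B * \<bar>Y n - x\<bar> * \<bar>x - y\<bar> powr - gexp"
            using elim x Y[of n] True by (intro B(2)) auto
          then have "\<bar>(KK (Y n - y) - KK (x - y)) / (Y n - x)\<bar> \<le> B * \<bar>x - y\<bar> powr - gexp"
            using Y[of n] by (simp add: field_simps)
          moreover have "norm (\<psi> y) \<le> C * (1 - y\<^sup>2) powr (s - 1)" using True \<psi> by (simp add: dens_def)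
          moreover have "norm (q n y) = \<bar>(KK (Y n - y) - KK (x - y)) / (Y n - x)\<bar> * norm (\<psi> y)"
            unfolding q_def using True by simp
          ultimately have "norm (q n y) \<le> (B * \<bar>x - y\<bar> powr - gexp) * (C * (1 - y\<^sup>2) powr (s - 1))"
            using B(1) by (metis mult_mono abs_ge_zero norm_ge_zero order_trans)
          also have "\<dots> = B * C * (\<bar>x - y\<bar> powr - gexp * (1 - y\<^sup>2) powr (s - 1))" by simp
          also have "\<dots> \<le> B * C * majorant x y"
            using True B(1) \<psi> by (intro mult_left_mono majorant_bound) (auto simp: dens_def)
          finally show ?thesis using True by simp
        qed (simp add: q_def)
      qed
    qed
    then have "(\<lambda>n. (G (Y n) - G x) /\<^sub>R (Y n - x)) \<longlonglongrightarrow> Npot \<psi> x"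
      unfolding eq Npot_def set_lebesgue_integral_def .
    then show "(\<lambda>n. (G (X n) - G x) /\<^sub>R (X n - x)) \<longlonglongrightarrow> Npot \<psi> x"
      unfolding Y_def by (rule LIMSEQ_offset)
  qed
  then show ?thesis
  proof (rule has_vector_derivative_transform_within_open[of _ _ _ "{-1<..<1}"])
    show "G z = Npot \<Psi> z" if "z \<in> {-1<..<1}" for z
      unfolding G_def using Npot_by_parts[OF \<psi> cont ends der] that by auto
  qed (use x in auto)
qed

lemma set_integral_comb4:
  fixes f1 f2 f3 f4 :: "real \<Rightarrow> 'a::euclidean_space"
  assumes "set_integrable lborel A f1" "set_integrable lborel A f2" "set_integrable lborel A f3" "set_integrable lborel A f4"
  shows "(LINT y:A|lborel. a *\<^sub>R f1 y - b *\<^sub>R f2 y - c *\<^sub>R f3 y + f4 y) =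
    a *\<^sub>R (LINT y:A|lborel. f1 y) - b *\<^sub>R (LINT y:A|lborel. f2 y) - c *\<^sub>R (LINT y:A|lborel. f3 y) + (LINT y:A|lborel. f4 y)"
  using assms by (simp add: set_integral_add set_integral_diff)

text \<open>Multiplication by the variable: \<open>(y \<Psi>)' = y \<psi> + \<Psi>\<close>, and
  \<open>y k(x - y) = x k(x - y) - (2 - 2s) KK(x - y) - delta (x - y)\<close> by the definition of \<open>KK\<close>.\<close>

lemma Npot_mult:
  assumes \<psi>: "dens \<psi> C" and cont: "continuous_on {-1..1} \<Psi>" and ends: "\<Psi> (-1) = 0" "\<Psi> 1 = 0"
    and der: "\<And>y. y \<in> {-1<..<1} \<Longrightarrow> (\<Psi> has_vector_derivative \<psi> y) (at y)"
    and x: "\<bar>x\<bar> \<le> 1"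
  shows "Npot (\<lambda>y. y *\<^sub>R \<psi> y + \<Psi> y) x =
     x *\<^sub>R Npot \<psi> x - (1 - 2 * s) *\<^sub>R Npot \<Psi> x - delta *\<^sub>R (LINT y:{-1<..<1}|lborel. \<Psi> y)"
proof -
  let ?I = "\<lambda>f. (LINT y:{-1<..<1}|lborel. f y)"
  obtain B where B: "dens \<Psi> B" using continuous_imp_dens[OF cont] by blast
  have i\<psi>: "set_integrable lborel {-1<..<1} (\<lambda>y. kern (x - y) *\<^sub>R \<psi> y)" by (rule dens_kernel_integrable[OF \<psi> x])
  have i\<Psi>: "set_integrable lborel {-1<..<1} (\<lambda>y. kern (x - y) *\<^sub>R \<Psi> y)" by (rule dens_kernel_integrable[OF B x])
  have iK: "set_integrable lborel {-1<..<1} (\<lambda>y. KK (x - y) *\<^sub>R \<psi> y)"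
    by (rule dens_mult_integrable[OF \<psi> continuous_KK])
  have ix: "set_integrable lborel {-1<..<1} (\<lambda>y. (x - y) *\<^sub>R \<psi> y)"
    by (rule dens_mult_integrable[OF \<psi>]) (intro continuous_intros)
  note iP = dens_integrable[OF B]
  have "?I (\<lambda>y. (x - y) *\<^sub>R \<psi> y - \<Psi> y) = (x - 1) *\<^sub>R \<Psi> 1 - (x - (-1)) *\<^sub>R \<Psi> (-1)"
  proof (rule set_integral_FTC[of _ _ _ "{}"])
    show "continuous_on {-1..1} (\<lambda>y. (x - y) *\<^sub>R \<Psi> y)"
      by (intro continuous_intros cont)
    fix y :: real assume y: "y \<in> {-1<..<1} - {}"
    have "((\<lambda>y::real. x - y) has_real_derivative (0 - 1)) (at y)"
      by (intro derivative_eq_intros) auto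
    then show "((\<lambda>y. (x - y) *\<^sub>R \<Psi> y) has_vector_derivative (x - y) *\<^sub>R \<psi> y - \<Psi> y) (at y)"
      using has_vector_derivative_scaleR[of "\<lambda>y. x - y", OF _ der[of y]] y by fastforce
  qed (use ix iP in \<open>auto intro: set_integral_diff\<close>)
  then have e1: "?I (\<lambda>y. (x - y) *\<^sub>R \<psi> y) = ?I \<Psi>" using ends ix iP by (simp add: set_integral_diff)
  have e2: "?I (\<lambda>y. KK (x - y) *\<^sub>R \<psi> y) = Npot \<Psi> x"
    using Npot_by_parts[OF \<psi> cont ends der x] by simp
  have "?I (\<lambda>y. kern (x - y) *\<^sub>R (y *\<^sub>R \<psi> y + \<Psi> y)) =
     ?I (\<lambda>y. x *\<^sub>R (kern (x - y) *\<^sub>R \<psi> y) - (2 - 2 * s) *\<^sub>R (KK (x - y) *\<^sub>R \<psi> y) - delta *\<^sub>R ((x - y) *\<^sub>R \<psi> y) + kern (x - y) *\<^sub>R \<Psi> y)"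
  proof (rule set_lebesgue_integral_cong)
    show "\<forall>y. y \<in> {-1<..<1} \<longrightarrow> kern (x - y) *\<^sub>R (y *\<^sub>R \<psi> y + \<Psi> y) =
      x *\<^sub>R (kern (x - y) *\<^sub>R \<psi> y) - (2 - 2 * s) *\<^sub>R (KK (x - y) *\<^sub>R \<psi> y) - delta *\<^sub>R ((x - y) *\<^sub>R \<psi> y) + kern (x - y) *\<^sub>R \<Psi> y"
    proof (intro allI impI)
      fix y
      have "(2 - 2 * s) * KK (x - y) = (x - y) * kern (x - y) - delta * (x - y)"
        using s_less by (simp add: KK_def)
      then have "kern (x - y) * y = x * kern (x - y) - (2 - 2 * s) * KK (x - y) - delta * (x - y)"
        by (simp add: algebra_simps)
      then show "kern (x - y) *\<^sub>R (y *\<^sub>R \<psi> y + \<Psi> y) =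
        x *\<^sub>R (kern (x - y) *\<^sub>R \<psi> y) - (2 - 2 * s) *\<^sub>R (KK (x - y) *\<^sub>R \<psi> y) - delta *\<^sub>R ((x - y) *\<^sub>R \<psi> y) + kern (x - y) *\<^sub>R \<Psi> y"
        by (simp add: scaleR_add_right scaleR_diff_left scaleR_diff_right right_diff_distrib)
    qed
  qed simp
  also have "\<dots> = x *\<^sub>R Npot \<psi> x - (2 - 2 * s) *\<^sub>R Npot \<Psi> x - delta *\<^sub>R ?I \<Psi> + Npot \<Psi> x"
    by (subst set_integral_comb4[OF i\<psi> iK ix i\<Psi>]) (simp add: e1 e2 Npot_def)
  also have "\<dots> = x *\<^sub>R Npot \<psi> x - (1 - 2 * s) *\<^sub>R Npot \<Psi> x - delta *\<^sub>R ?I \<Psi>"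
    by (simp add: scaleR_diff_left scaleR_2)
  finally show ?thesis by (simp add: Npot_def)
qed

end

section \<open>The operator on polynomials\<close>

lemma poly_eq_on_interval:
  fixes p q :: "real poly"
  assumes "\<And>x. x \<in> {-1<..<1} \<Longrightarrow> poly p x = poly q x"
  shows "p = q"
proof (rule ccontr)
  assume "p \<noteq> q"
  then have "finite {x. poly (p - q) x = 0}" by (intro poly_roots_finite) simp
  moreover have "{-1<..<1} \<subseteq> {x. poly (p - q) x = 0}" using assms by auto
  ultimately have "finite {-1<..<1::real}" by (rule finite_subset[rotated])
  then show False by (simp add: infinite_Ioo)
qed

lemma poly_derivative_sum: "pderiv (\<Sum>i\<in>A. f i) = (\<Sum>i\<in>A. pderiv (f i))"
  by (induction A rule: infinite_finite_induct) (simp_all add: pderiv_add)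

lemma pderiv_surj: "\<exists>v. pderiv v = (u :: real poly)"
proof
  let ?v = "\<Sum>i\<le>degree u. monom (coeff u i / (1 + real i)) (Suc i)"
  have "pderiv ?v = (\<Sum>i\<le>degree u. monom (coeff u i) i)"
    by (simp add: poly_derivative_sum pderiv_monom del: of_nat_Suc) (simp add: add_nonneg_eq_0_iff)
  then show "pderiv ?v = u" by (simp add: poly_as_sum_of_monoms)
qed

lemma set_integral_reflect:
  fixes f :: "real \<Rightarrow> 'a::{banach,second_countable_topology}"
  shows "(LINT y:{-1<..<1}|lborel. f (- y)) = (LINT y:{-1<..<1}|lborel. f y)"
proof -
  have "(LINT y|lborel. indicator {-1<..<1} y *\<^sub>R f y) =
      \<bar>-1\<bar> *\<^sub>R (LINT y|lborel. indicator {-1<..<1} (0 + (-1) * y) *\<^sub>R f (0 + (-1) * y))"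
    by (rule lborel_integral_real_affine) simp
  moreover have "indicator {-1<..<1} (- y) = (indicator {-1<..<1} y :: real)" for y :: real
    by (auto simp: indicator_def)
  ultimately show ?thesis by (simp add: set_lebesgue_integral_def)
qed

text \<open>The polynomials \<open>X\<close> and \<open>1 - X\<^sup>2\<close>.\<close>

definition PX :: "real poly" where "PX = [:0, 1:]"
definition PX2 :: "real poly" where "PX2 = 1 - PX * PX"

lemma poly_PX [simp]: "poly PX x = x" and poly_PX2 [simp]: "poly PX2 x = 1 - x\<^sup>2"
  by (simp_all add: PX_def PX2_def power2_eq_square)

lemma pderiv_PX [simp]: "pderiv PX = 1" and pderiv_PX2 [simp]: "pderiv PX2 = smult (-2) PX"
  by (simp_all add: PX_def PX2_def pderiv_pCons pderiv_diff pderiv_mult one_pCons)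

lemma pCons_eq_PX: "pCons a p = smult a 1 + PX * p"
  by (simp add: PX_def one_pCons)

context fractional_order
begin

text \<open>The weighted polynomial \<open>wt p = \<omega>\<^sup>s p\<close> has the derivative \<open>wt' p = (1 - y\<^sup>2) powr (s - 1) * dp p\<close>. Its
  potential is \<open>V p\<close>, the potential of its derivative is \<open>U p\<close>, and its integral is \<open>W p\<close>.\<close>

definition wt :: "real poly \<Rightarrow> real \<Rightarrow> real" where "wt p y = omega s y * poly p y"
definition dp :: "real poly \<Rightarrow> real poly" where "dp p = PX2 * pderiv p - smult (2 * s) (PX * p)"
definition wt' :: "real poly \<Rightarrow> real \<Rightarrow> real" where "wt' p y = (1 - y\<^sup>2) powr (s - 1) * poly (dp p) y"
definition U :: "real poly \<Rightarrow> real \<Rightarrow> real" where "U p = Npot (wt' p)"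
definition V :: "real poly \<Rightarrow> real \<Rightarrow> real" where "V p = Npot (wt p)"
definition W :: "real poly \<Rightarrow> real" where "W p = (LINT y:{-1<..<1}|lborel. wt p y)"

lemma wt_cont: "continuous_on {-1..1} (wt p)"
proof -
  have "continuous_on {-1..1} (\<lambda>y::real. (1 - y\<^sup>2) powr s)"
    using s_pos by (intro continuous_on_powr' continuous_intros) (auto simp: abs_square_le_1 abs_le_iff)
  then show ?thesis unfolding wt_def[abs_def] omega_def
    by (rule continuous_on_mult) (intro continuous_intros)
qed

lemma wt_ends [simp]: "wt p (-1) = 0" "wt p 1 = 0"
  by (simp_all add: wt_def omega_def)

lemma wt_deriv:
  assumes "y \<in> {-1<..<1}"
  shows "(wt p has_real_derivative wt' p y) (at y)"
proof -
  note pos = one_minus_sq_pos[OF assms]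
  have "((\<lambda>y. (1 - y\<^sup>2) powr s) has_real_derivative s * (1 - y\<^sup>2) powr (s - 1) * (- 2 * y)) (at y)"
    using pos by (intro DERIV_chain2[OF has_real_derivative_powr]) (auto intro!: derivative_eq_intros)
  from DERIV_mult[OF this poly_DERIV[of p y]]
  have "(wt p has_real_derivative s * (1 - y\<^sup>2) powr (s - 1) * (- 2 * y) * poly p y + poly (pderiv p) y * (1 - y\<^sup>2) powr s) (at y)"
    by (simp add: wt_def[abs_def] omega_def)
  moreover have "(1 - y\<^sup>2) powr s = (1 - y\<^sup>2) powr (s - 1) * (1 - y\<^sup>2)"
    using pos by (simp add: powr_diff)
  then have "s * (1 - y\<^sup>2) powr (s - 1) * (- 2 * y) * poly p y + poly (pderiv p) y * (1 - y\<^sup>2) powr s = wt' p y"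
    by (simp add: wt'_def dp_def power2_eq_square) (simp add: algebra_simps)
  ultimately show ?thesis by simp
qed

lemma dens_wt': "\<exists>C. dens (wt' p) C"
proof -
  have "bounded (poly (dp p) ` {-1..1})"
    by (intro compact_imp_bounded compact_continuous_image continuous_intros) auto
  then obtain B where B: "\<And>y. y \<in> {-1..1} \<Longrightarrow> norm (poly (dp p) y) \<le> B" "B > 0"
    by (metis bounded_pos imageI)
  have "continuous_on {-1<..<1} (wt' p)"
    unfolding wt'_def[abs_def]
    by (intro continuous_intros) (auto simp: power2_eq_1_iff)
  moreover have "norm (wt' p y) \<le> B * (1 - y\<^sup>2) powr (s - 1)" if "y \<in> {-1<..<1}" for y
    using B(1)[of y] that by (simp add: wt'_def abs_mult mult.commute mult_right_mono)
  ultimately show ?thesis using B(2) by (intro exI[of _ B]) (auto simp: dens_def)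
qed

lemma dens_wt: "\<exists>C. dens (wt p) C"
  by (rule continuous_imp_dens[OF wt_cont])

lemma wt_deriv_vec: "y \<in> {-1<..<1} \<Longrightarrow> (wt p has_vector_derivative wt' p y) (at y)"
  using wt_deriv by (simp add: has_real_derivative_iff_has_vector_derivative)

lemma Npot_add:
  assumes "dens f B" "dens g C" "\<bar>x\<bar> \<le> 1"
  shows "Npot (\<lambda>y. f y + g y) x = Npot f x + Npot g x"
  using dens_kernel_integrable(1)[OF assms(1,3)] dens_kernel_integrable(1)[OF assms(2,3)]
  by (simp add: Npot_def scaleR_add_right set_integral_add)

lemma Npot_scaleR: "Npot (\<lambda>y. c *\<^sub>R f y) x = c *\<^sub>R Npot f x"
  unfolding Npot_def by (simp add: mult.commute flip: set_integral_scaleR_right)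

lemma dp_add: "dp (p + q) = dp p + dp q"
  by (simp add: dp_def pderiv_add algebra_simps smult_add_right)
lemma dp_smult: "dp (smult c p) = smult c (dp p)"
  by (simp only: dp_def pderiv_smult mult_smult_right smult_diff_right smult_smult mult.commute[of c])

lemma wt'_add: "wt' (p + q) = (\<lambda>y. wt' p y + wt' q y)"
  by (simp add: wt'_def[abs_def] dp_add algebra_simps)
lemma wt'_smult: "wt' (smult c p) = (\<lambda>y. c *\<^sub>R wt' p y)"
  by (simp add: wt'_def[abs_def] dp_smult algebra_simps)
lemma wt_smult: "wt (smult c p) = (\<lambda>y. c *\<^sub>R wt p y)"
  by (simp add: wt_def[abs_def] algebra_simps)

lemma U_add: "\<bar>x\<bar> \<le> 1 \<Longrightarrow> U (p + q) x = U p x + U q x"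
  unfolding U_def wt'_add using dens_wt'[of p] dens_wt'[of q] Npot_add by blast
lemma U_smult: "U (smult c p) x = c * U p x"
  unfolding U_def wt'_smult Npot_scaleR by simp
lemma V_smult: "V (smult c p) x = c * V p x"
  unfolding V_def wt_smult Npot_scaleR by simp

lemma V_deriv:
  assumes "x \<in> {-1<..<1}"
  shows "(V p has_real_derivative U p x) (at x)"
proof -
  obtain C where "dens (wt' p) C" using dens_wt' by blast
  from Npot_deriv[OF this wt_cont wt_ends wt_deriv_vec assms]
  show ?thesis by (simp add: V_def U_def has_real_derivative_iff_has_vector_derivative)
qed

lemma U_mult_X:
  assumes "\<bar>x\<bar> \<le> 1"
  shows "U (PX * p) x = x * U p x - (1 - 2 * s) * V p x - delta * W p"
proof -
  obtain C where C: "dens (wt' p) C" using dens_wt' by blast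
  have eq: "wt' (PX * p) y = y *\<^sub>R wt' p y + wt p y" if y: "y \<in> {-1<..<1}" for y
  proof -
    have e: "(1 - y\<^sup>2) powr s = (1 - y\<^sup>2) powr (s - 1) * (1 - y\<^sup>2)"
      using one_minus_sq_pos[OF y] by (simp add: powr_diff)
    have d: "poly (pderiv (PX * p)) y = poly p y + y * poly (pderiv p) y"
      by (subst pderiv_mult) (simp add: pderiv_pCons)
    show ?thesis
      unfolding wt'_def wt_def dp_def omega_def e poly_diff poly_mult poly_smult d
      by (simp add: algebra_simps power2_eq_square)
  qed
  have "U (PX * p) x = Npot (\<lambda>y. y *\<^sub>R wt' p y + wt p y) x"
    unfolding U_def Npot_def by (intro set_lebesgue_integral_cong) (auto simp: eq)
  also have "\<dots> = x * U p x - (1 - 2 * s) * V p x - delta * W p"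
    using Npot_mult[OF C wt_cont wt_ends wt_deriv_vec assms]
    by (simp add: U_def V_def W_def)
  finally show ?thesis .
qed

text \<open>The factor \<open>1 - X\<^sup>2\<close> cancels the end point singularity: the derivative of \<open>\<omega>\<^sup>s (1 - X\<^sup>2) p\<close> is again a
  weighted polynomial.\<close>

lemma U_mult_X2:
  "U (PX2 * p) x = V (PX2 * pderiv p - smult (2 * s + 2) (PX * p)) x"
proof -
  have eq: "wt' (PX2 * p) y = wt (PX2 * pderiv p - smult (2 * s + 2) (PX * p)) y" if y: "y \<in> {-1<..<1}" for y
  proof -
    have e: "(1 - y\<^sup>2) powr s = (1 - y\<^sup>2) powr (s - 1) * (1 - y\<^sup>2)"
      using one_minus_sq_pos[OF y] by (simp add: powr_diff)
    have d: "poly (pderiv (PX2 * p)) y = (1 - y\<^sup>2) * poly (pderiv p) y - 2 * y * poly p y"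
      by (subst pderiv_mult) (simp add: pderiv_pCons power2_eq_square algebra_simps)
    show ?thesis
      unfolding wt'_def wt_def dp_def omega_def e poly_diff poly_mult poly_smult d
      by (simp add: algebra_simps power2_eq_square)
  qed
  show ?thesis
    unfolding U_def V_def Npot_def by (intro set_lebesgue_integral_cong) (auto simp: eq)
qed

lemma W_X: "W PX = 0"
proof -
  have "W PX = (LINT y:{-1<..<1}|lborel. - (wt PX (- y)))"
    unfolding W_def by (intro set_lebesgue_integral_cong) (auto simp: wt_def omega_def)
  also have "\<dots> = - (LINT y:{-1<..<1}|lborel. wt PX (- y))" by (simp add: set_lebesgue_integral_def)
  also have "\<dots> = - W PX" unfolding W_def by (simp add: set_integral_reflect)
  finally show ?thesis by simp
qed

lemma U_1_0: "U 1 0 = 0"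
proof -
  have "U 1 0 = (LINT y:{-1<..<1}|lborel. - (kern (0 - (- y)) *\<^sub>R wt' 1 (- y)))"
    unfolding U_def Npot_def
    by (intro set_lebesgue_integral_cong) (auto simp: wt'_def dp_def)
  also have "\<dots> = - (LINT y:{-1<..<1}|lborel. kern (0 - (- y)) *\<^sub>R wt' 1 (- y))" by (simp add: set_lebesgue_integral_def)
  also have "\<dots> = - U 1 0" unfolding U_def Npot_def by (subst set_integral_reflect) simp
  finally show ?thesis by simp
qed

text \<open>The value of \<open>L 1\<close>, that is, the slope of \<open>U 1\<close>; the right-hand side is what the proof of \<open>U_1\<close> yields
  for the derivative of \<open>U 1\<close> at \<open>0\<close>.\<close>

definition ell0 :: real where "ell0 = 2 * ((1 - 2 * s) * V 1 0 + delta * W 1)"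

text \<open>\<open>ell0\<close> is a nonzero multiple of the integral of the nonnegative function \<open>\<bar>y\<bar> powr (1 - 2s) * \<omega>\<^sup>s\<close>.\<close>

lemma ell0_nonzero: "ell0 \<noteq> 0"
proof
  assume "ell0 = 0"
  obtain C where C: "dens (wt 1) C" using dens_wt by blast
  let ?f = "\<lambda>y. indicator {-1<..<1} y * (\<bar>y\<bar> powr (1 - 2 * s) * omega s y)"
  have i1: "set_integrable lborel {-1<..<1} (\<lambda>y. kern (0 - y) *\<^sub>R wt 1 y)"
    by (rule dens_kernel_integrable[OF C]) simp
  have i2: "set_integrable lborel {-1<..<1} (wt 1)" by (rule dens_integrable[OF C])
  have i3: "set_integrable lborel {-1<..<1} (\<lambda>y. (1 - 2 * s) * (kern (0 - y) *\<^sub>R wt 1 y) + delta * wt 1 y)"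
    using i1 i2 by (intro set_integral_add set_integrable_mult_right) auto
  have pt: "(1 - 2 * s) * (kern (0 - y) *\<^sub>R wt 1 y) + delta * wt 1 y = kappa * (\<bar>y\<bar> powr (1 - 2 * s) * omega s y)"
    if "y \<noteq> 0" for y
  proof -
    have "(1 - 2 * s) * (kern (0 - y) *\<^sub>R wt 1 y) + delta * wt 1 y = ((1 - 2 * s) * kern y + delta) * omega s y"
      by (simp add: wt_def algebra_simps)
    also have "\<dots> = kappa * \<bar>y\<bar> powr (1 - 2 * s) * omega s y"
      using hker_eq[OF that] by (simp add: hker_def)
    finally show ?thesis by simp
  qed
  have "(1 - 2 * s) * V 1 0 + delta * W 1 = (LINT y:{-1<..<1}|lborel. (1 - 2 * s) * (kern (0 - y) *\<^sub>R wt 1 y) + delta * wt 1 y)"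
    using i1 i2 by (simp add: V_def Npot_def W_def set_integral_add)
  also have "\<dots> = (LINT y:{-1<..<1}|lborel. kappa * (\<bar>y\<bar> powr (1 - 2 * s) * omega s y))"
  proof (rule set_lebesgue_integral_cong_AE)
    show "AE y\<in>{-1<..<1} in lborel. (1 - 2 * s) * (kern (0 - y) *\<^sub>R wt 1 y) + delta * wt 1 y = kappa * (\<bar>y\<bar> powr (1 - 2 * s) * omega s y)"
      using AE_lborel_singleton[of 0]
    proof eventually_elim
      case (elim y)
      show ?case using pt[OF elim] by simp
    qed
  qed (auto simp: wt_def[abs_def] omega_def)
  also have "\<dots> = kappa * (LINT y|lborel. ?f y)"
    by (simp add: set_lebesgue_integral_def mult.left_commute)
  finally have z: "(LINT y|lborel. ?f y) = 0"
    using \<open>ell0 = 0\<close> kappa_nonzero by (simp add: ell0_def)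
  have "integrable lborel ?f"
  proof -
    have "integrable lborel (\<lambda>y. indicator {-1<..<1} y *\<^sub>R (kappa * (\<bar>y\<bar> powr (1 - 2 * s) * omega s y)))"
      using i3 unfolding set_integrable_def
    proof (rule integrable_cong_AE_imp)
      show "AE y in lborel. indicator {-1<..<1} y *\<^sub>R ((1 - 2 * s) * (kern (0 - y) *\<^sub>R wt 1 y) + delta * wt 1 y) =
          indicator {-1<..<1} y *\<^sub>R (kappa * (\<bar>y\<bar> powr (1 - 2 * s) * omega s y))"
        using AE_lborel_singleton[of 0]
      proof eventually_elim
        case (elim y)
        show ?case using pt[OF elim] by simp
      qed
    qed (auto simp: omega_def)
    then have "integrable lborel (\<lambda>y. inverse kappa * (indicator {-1<..<1} y *\<^sub>R (kappa * (\<bar>y\<bar> powr (1 - 2 * s) * omega s y))))"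
      by (rule integrable_mult_right)
    then show ?thesis using kappa_nonzero by (simp add: mult.left_commute)
  qed
  then have "AE y in lborel. ?f y = 0"
    using z by (subst (asm) integral_nonneg_eq_0_iff_AE) (auto simp: omega_def)
  then have "AE y in lborel. y \<notin> {0<..<1::real}"
    by eventually_elim (auto simp: omega_def indicator_def power2_eq_1_iff)
  then have "emeasure lborel {0<..<1::real} = 0"
    by (subst (asm) AE_iff_measurable[of "{0<..<1}"]) auto
  then show False by simp
qed

text \<open>Let \<open>a = V 1\<close>, \<open>b = V X\<close> and \<open>c = U 1\<close>, so that \<open>a' = c\<close> and \<open>b' = U X\<close>. The two multiplication rules give
  \<open>U X\<close> and \<open>(x\<^sup>2 - 1) c\<close> in terms of \<open>a\<close>, \<open>b\<close> and \<open>x\<close>; differentiating twice, one finds \<open>g = c'\<close> and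
  \<open>(x\<^sup>2 - 1) g' = 2s (c - x g)\<close>. Then \<open>(x g - c) (1 - x\<^sup>2) powr s\<close> is constant, and it is \<open>0\<close> since
  \<open>c\<close> vanishes at \<open>0\<close>; so \<open>x g = c\<close>, hence \<open>g' = 0\<close> and \<open>c = g(0) x\<close>.\<close>

lemma U_1: "x \<in> {-1<..<1} \<Longrightarrow> U 1 x = ell0 * x"
proof -
  let ?I = "{-1<..<1::real}"
  define a b c where "a = V 1" and "b = V PX" and "c = U 1"
  define w where "w = delta * W 1"
  have UX: "U PX x = x * c x - (1 - 2 * s) * a x - w" if "x \<in> ?I" for x
    using U_mult_X[of x 1] that by (simp add: a_def c_def w_def abs_le_iff)
  have e3: "x * U PX x - c x = 3 * b x" if "x \<in> ?I" for x
  proof -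
    have "U (PX * PX) x = x * U PX x - (1 - 2 * s) * b x"
      using U_mult_X[of x PX] that by (simp add: W_X b_def abs_le_iff)
    moreover have "U (PX2 * 1) x = - (2 * s + 2) * b x"
    proof -
      have "PX2 * pderiv 1 - smult (2 * s + 2) (PX * 1) = smult (- (2 * s + 2)) PX"
        by (simp only: smult_minus_left pderiv_1 mult_zero_right mult_1_right diff_0)
      then show ?thesis
        using U_mult_X2[of 1 x] V_smult[of "- (2 * s + 2)" PX x] by (simp only: b_def)
    qed
    moreover have "PX2 * 1 = 1 + smult (-1) (PX * PX)" by (simp add: PX2_def)
    moreover have "\<bar>x\<bar> \<le> 1" using that by (simp add: abs_le_iff)
    ultimately have "U (PX2 * 1) x = c x + (-1) * U (PX * PX) x"
      and "U (PX * PX) x = x * U PX x - (1 - 2 * s) * b x" and "U (PX2 * 1) x = - (2 * s + 2) * b x"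
      by (simp_all only: U_add U_smult c_def)
    then show ?thesis by (simp add: algebra_simps)
  qed
  have nz: "x\<^sup>2 - 1 \<noteq> 0" if "x \<in> ?I" for x :: real using that by (auto simp: power2_eq_1_iff)
  have c_eq: "c x = (3 * b x + (1 - 2 * s) * x * a x + w * x) / (x\<^sup>2 - 1)" if "x \<in> ?I" for x
    using e3[OF that] UX[OF that] nz[OF that]
    by (simp add: field_simps power2_eq_square)
  define g where "g x = ((2 - 2 * s) * x * c x - 2 * (1 - 2 * s) * a x - 2 * w) / (x\<^sup>2 - 1)" for x
  have da: "(a has_real_derivative c x) (at x)" if "x \<in> ?I" for x
    using V_deriv[OF that] by (simp add: a_def c_def)
  have db: "(b has_real_derivative U PX x) (at x)" if "x \<in> ?I" for x
    using V_deriv[OF that] by (simp add: b_def)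
  have dc: "(c has_real_derivative g x) (at x)" if x: "x \<in> ?I" for x
  proof -
    have "((\<lambda>x. (3 * b x + (1 - 2 * s) * x * a x + w * x) / (x\<^sup>2 - 1)) has_real_derivative
      ((3 * U PX x + (1 - 2 * s) * (a x + x * c x) + w) * (x\<^sup>2 - 1) - (3 * b x + (1 - 2 * s) * x * a x + w * x) * (2 * x)) / ((x\<^sup>2 - 1) * (x\<^sup>2 - 1))) (at x)"
      using nz[OF x] by (auto intro!: derivative_eq_intros da[OF x] db[OF x] simp: algebra_simps)
    moreover have "((3 * U PX x + (1 - 2 * s) * (a x + x * c x) + w) * (x\<^sup>2 - 1) - (3 * b x + (1 - 2 * s) * x * a x + w * x) * (2 * x)) / ((x\<^sup>2 - 1) * (x\<^sup>2 - 1)) = g x"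
    proof -
      have S: "3 * b x + (1 - 2 * s) * x * a x + w * x = c x * (x\<^sup>2 - 1)"
        using c_eq[OF x] nz[OF x] by simp
      have "((3 * U PX x + (1 - 2 * s) * (a x + x * c x) + w) * (x\<^sup>2 - 1) - (3 * b x + (1 - 2 * s) * x * a x + w * x) * (2 * x))
         = ((3 * U PX x + (1 - 2 * s) * (a x + x * c x) + w) - 2 * x * c x) * (x\<^sup>2 - 1)"
        unfolding S by (simp add: algebra_simps)
      moreover have "3 * U PX x + (1 - 2 * s) * (a x + x * c x) + w - 2 * x * c x = (2 - 2 * s) * x * c x - 2 * (1 - 2 * s) * a x - 2 * w"
        using UX[OF x] by (simp add: algebra_simps)
      ultimately show ?thesis using nz[OF x] unfolding g_def by simp
    qed
    ultimately have "((\<lambda>x. (3 * b x + (1 - 2 * s) * x * a x + w * x) / (x\<^sup>2 - 1)) has_real_derivative g x) (at x)" by simp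
    then show ?thesis
      by (rule has_field_derivative_transform_within_open[of _ _ _ ?I]) (use x c_eq in auto)
  qed
  have dg: "(g has_real_derivative (2 * s * (c x - x * g x)) / (x\<^sup>2 - 1)) (at x)" if x: "x \<in> ?I" for x
  proof -
    have "((\<lambda>x. ((2 - 2 * s) * x * c x - 2 * (1 - 2 * s) * a x - 2 * w) / (x\<^sup>2 - 1)) has_real_derivative
      (((2 - 2 * s) * (c x + x * g x) - 2 * (1 - 2 * s) * c x) * (x\<^sup>2 - 1) - ((2 - 2 * s) * x * c x - 2 * (1 - 2 * s) * a x - 2 * w) * (2 * x)) / ((x\<^sup>2 - 1) * (x\<^sup>2 - 1))) (at x)"
      using nz[OF x] by (auto intro!: derivative_eq_intros da[OF x] dc[OF x] simp: algebra_simps)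
    moreover have "(((2 - 2 * s) * (c x + x * g x) - 2 * (1 - 2 * s) * c x) * (x\<^sup>2 - 1) - ((2 - 2 * s) * x * c x - 2 * (1 - 2 * s) * a x - 2 * w) * (2 * x))
       = (2 * s * (c x - x * g x)) * (x\<^sup>2 - 1)"
    proof -
      have S: "((2 - 2 * s) * x * c x - 2 * (1 - 2 * s) * a x - 2 * w) = g x * (x\<^sup>2 - 1)"
        using nz[OF x] by (simp add: g_def)
      show ?thesis unfolding S by (simp add: algebra_simps)
    qed
    ultimately show ?thesis using nz[OF x] unfolding g_def[abs_def] by simp
  qed
  define M where "M x = (x * g x - c x) * (1 - x\<^sup>2) powr s" for x
  have dM: "(M has_real_derivative 0) (at x)" if x: "x \<in> ?I" for x
  proof -
    note pos = one_minus_sq_pos[OF x]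
    have 1: "((\<lambda>y. (1 - y\<^sup>2) powr s) has_real_derivative s * (1 - x\<^sup>2) powr (s - 1) * (- 2 * x)) (at x)"
      using pos by (intro DERIV_chain2[OF has_real_derivative_powr]) (auto intro!: derivative_eq_intros)
    have 2: "((\<lambda>x. x * g x - c x) has_real_derivative x * ((2 * s * (c x - x * g x)) / (x\<^sup>2 - 1))) (at x)"
      by (auto intro!: derivative_eq_intros dc[OF x] dg[OF x])
    have e: "(1 - x\<^sup>2) powr s = (1 - x\<^sup>2) powr (s - 1) * (1 - x\<^sup>2)"
      using pos by (simp add: powr_diff)
    have "x * ((2 * s * (c x - x * g x)) / (x\<^sup>2 - 1)) * (1 - x\<^sup>2) powr s + s * (1 - x\<^sup>2) powr (s - 1) * (- 2 * x) * (x * g x - c x) = 0"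
      unfolding e using nz[OF x] by (simp add: divide_simps) (simp add: algebra_simps)
    with DERIV_mult[OF 2 1] show ?thesis unfolding M_def[abs_def] by simp
  qed
  have const: "f x = f y" if "\<And>x. x \<in> ?I \<Longrightarrow> (f has_real_derivative 0) (at x)" "x \<in> ?I" "y \<in> ?I" for f :: "real \<Rightarrow> real" and x y
    using has_field_derivative_zero_constant[of ?I f] that
    by (metis convex_real_interval(8) has_field_derivative_at_within)
  have e0: "x * g x = c x" if x: "x \<in> ?I" for x
  proof -
    have "M x = M 0" by (rule const[OF dM x]) auto
    also have "\<dots> = 0" by (simp add: M_def c_def U_1_0)
    finally show ?thesis using nz[OF x] by (simp add: M_def)
  qed
  show "x \<in> ?I \<Longrightarrow> U 1 x = ell0 * x"
  proof -
    assume x: "x \<in> ?I"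
    have "(g has_real_derivative 0) (at x)" if "x \<in> ?I" for x
      using dg[OF that] e0[OF that] by simp
    then have "g x = g 0" by (rule const[OF _ x]) auto
    also have "g 0 = ell0" by (simp add: g_def ell0_def a_def w_def)
    finally show ?thesis using e0[OF x] by (simp add: c_def mult.commute)
  qed
qed

text \<open>Induction on the degree by \<open>U_mult_X\<close>, where \<open>V p\<close> is a polynomial because its derivative \<open>U p\<close> is one.\<close>

lemma U_poly_ex: "\<exists>u. \<forall>x\<in>{-1<..<1}. U p x = poly u x"
proof (induction p rule: pCons_induct)
  case 0
  have "U 0 x = 0" for x using U_smult[of 0 0 x] by simp
  then show ?case by (intro exI[of _ 0]) simp
next
  case (pCons a p)
  then obtain u where u: "\<And>x. x \<in> {-1<..<1} \<Longrightarrow> U p x = poly u x" by blast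
  obtain v where v: "pderiv v = u" using pderiv_surj by blast
  have "\<exists>c. \<forall>x\<in>{-1<..<1}. V p x - poly v x = c"
  proof (rule has_field_derivative_zero_constant)
    fix x :: real assume x: "x \<in> {-1<..<1}"
    have "((\<lambda>x. V p x - poly v x) has_real_derivative U p x - poly (pderiv v) x) (at x)"
      by (intro DERIV_diff V_deriv[OF x] poly_DERIV)
    then show "((\<lambda>x. V p x - poly v x) has_real_derivative 0) (at x within {-1<..<1})"
      using u[OF x] v by (auto intro: has_field_derivative_at_within)
  qed auto
  then obtain c where "\<forall>x\<in>{-1<..<1}. V p x - poly v x = c" ..
  then have c: "V p x = poly v x + c" if "x \<in> {-1<..<1}" for x using that by (auto simp: algebra_simps)
  note eq = pCons_eq_PX[of a p]
  have "U (pCons a p) x = poly ([:0, a * ell0:] + PX * u - smult (1 - 2 * s) v - [:(1 - 2 * s) * c + delta * W p:]) x"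
    if x: "x \<in> {-1<..<1}" for x
  proof -
    have "U (pCons a p) x = a * U 1 x + U (PX * p) x"
    proof -
      have xa: "\<bar>x\<bar> \<le> 1" using x by (simp add: abs_le_iff)
      show ?thesis by (simp only: eq U_add[OF xa] U_smult)
    qed
    then show ?thesis using x
      by (simp add: U_1 U_mult_X abs_le_iff u c algebra_simps)
  qed
  then show ?case by blast
qed

text \<open>The polynomial that agrees with \<open>U p\<close> on \<open>(-1, 1)\<close>, and its derivative, the image of \<open>p\<close> under the
  weighted operator.\<close>

definition Upol :: "real poly \<Rightarrow> real poly" where "Upol p = (SOME u. \<forall>x\<in>{-1<..<1}. U p x = poly u x)"
definition LP :: "real poly \<Rightarrow> real poly" where "LP p = pderiv (Upol p)"

lemma U_eq_poly: "x \<in> {-1<..<1} \<Longrightarrow> U p x = poly (Upol p) x"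
  using someI_ex[OF U_poly_ex[of p]] by (simp add: Upol_def)

lemma Upol_unique: "(\<And>x. x \<in> {-1<..<1} \<Longrightarrow> U p x = poly u x) \<Longrightarrow> Upol p = u"
  by (rule poly_eq_on_interval) (simp flip: U_eq_poly)

lemma U_deriv:
  assumes x: "x \<in> {-1<..<1}"
  shows "(U p has_real_derivative poly (LP p) x) (at x)"
  unfolding LP_def
  by (rule has_field_derivative_transform_within_open[of _ _ _ "{-1<..<1}", OF poly_DERIV]) (use x in \<open>auto simp: U_eq_poly\<close>)

lemma Upol_add: "Upol (p + q) = Upol p + Upol q"
  by (rule Upol_unique) (auto simp: U_add abs_le_iff simp flip: U_eq_poly)
lemma Upol_smult: "Upol (smult c p) = smult c (Upol p)"
  by (rule Upol_unique) (auto simp: U_smult simp flip: U_eq_poly)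
lemma LP_add: "LP (p + q) = LP p + LP q"
  by (simp add: LP_def Upol_add pderiv_add)
lemma LP_smult: "LP (smult c p) = smult c (LP p)"
  by (simp add: LP_def Upol_smult pderiv_smult)
lemma LP_diff: "LP (p - q) = LP p - LP q"
  using LP_add[of p "- q"] LP_smult[of "-1" q] by simp
lemma LP_0 [simp]: "LP 0 = 0"
  using LP_smult[of 0 0] by simp
lemma LP_sum: "LP (\<Sum>i\<in>A. f i) = (\<Sum>i\<in>A. LP (f i))"
  by (induction A rule: infinite_finite_induct) (simp_all add: LP_add)

lemma LP_1: "LP 1 = [:ell0:]"
proof -
  have "Upol 1 = [:0, ell0:]" by (rule Upol_unique) (simp add: U_1)
  then show ?thesis by (simp add: LP_def pderiv_pCons)
qed

lemma LP_mult_X: "LP (PX * p) = PX * LP p + smult (2 * s) (Upol p)"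
proof (rule poly_eq_on_interval)
  fix x :: real assume x: "x \<in> {-1<..<1}"
  have "((\<lambda>x. x * U p x - (1 - 2 * s) * V p x - delta * W p) has_real_derivative
      (U p x + x * poly (LP p) x) - (1 - 2 * s) * U p x) (at x)"
    by (auto intro!: derivative_eq_intros U_deriv[OF x] V_deriv[OF x])
  then have "(U (PX * p) has_real_derivative (U p x + x * poly (LP p) x) - (1 - 2 * s) * U p x) (at x)"
    by (rule has_field_derivative_transform_within_open[of _ _ _ "{-1<..<1}"]) (use x U_mult_X in auto)
  from DERIV_unique[OF U_deriv[OF x] this]
  show "poly (LP (PX * p)) x = poly (PX * LP p + smult (2 * s) (Upol p)) x"
    using x by (simp add: U_eq_poly algebra_simps)
qed

lemma LP_mult_X2: "LP (PX2 * p) = Upol (PX2 * pderiv p - smult (2 * s + 2) (PX * p))"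
proof (rule poly_eq_on_interval)
  fix x :: real assume x: "x \<in> {-1<..<1}"
  have "U (PX2 * p) = V (PX2 * pderiv p - smult (2 * s + 2) (PX * p))"
    using U_mult_X2 by blast
  with V_deriv[OF x] have "(U (PX2 * p) has_real_derivative U (PX2 * pderiv p - smult (2 * s + 2) (PX * p)) x) (at x)" by simp
  from DERIV_unique[OF U_deriv[OF x] this]
  show "poly (LP (PX2 * p)) x = poly (Upol (PX2 * pderiv p - smult (2 * s + 2) (PX * p))) x"
    using x by (simp add: U_eq_poly)
qed

text \<open>Both \<open>LP_mult_X\<close> for \<open>q\<close> and \<open>LP_mult_X2\<close> for \<open>p\<close> involve \<open>Upol q\<close>, which cancels.\<close>

lemma LP_recursion:
  assumes "q = PX2 * pderiv p - smult (2 * s + 2) (PX * p)"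
  shows "LP (PX * q - smult (2 * s) (PX2 * p)) = PX * LP q"
  by (simp only: LP_diff LP_smult LP_mult_X[of q] LP_mult_X2 assms[symmetric])

lemma LP_X: "LP PX = smult ((1 + 2 * s) * ell0) PX"
proof (rule poly_eq_on_interval)
  have "Upol 1 = smult ell0 PX" by (rule Upol_unique) (simp add: U_1)
  then show "poly (LP PX) x = poly (smult ((1 + 2 * s) * ell0) PX) x" for x
    using LP_mult_X[of 1] by (simp add: LP_1 algebra_simps)
qed

end

section \<open>Symmetry of the weighted operator\<close>

lemma vector_derivative_complex_of_real:
  assumes "(f has_real_derivative D) (at x)"
  shows "((\<lambda>x. complex_of_real (f x)) has_vector_derivative complex_of_real D) (at x)"
  using assms by (simp add: has_vector_derivative_of_real has_real_derivative_iff_has_vector_derivative)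

context fractional_order
begin

text \<open>The weighted function \<open>\<omega>\<^sup>s \<phi>\<close> and its derivative.\<close>

definition wphi :: "(real \<Rightarrow> complex) \<Rightarrow> real \<Rightarrow> complex" where
  "wphi \<phi> y = omega s y *\<^sub>R \<phi> y"
definition dphi :: "(real \<Rightarrow> complex) \<Rightarrow> real \<Rightarrow> complex" where
  "dphi \<phi> y = vector_derivative (wphi \<phi>) (at y)"

lemma riesz_potential_eq: "riesz_potential s \<phi> = Npot (dphi \<phi>)"
  by (simp add: fun_eq_iff riesz_potential_def Npot_def dphi_def wphi_def[abs_def])

lemma omega_deriv:
  assumes "y \<in> {-1<..<1}"
  shows "(omega s has_real_derivative (1 - y\<^sup>2) powr (s - 1) * (- 2 * s * y)) (at y)"
  using wt_deriv[OF assms, of 1] by (simp add: wt_def[abs_def] wt'_def dp_def)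

lemma omega_cont: "continuous_on {-1..1} (omega s)"
  using wt_cont[of 1] by (simp add: wt_def[abs_def])

lemma omega_ends [simp]: "omega s 1 = 0" "omega s (-1) = 0"
  by (simp_all add: omega_def)

lemma omega_nonneg [simp]: "omega s x \<ge> 0"
  by (simp add: omega_def)

lemma omega_integrable: "set_integrable lborel {-1<..<1} (omega s)"
  using dens_wt[of 1] dens_integrable by (auto simp: wt_def[abs_def])

lemma omega_measurable [measurable]: "omega s \<in> borel_measurable borel"
  by (simp add: omega_def[abs_def])

lemma C2_facts:
  assumes "C2_open_C1_closed \<phi>"
  shows "continuous_on {-1..1} \<phi>" "continuous_on {-1..1} (wphi \<phi>)"
    "\<And>y. y \<in> {-1<..<1} \<Longrightarrow> (wphi \<phi> has_vector_derivative dphi \<phi> y) (at y)"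
    "\<exists>C. dens (dphi \<phi>) C"
proof -
  obtain \<phi>' \<phi>'' where 1: "\<And>x. x \<in> {-1..1} \<Longrightarrow> (\<phi> has_vector_derivative \<phi>' x) (at x within {-1..1})"
    and 2: "continuous_on {-1..1} \<phi>'"
    using assms unfolding C2_open_C1_closed_def by blast
  show cont: "continuous_on {-1..1} \<phi>"
    unfolding continuous_on_eq_continuous_within
    by (intro ballI has_vector_derivative_continuous[OF 1])
  show "continuous_on {-1..1} (wphi \<phi>)"
    unfolding wphi_def[abs_def] by (intro continuous_intros omega_cont cont)
  have d: "(\<phi> has_vector_derivative \<phi>' y) (at y)" if "y \<in> {-1<..<1}" for y
  proof -
    have "(\<phi> has_vector_derivative \<phi>' y) (at y within {-1<..<1})"
      using 1[of y] that by (auto intro: has_vector_derivative_within_subset)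
    then show ?thesis using at_within_open[OF that] by simp
  qed
  define m where "m y = (1 - y\<^sup>2) *\<^sub>R \<phi>' y - (2 * s * y) *\<^sub>R \<phi> y" for y
  have der: "(wphi \<phi> has_vector_derivative (1 - y\<^sup>2) powr (s - 1) *\<^sub>R m y) (at y)" if y: "y \<in> {-1<..<1}" for y
  proof -
    have "(wphi \<phi> has_vector_derivative omega s y *\<^sub>R \<phi>' y + ((1 - y\<^sup>2) powr (s - 1) * (- 2 * s * y)) *\<^sub>R \<phi> y) (at y)"
      unfolding wphi_def[abs_def] by (rule has_vector_derivative_scaleR[OF omega_deriv[OF y] d[OF y]])
    moreover have "omega s y = (1 - y\<^sup>2) powr (s - 1) * (1 - y\<^sup>2)"
      using one_minus_sq_pos[OF y] by (simp add: powr_diff omega_def)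
    ultimately show ?thesis by (simp add: m_def scaleR_diff_right mult.assoc)
  qed
  have eq: "dphi \<phi> y = (1 - y\<^sup>2) powr (s - 1) *\<^sub>R m y" if y: "y \<in> {-1<..<1}" for y
    using der[OF y] unfolding dphi_def by (rule vector_derivative_at)
  then show "\<And>y. y \<in> {-1<..<1} \<Longrightarrow> (wphi \<phi> has_vector_derivative dphi \<phi> y) (at y)"
    using der by simp
  have mc: "continuous_on {-1..1} m" unfolding m_def[abs_def] by (intro continuous_intros 2 cont)
  then have "bounded (m ` {-1..1})" by (intro compact_imp_bounded compact_continuous_image) auto
  then obtain B where B: "\<And>y. y \<in> {-1..1} \<Longrightarrow> norm (m y) \<le> B" "B > 0"
    by (metis bounded_pos imageI)
  have "continuous_on {-1<..<1} (\<lambda>y. (1 - y\<^sup>2) powr (s - 1) *\<^sub>R m y)"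
    by (intro continuous_intros continuous_on_subset[OF mc]) (auto simp: power2_eq_1_iff)
  then have "continuous_on {-1<..<1} (dphi \<phi>)" by (rule continuous_on_eq) (simp only: eq)
  moreover have "norm (dphi \<phi> y) \<le> B * (1 - y\<^sup>2) powr (s - 1)" if "y \<in> {-1<..<1}" for y
  proof -
    have "norm (dphi \<phi> y) = (1 - y\<^sup>2) powr (s - 1) * norm (m y)" unfolding eq[OF that] by simp
    also have "\<dots> \<le> (1 - y\<^sup>2) powr (s - 1) * B" using B(1)[of y] that by (intro mult_left_mono) auto
    finally show ?thesis by (simp only: mult.commute)
  qed
  ultimately show "\<exists>C. dens (dphi \<phi>) C" using B(2) by (intro exI[of _ B]) (auto simp: dens_def)
qed

lemma C2_add:
  assumes "C2_open_C1_closed f" "C2_open_C1_closed g"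
  shows "C2_open_C1_closed (\<lambda>x. f x + g x)"
proof -
  obtain f' f'' where f: "\<forall>x\<in>{-1..1}. (f has_vector_derivative f' x) (at x within {-1..1})"
        "continuous_on {-1..1} f'" "\<forall>x\<in>{-1<..<1}. (f' has_vector_derivative f'' x) (at x)"
        "continuous_on {-1<..<1} f''" using assms(1) unfolding C2_open_C1_closed_def by blast
  obtain g' g'' where g: "\<forall>x\<in>{-1..1}. (g has_vector_derivative g' x) (at x within {-1..1})"
        "continuous_on {-1..1} g'" "\<forall>x\<in>{-1<..<1}. (g' has_vector_derivative g'' x) (at x)"
        "continuous_on {-1<..<1} g''" using assms(2) unfolding C2_open_C1_closed_def by blast
  show ?thesis unfolding C2_open_C1_closed_def
    by (intro exI[of _ "\<lambda>x. f' x + g' x"] exI[of _ "\<lambda>x. f'' x + g'' x"] conjI ballI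
        has_vector_derivative_add continuous_intros) (use f g in auto)
qed

lemma C2_cmult:
  assumes "C2_open_C1_closed f"
  shows "C2_open_C1_closed (\<lambda>x. c * f x)"
proof -
  obtain f' f'' where f: "\<forall>x\<in>{-1..1}. (f has_vector_derivative f' x) (at x within {-1..1})"
        "continuous_on {-1..1} f'" "\<forall>x\<in>{-1<..<1}. (f' has_vector_derivative f'' x) (at x)"
        "continuous_on {-1<..<1} f''" using assms(1) unfolding C2_open_C1_closed_def by blast
  show ?thesis unfolding C2_open_C1_closed_def
    by (intro exI[of _ "\<lambda>x. c * f' x"] exI[of _ "\<lambda>x. c * f'' x"] conjI ballI
        has_vector_derivative_mult_right continuous_intros) (use f in auto)
qed

lemma weighted_frac_lap_add:
  assumes "weighted_frac_lap s f F" "weighted_frac_lap s g G"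
  shows "weighted_frac_lap s (\<lambda>x. f x + g x) (\<lambda>x. F x + G x)"
proof -
  have f: "C2_open_C1_closed f" and g: "C2_open_C1_closed g"
    using assms by (auto simp: weighted_frac_lap_def)
  obtain A B where AB: "dens (dphi f) A" "dens (dphi g) B" using C2_facts(4) f g by metis
  have eq: "dphi (\<lambda>x. f x + g x) y = dphi f y + dphi g y" if "y \<in> {-1<..<1}" for y
  proof -
    have "(wphi (\<lambda>x. f x + g x) has_vector_derivative dphi f y + dphi g y) (at y)"
      using has_vector_derivative_add[OF C2_facts(3)[OF f that] C2_facts(3)[OF g that]]
      by (simp add: wphi_def[abs_def] scaleR_add_right)
    then show ?thesis unfolding dphi_def by (rule vector_derivative_at)
  qed
  have eq2: "riesz_potential s (\<lambda>x. f x + g x) x = riesz_potential s f x + riesz_potential s g x" if "x \<in> {-1<..<1}" for x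
  proof -
    have "Npot (dphi (\<lambda>x. f x + g x)) x = Npot (\<lambda>y. dphi f y + dphi g y) x"
      unfolding Npot_def by (intro set_lebesgue_integral_cong) (auto simp: eq)
    also have "\<dots> = Npot (dphi f) x + Npot (dphi g) x" using that by (intro Npot_add[OF AB]) auto
    finally show ?thesis by (simp add: riesz_potential_eq)
  qed
  show ?thesis unfolding weighted_frac_lap_def
  proof (intro conjI ballI C2_add f g)
    fix x :: real assume x: "x \<in> {-1<..<1}"
    have "((\<lambda>x. riesz_potential s f x + riesz_potential s g x) has_vector_derivative F x + G x) (at x)"
      using assms x by (intro has_vector_derivative_add) (auto simp: weighted_frac_lap_def)
    then show "(riesz_potential s (\<lambda>x. f x + g x) has_vector_derivative F x + G x) (at x)"
      by (rule has_vector_derivative_transform_within_open[of _ _ _ "{-1<..<1}"]) (use x eq2 in auto)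
  qed
qed

lemma weighted_frac_lap_cmult:
  assumes "weighted_frac_lap s f F"
  shows "weighted_frac_lap s (\<lambda>x. c * f x) (\<lambda>x. c * F x)"
proof -
  have f: "C2_open_C1_closed f"
    using assms by (auto simp: weighted_frac_lap_def)
  have eq: "dphi (\<lambda>x. c * f x) y = c * dphi f y" if "y \<in> {-1<..<1}" for y
  proof -
    have "(wphi (\<lambda>x. c * f x) has_vector_derivative c * dphi f y) (at y)"
      using has_vector_derivative_mult_right[OF C2_facts(3)[OF f that], of c]
      by (simp add: wphi_def[abs_def])
    then show ?thesis unfolding dphi_def by (rule vector_derivative_at)
  qed
  have eq2: "riesz_potential s (\<lambda>x. c * f x) x = c * riesz_potential s f x" if "x \<in> {-1<..<1}" for x
  proof -
    have "Npot (dphi (\<lambda>x. c * f x)) x = (LINT y:{-1<..<1}|lborel. c * (kern (x - y) *\<^sub>R dphi f y))"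
      unfolding Npot_def by (intro set_lebesgue_integral_cong) (auto simp: eq)
    also have "\<dots> = c * Npot (dphi f) x" unfolding Npot_def by (rule set_integral_mult_right)
    finally show ?thesis by (simp add: riesz_potential_eq)
  qed
  show ?thesis unfolding weighted_frac_lap_def
  proof (intro conjI ballI C2_cmult f)
    fix x :: real assume x: "x \<in> {-1<..<1}"
    have "((\<lambda>x. c * riesz_potential s f x) has_vector_derivative c * F x) (at x)"
      using assms x by (intro has_vector_derivative_mult_right) (auto simp: weighted_frac_lap_def)
    then show "(riesz_potential s (\<lambda>x. c * f x) has_vector_derivative c * F x) (at x)"
      by (rule has_vector_derivative_transform_within_open[of _ _ _ "{-1<..<1}"]) (use x eq2 in auto)
  qed
qed

lemma C2_poly: "C2_open_C1_closed (\<lambda>x. complex_of_real (poly p x))"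
  unfolding C2_open_C1_closed_def
proof (rule exI[of _ "\<lambda>x. complex_of_real (poly (pderiv p) x)"],
    rule exI[of _ "\<lambda>x. complex_of_real (poly (pderiv (pderiv p)) x)"], intro conjI ballI)
  show "((\<lambda>x. complex_of_real (poly p x)) has_vector_derivative complex_of_real (poly (pderiv p) x)) (at x within {-1..1})" for x
    by (rule has_vector_derivative_at_within[OF vector_derivative_complex_of_real[OF poly_DERIV]])
  show "((\<lambda>x. complex_of_real (poly (pderiv p) x)) has_vector_derivative complex_of_real (poly (pderiv (pderiv p)) x)) (at x)" for x
    by (rule vector_derivative_complex_of_real[OF poly_DERIV])
qed (intro continuous_intros)+

lemma riesz_potential_poly:
  "riesz_potential s (\<lambda>x. complex_of_real (poly p x)) x = complex_of_real (U p x)"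
proof -
  have eq: "dphi (\<lambda>x. complex_of_real (poly p x)) y = complex_of_real (wt' p y)" if "y \<in> {-1<..<1}" for y
  proof -
    have "wphi (\<lambda>x. complex_of_real (poly p x)) = (\<lambda>y. complex_of_real (wt p y))"
      by (simp add: wphi_def[abs_def] wt_def[abs_def] scaleR_conv_of_real)
    then show ?thesis
      unfolding dphi_def using vector_derivative_at[OF vector_derivative_complex_of_real[OF wt_deriv[OF that]]] by simp
  qed
  have "Npot (dphi (\<lambda>x. complex_of_real (poly p x))) x = (LINT y:{-1<..<1}|lborel. complex_of_real (kern (x - y) *\<^sub>R wt' p y))"
    unfolding Npot_def by (intro set_lebesgue_integral_cong) (auto simp: eq scaleR_conv_of_real)
  also have "\<dots> = complex_of_real (U p x)"
    unfolding U_def Npot_def by (rule set_integral_complex_of_real)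
  finally show ?thesis by (simp add: riesz_potential_eq)
qed

lemma weighted_frac_lap_poly:
  "weighted_frac_lap s (\<lambda>x. complex_of_real (poly p x)) (\<lambda>x. complex_of_real (poly (LP p) x))"
  unfolding weighted_frac_lap_def
  unfolding riesz_potential_poly[abs_def]
proof (intro conjI ballI C2_poly)
  fix x :: real assume "x \<in> {-1<..<1}"
  then show "((\<lambda>x. complex_of_real (U p x)) has_vector_derivative complex_of_real (poly (LP p) x)) (at x)"
    by (rule vector_derivative_complex_of_real[OF U_deriv])
qed

lemma L2_weighted_mult_integrable:
  assumes v: "v \<in> L2_weighted s" and q: "continuous_on {-1..1} q"
  shows "set_integrable lborel {-1<..<1} (\<lambda>x. (q x * omega s x) *\<^sub>R v x)"
proof -
  have "bounded (q ` {-1..1})" using q by (intro compact_imp_bounded compact_continuous_image) auto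
  then obtain B where B: "\<And>y. y \<in> {-1..1} \<Longrightarrow> norm (q y) \<le> B" "B > 0"
    by (metis bounded_pos imageI)
  have m: "set_borel_measurable lborel {-1<..<1} v" and i: "set_integrable lborel {-1<..<1} (\<lambda>x. (cmod (v x))\<^sup>2 * omega s x)"
    using v by (auto simp: L2_weighted_def)
  have "set_borel_measurable lborel {-1<..<1} (\<lambda>x. q x * omega s x)"
    by (rule set_measurable_continuous) (auto intro!: continuous_intros intro: continuous_on_subset[OF q] continuous_on_subset[OF omega_cont])
  then have "(\<lambda>x. (indicator {-1<..<1} x *\<^sub>R (q x * omega s x)) *\<^sub>R (indicator {-1<..<1} x *\<^sub>R v x)) \<in> borel_measurable lborel"
    using m unfolding set_borel_measurable_def by (rule borel_measurable_scaleR)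
  moreover have "(\<lambda>x. (indicator {-1<..<1} x *\<^sub>R (q x * omega s x)) *\<^sub>R (indicator {-1<..<1} x *\<^sub>R v x)) =
     (\<lambda>x. indicator {-1<..<1::real} x *\<^sub>R ((q x * omega s x) *\<^sub>R v x))" by (auto simp: indicator_def)
  ultimately have m2: "set_borel_measurable lborel {-1<..<1} (\<lambda>x. (q x * omega s x) *\<^sub>R v x)"
    unfolding set_borel_measurable_def by simp
  have i2: "set_integrable lborel {-1<..<1} (\<lambda>x. B * (omega s x + (cmod (v x))\<^sup>2 * omega s x))"
    using i omega_integrable by (intro set_integrable_mult_right set_integral_add) auto
  show ?thesis
  proof (rule set_integral_dominated(1)[OF i2 m2])
    fix x :: real assume x: "x \<in> {-1<..<1}"
    have a: "cmod (v x) \<le> 1 + (cmod (v x))\<^sup>2"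
      using zero_le_power2[of "cmod (v x) - 1/2"] by (simp add: power2_eq_square algebra_simps)
    have "norm ((q x * omega s x) *\<^sub>R v x) = norm (q x) * (omega s x * cmod (v x))" by (simp add: abs_mult)
    also have "\<dots> \<le> B * (omega s x * (1 + (cmod (v x))\<^sup>2))"
      using B(1)[of x] x a B(2) by (intro mult_mono mult_left_mono) auto
    finally show "norm ((q x * omega s x) *\<^sub>R v x) \<le> B * (omega s x + (cmod (v x))\<^sup>2 * omega s x)"
      by (simp add: algebra_simps)
  qed
qed

lemma Npot_Fubini:
  fixes f :: "real \<Rightarrow> real" and g :: "real \<Rightarrow> complex"
  assumes f: "dens f A" and g: "dens g B"
  shows "(LINT x:{-1<..<1}|lborel. f x *\<^sub>R Npot g x) = (LINT y:{-1<..<1}|lborel. Npot f y *\<^sub>R g y)"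
proof -
  define f0 where "f0 x = indicator {-1<..<1} x *\<^sub>R f x" for x
  define g0 where "g0 x = indicator {-1<..<1} x *\<^sub>R g x" for x
  define F where "F x y = f0 x *\<^sub>R (kern (x - y) *\<^sub>R g0 y)" for x y
  have F_alt: "F x y = (kern (x - y) * f0 x) *\<^sub>R g0 y" for x y by (simp add: F_def mult.commute)
  have [measurable]: "f0 \<in> borel_measurable borel" "g0 \<in> borel_measurable borel"
    using dens_measurable[OF f] dens_measurable[OF g]
    by (simp_all add: f0_def[abs_def] g0_def[abs_def] set_borel_measurable_def)
  have N: "Npot g x = (LINT y|lborel. kern (x - y) *\<^sub>R g0 y)" for x
    unfolding Npot_def set_lebesgue_integral_def g0_def by (simp add: mult.commute)
  have N2: "Npot f y = (LINT x|lborel. kern (x - y) * f0 x)" for y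
    unfolding Npot_def set_lebesgue_integral_def f0_def
    by (intro Bochner_Integration.integral_cong) (auto simp: mult_ac kern_minus[of "y - x" for x, symmetric] simp del: kern_minus)
  have meas: "(\<lambda>(x, y). F x y) \<in> borel_measurable (lborel \<Otimes>\<^sub>M lborel)"
    unfolding F_def[abs_def] by measurable
  have inner: "integrable lborel (\<lambda>y. F x y)" for x
  proof (cases "x \<in> {-1<..<1}")
    case True
    then have "integrable lborel (\<lambda>y. kern (x - y) *\<^sub>R g0 y)"
      using dens_kernel_integrable(1)[OF g, of x] by (simp add: set_integrable_def g0_def mult.commute abs_le_iff)
    then show ?thesis unfolding F_def by (rule integrable_scaleR_right)
  qed (simp add: F_def f0_def)
  have "integrable (lborel \<Otimes>\<^sub>M lborel) (\<lambda>(x, y). F x y)"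
  proof (rule lborel_pair.Fubini_integrable[OF meas])
    show "AE x in lborel. integrable lborel (\<lambda>y. case (x, y) of (x, y) \<Rightarrow> F x y)" using inner by simp
    let ?B = "B * kC * (12 / (1 - theta))"
    have "dens (\<lambda>y. norm (g y)) B" using g by (auto simp: dens_def intro!: continuous_intros)
    have absb: "(LINT y|lborel. norm (F x y)) \<le> norm (f0 x) * ?B" for x
    proof (cases "x \<in> {-1<..<1}")
      case True
      then have x: "\<bar>x\<bar> \<le> 1" by auto
      have "(LINT y|lborel. norm (F x y)) \<le> (LINT y|lborel. norm (f0 x) * (indicator {-1<..<1} y *\<^sub>R (B * kC * majorant x y)))"
      proof (rule integral_mono)
        show "integrable lborel (\<lambda>y. norm (F x y))" using inner by (rule integrable_norm)
        show "integrable lborel (\<lambda>y. norm (f0 x) * (indicator {-1<..<1} y *\<^sub>R (B * kC * majorant x y)))"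
          using majorant_integrable(1)[OF x]
          by (intro integrable_mult_right) (simp add: set_integrable_def mult.left_commute)
        show "norm (F x y) \<le> norm (f0 x) * (indicator {-1<..<1} y *\<^sub>R (B * kC * majorant x y))" for y
        proof (cases "y \<in> {-1<..<1}")
          case True
          then have "norm (F x y) = norm (f0 x) * norm (kern (x - y) *\<^sub>R g y)"
            by (simp add: F_def g0_def abs_mult)
          also have "\<dots> \<le> norm (f0 x) * (B * kC * majorant x y)"
            using dens_kernel_bound[OF g x True] by (rule mult_left_mono) simp
          finally show ?thesis using True by simp
        qed (simp add: F_def g0_def)
      qed
      also have "\<dots> = norm (f0 x) * (B * kC * (LINT y:{-1<..<1}|lborel. majorant x y))"
        by (simp add: set_lebesgue_integral_def mult.left_commute)
      also have "\<dots> \<le> norm (f0 x) * ?B"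
        using g kC_pos majorant_integrable(2)[OF x] by (intro mult_left_mono) (auto simp: dens_def)
      finally show ?thesis .
    qed (simp add: F_def f0_def)
    have "integrable lborel (\<lambda>x. norm (f0 x) * ?B)"
      using dens_integrable[OF f] by (intro integrable_mult_left integrable_norm) (simp add: set_integrable_def f0_def)
    then show "integrable lborel (\<lambda>x. LINT y|lborel. norm (case (x, y) of (x, y) \<Rightarrow> F x y))"
    proof (rule Bochner_Integration.integrable_bound)
      show "(\<lambda>x. LINT y|lborel. norm (case (x, y) of (x, y) \<Rightarrow> F x y)) \<in> borel_measurable lborel"
        unfolding F_def by measurable
      show "AE x in lborel. norm (LINT y|lborel. norm (case (x, y) of (x, y) \<Rightarrow> F x y)) \<le> norm (norm (f0 x) * ?B)"
      proof (intro AE_I2)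
        fix x
        have "norm (LINT y|lborel. norm (F x y)) = (LINT y|lborel. norm (F x y))" by simp
        also have "\<dots> \<le> norm (norm (f0 x) * ?B)" using absb[of x] by (metis abs_ge_self order_trans real_norm_def)
        finally show "norm (LINT y|lborel. norm (case (x, y) of (x, y) \<Rightarrow> F x y)) \<le> norm (norm (f0 x) * ?B)" by simp
      qed
    qed
  qed
  from lborel_pair.Fubini_integral[OF this]
  have "(LINT y|lborel. LINT x|lborel. F x y) = (LINT x|lborel. LINT y|lborel. F x y)" .
  moreover have "(LINT y|lborel. F x y) = f0 x *\<^sub>R Npot g x" for x
    unfolding N F_def by (rule integral_scaleR_right)
  moreover have "(LINT x|lborel. F x y) = Npot f y *\<^sub>R g0 y" for y
    unfolding N2 F_alt
  proof (cases "g0 y = 0")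
    case False
    then have y: "y \<in> {-1<..<1}" by (auto simp: g0_def split: split_indicator_asm)
    have "integrable lborel (\<lambda>x. kern (x - y) * f0 x)"
    proof -
      have "kern (x - y) = kern (y - x)" for x using kern_minus[of "y - x"] by simp
      then show ?thesis using dens_kernel_integrable(1)[OF f, of y] y
        by (simp add: set_integrable_def f0_def mult.left_commute abs_le_iff)
    qed
    then show "(LINT x|lborel. (kern (x - y) * f0 x) *\<^sub>R g0 y) = (LINT x|lborel. kern (x - y) * f0 x) *\<^sub>R g0 y"
      by (rule integral_scaleR_left)
  qed simp
  ultimately show ?thesis
    unfolding set_lebesgue_integral_def f0_def g0_def by (simp add: mult.commute)
qed

text \<open>Both sides are integrated by parts; in between, the kernel is moved from one factor to the other by
  Fubini's theorem.\<close>

lemma weighted_frac_lap_symmetric: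
  assumes L: "weighted_frac_lap s \<phi> g" and g: "g \<in> L2_weighted s"
  shows "(LINT x:{-1<..<1}|lborel. (poly p x * omega s x) *\<^sub>R g x) =
         (LINT x:{-1<..<1}|lborel. (poly (LP p) x * omega s x) *\<^sub>R \<phi> x)"
proof -
  let ?I = "\<lambda>f. (LINT x:{-1<..<1}|lborel. f x :: complex)"
  have \<phi>: "C2_open_C1_closed \<phi>" and R: "\<And>x. x \<in> {-1<..<1} \<Longrightarrow> (Npot (dphi \<phi>) has_vector_derivative g x) (at x)"
    using L by (auto simp: weighted_frac_lap_def riesz_potential_eq)
  obtain C where C: "dens (dphi \<phi>) C" using C2_facts(4)[OF \<phi>] by blast
  obtain A where A: "dens (wt' p) A" using dens_wt' by blast
  define B where "B = C * kC * (12 / (1 - theta))"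
  have B: "norm (Npot (dphi \<phi>) x) \<le> B" if "\<bar>x\<bar> \<le> 1" for x
    unfolding B_def by (rule dens_kernel_integrable(2)[OF C that])
  have B0: "B \<ge> 0" using B[of 0] norm_ge_zero[of "Npot (dphi \<phi>) 0"] by linarith
  have Rc: "continuous_on {-1<..<1} (Npot (dphi \<phi>))"
    by (intro continuous_at_imp_continuous_on ballI has_vector_derivative_continuous[OF R])
  have cont: "continuous_on {-1..1} (\<lambda>x. wt p x *\<^sub>R Npot (dphi \<phi>) x)"
    unfolding continuous_on_eq_continuous_within
  proof
    fix x :: real assume x: "x \<in> {-1..1}"
    show "continuous (at x within {-1..1}) (\<lambda>x. wt p x *\<^sub>R Npot (dphi \<phi>) x)"
    proof (cases "x \<in> {-1<..<1}")
      case True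
      then show ?thesis
        by (rule continuous_at_imp_continuous_at_within[OF continuous_scaleR[OF
            has_vector_derivative_continuous[OF wt_deriv_vec] has_vector_derivative_continuous[OF R]]]) (use True in auto)
    next
      case False
      then have x1: "wt p x = 0" using x by (cases "x = 1") auto
      have "(wt p \<longlongrightarrow> 0) (at x within {-1..1})"
        using wt_cont[of p] x x1 unfolding continuous_on by metis
      then have "((\<lambda>x. norm (wt p x) * B) \<longlongrightarrow> 0) (at x within {-1..1})"
        by (intro tendsto_mult_left_zero tendsto_norm_zero)
      moreover have "\<forall>\<^sub>F z in at x within {-1..1}. norm (wt p z *\<^sub>R Npot (dphi \<phi>) z) \<le> norm (wt p z) * B"
        unfolding eventually_at_filter
        by (rule always_eventually) (auto intro!: mult_left_mono B)
      ultimately have "((\<lambda>z. wt p z *\<^sub>R Npot (dphi \<phi>) z) \<longlongrightarrow> 0) (at x within {-1..1})"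
        by (rule Lim_null_comparison[rotated])
      then show ?thesis by (simp add: continuous_within x1)
    qed
  qed
  have i1: "set_integrable lborel {-1<..<1} (\<lambda>x. wt p x *\<^sub>R g x)"
    using L2_weighted_mult_integrable[OF g, of "poly p"]
    by (simp add: wt_def mult.commute continuous_intros)
  have "dens (\<lambda>x. wt' p x *\<^sub>R Npot (dphi \<phi>) x) (A * B)"
    unfolding dens_def
  proof (intro conjI ballI)
    show "continuous_on {-1<..<1} (\<lambda>x. wt' p x *\<^sub>R Npot (dphi \<phi>) x)"
      using A Rc by (intro continuous_intros) (auto simp: dens_def)
    fix y :: real assume y: "y \<in> {-1<..<1}"
    have "norm (wt' p y *\<^sub>R Npot (dphi \<phi>) y) \<le> (A * (1 - y\<^sup>2) powr (s - 1)) * B"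
      unfolding norm_scaleR using A y B[of y] by (intro mult_mono) (auto simp: dens_def)
    then show "norm (wt' p y *\<^sub>R Npot (dphi \<phi>) y) \<le> A * B * (1 - y\<^sup>2) powr (s - 1)" by (simp add: mult_ac)
  qed (use A B0 in \<open>auto simp: dens_def\<close>)
  then have i2: "set_integrable lborel {-1<..<1} (\<lambda>x. wt' p x *\<^sub>R Npot (dphi \<phi>) x)"
    by (rule dens_integrable)
  have "?I (\<lambda>x. wt p x *\<^sub>R g x + wt' p x *\<^sub>R Npot (dphi \<phi>) x) =
      wt p 1 *\<^sub>R Npot (dphi \<phi>) 1 - wt p (-1) *\<^sub>R Npot (dphi \<phi>) (-1)"
  proof (rule set_integral_FTC[of _ _ _ "{}", OF _ cont])
    show "((\<lambda>x. wt p x *\<^sub>R Npot (dphi \<phi>) x) has_vector_derivative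
         wt p x *\<^sub>R g x + wt' p x *\<^sub>R Npot (dphi \<phi>) x) (at x)" if "x \<in> {-1<..<1} - {}" for x
      using that by (intro has_vector_derivative_scaleR wt_deriv R) auto
  qed (use i1 i2 in \<open>auto intro: set_integral_add\<close>)
  then have e1: "?I (\<lambda>x. wt p x *\<^sub>R g x) = - ?I (\<lambda>x. wt' p x *\<^sub>R Npot (dphi \<phi>) x)"
    unfolding set_integral_add(2)[OF i1 i2] by (simp add: eq_neg_iff_add_eq_0)
  have e2: "?I (\<lambda>x. wt' p x *\<^sub>R Npot (dphi \<phi>) x) = ?I (\<lambda>y. U p y *\<^sub>R dphi \<phi> y)"
    unfolding U_def by (rule Npot_Fubini[OF A C])
  have e3: "?I (\<lambda>y. U p y *\<^sub>R dphi \<phi> y) = ?I (\<lambda>y. poly (Upol p) y *\<^sub>R dphi \<phi> y)"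
    by (intro set_lebesgue_integral_cong) (auto simp: U_eq_poly)
  have i3: "set_integrable lborel {-1<..<1} (\<lambda>y. poly (Upol p) y *\<^sub>R dphi \<phi> y)"
    by (rule dens_mult_integrable[OF C]) (intro continuous_intros)
  obtain D where D: "dens (wphi \<phi>) D" using continuous_imp_dens[OF C2_facts(2)[OF \<phi>]] by blast
  have i4: "set_integrable lborel {-1<..<1} (\<lambda>y. poly (LP p) y *\<^sub>R wphi \<phi> y)"
    by (rule dens_mult_integrable[OF D]) (intro continuous_intros)
  have "?I (\<lambda>y. poly (Upol p) y *\<^sub>R dphi \<phi> y + poly (LP p) y *\<^sub>R wphi \<phi> y) =
     poly (Upol p) 1 *\<^sub>R wphi \<phi> 1 - poly (Upol p) (-1) *\<^sub>R wphi \<phi> (-1)"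
  proof (rule set_integral_FTC[of _ _ _ "{}"])
    show "continuous_on {-1..1} (\<lambda>y. poly (Upol p) y *\<^sub>R wphi \<phi> y)"
      by (intro continuous_intros C2_facts(2)[OF \<phi>])
    show "((\<lambda>y. poly (Upol p) y *\<^sub>R wphi \<phi> y) has_vector_derivative
       poly (Upol p) x *\<^sub>R dphi \<phi> x + poly (LP p) x *\<^sub>R wphi \<phi> x) (at x)" if "x \<in> {-1<..<1} - {}" for x
      unfolding LP_def using that by (intro has_vector_derivative_scaleR poly_DERIV C2_facts(3)[OF \<phi>]) auto
  qed (use i3 i4 in \<open>auto intro: set_integral_add\<close>)
  then have e4: "?I (\<lambda>y. poly (Upol p) y *\<^sub>R dphi \<phi> y) = - ?I (\<lambda>y. poly (LP p) y *\<^sub>R wphi \<phi> y)"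
    unfolding set_integral_add(2)[OF i3 i4] by (simp add: wphi_def eq_neg_iff_add_eq_0)
  show ?thesis
    using e1 e2 e3 e4 by (simp add: wt_def wphi_def mult.commute)
qed

end

section \<open>Gegenbauer polynomials as eigenfunctions\<close>

context fractional_order
begin

text \<open>The Gegenbauer polynomials of parameter \<open>s + 1/2\<close> as elements of the type of polynomials.\<close>

fun gpol :: "nat \<Rightarrow> real poly" where
  "gpol 0 = 1"
| "gpol (Suc 0) = smult (1 + 2 * s) PX"
| "gpol (Suc (Suc n)) =
     smult ((2 * real n + 3 + 2 * s) / (real n + 2)) (PX * gpol (Suc n))
     - smult ((real n + 1 + 2 * s) / (real n + 2)) (gpol n)"

lemma poly_gpol: "poly (gpol n) x = gegenbauer (s + 1/2) n x"
proof (induction n rule: gpol.induct)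
  case (3 n)
  have "2 * (real n + 1 + (s + 1/2)) = 2 * real n + 3 + 2 * s" "real n + 2 * (s + 1/2) = real n + 1 + 2 * s"
    by (simp_all add: algebra_simps)
  then show ?case using 3 by (simp add: diff_divide_distrib add_ac mult_ac)
qed simp_all

text \<open>The coefficients of \<open>(1 - z) powr -(1 + 2s)\<close>; up to the factor \<open>ell0\<close> they are the eigenvalues of the operator.\<close>

definition gam :: "nat \<Rightarrow> real" where "gam n = pochhammer (1 + 2 * s) n / fact n"

lemma gam_0 [simp]: "gam 0 = 1" by (simp add: gam_def)

lemma gam_Suc: "gam (Suc n) = gam n * (real n + 1 + 2 * s) / (real n + 1)"
  by (simp add: gam_def pochhammer_Suc add_ac)

lemma gam_pos: "gam n > 0"
  using s_pos by (simp add: gam_def pochhammer_pos)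

text \<open>The Gegenbauer polynomials of degrees \<open>n - 1\<close> and \<open>n - 2\<close>, read as \<open>0\<close> where the degree would be negative.\<close>

definition Cm1 :: "nat \<Rightarrow> real poly" where "Cm1 n = (if n = 0 then 0 else gpol (n - 1))"
definition Cm2 :: "nat \<Rightarrow> real poly" where "Cm2 n = (if n < 2 then 0 else gpol (n - 2))"

lemma gpol_rec:
  "(2 * real n + 1 + 2 * s) * (x * poly (gpol n) x) =
     (real n + 1) * poly (gpol (Suc n)) x + (real n + 2 * s) * poly (Cm1 n) x"
proof (cases n)
  case (Suc m)
  have "(real m + 2) * poly (gpol (Suc (Suc m))) x =
    (2 * real m + 3 + 2 * s) * (x * poly (gpol (Suc m)) x) - (real m + 1 + 2 * s) * poly (gpol m) x"
    by (simp add: diff_divide_distrib[symmetric])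
  then show ?thesis using Suc by (simp add: Cm1_def algebra_simps)
qed (simp add: Cm1_def)

lemma gpol_rec':
  "(2 * real n - 1 + 2 * s) * (x * poly (Cm1 n) x) =
     real n * poly (gpol n) x + (real n - 1 + 2 * s) * poly (Cm2 n) x"
proof (cases n)
  case (Suc m)
  have "Cm2 (Suc m) = Cm1 m" by (auto simp: Cm1_def Cm2_def)
  then show ?thesis using gpol_rec[of m x] Suc by (simp add: Cm1_def algebra_simps)
qed (simp add: Cm1_def Cm2_def)

lemma gpol_deriv:
  "(1 - x\<^sup>2) * poly (pderiv (gpol n)) x = (real n + 2 * s) * poly (Cm1 n) x - real n * (x * poly (gpol n) x)"
proof (induction n rule: gpol.induct)
  case 1 then show ?case by (simp add: Cm1_def)
next
  case 2 then show ?case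
    by (simp add: Cm1_def pderiv_smult power2_eq_square algebra_simps)
next
  case (3 n)
  define c0 c1 c2 d0 d1 d2 m where "c0 = poly (gpol n) x" "c1 = poly (gpol (Suc n)) x"
    "c2 = poly (gpol (Suc (Suc n))) x" "d0 = poly (pderiv (gpol n)) x" "d1 = poly (pderiv (gpol (Suc n))) x"
    "d2 = poly (pderiv (gpol (Suc (Suc n)))) x" "m = poly (Cm1 n) x"
  note defs = this
  let ?N = "real n"
  have r0: "(2 * ?N + 1 + 2 * s) * (x * c0) = (?N + 1) * c1 + (?N + 2 * s) * m"
    using gpol_rec[of n x] by (simp add: defs)
  have r1: "(?N + 2) * c2 = (2 * ?N + 3 + 2 * s) * (x * c1) - (?N + 1 + 2 * s) * c0"
    by (simp add: defs diff_divide_distrib[symmetric])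
  have "(?N + 2) * d2 = (?N + 2) * ((2 * ?N + 3 + 2 * s) / (?N + 2) * (c1 + x * d1) - (?N + 1 + 2 * s) / (?N + 2) * d0)"
    by (simp add: defs pderiv_diff pderiv_smult pderiv_mult algebra_simps)
  also have "\<dots> = (2 * ?N + 3 + 2 * s) * (c1 + x * d1) - (?N + 1 + 2 * s) * d0"
    by (simp add: right_diff_distrib)
  finally have r2: "(?N + 2) * d2 = (2 * ?N + 3 + 2 * s) * (c1 + x * d1) - (?N + 1 + 2 * s) * d0" .
  have i0: "(1 - x\<^sup>2) * d0 = (?N + 2 * s) * m - ?N * (x * c0)"
    using 3(2) by (simp add: defs)
  have i1: "(1 - x\<^sup>2) * d1 = (?N + 1 + 2 * s) * c0 - (?N + 1) * (x * c1)"
    using 3(1) by (simp add: defs Cm1_def algebra_simps)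
  have "(?N + 2) * ((1 - x\<^sup>2) * d2) = (?N + 2) * ((?N + 2 + 2 * s) * c1 - (?N + 2) * (x * c2))"
  proof -
    have "(?N + 2) * ((1 - x\<^sup>2) * d2) = (1 - x\<^sup>2) * ((?N + 2) * d2)" by simp
    also have "\<dots> = (2 * ?N + 3 + 2 * s) * ((1 - x\<^sup>2) * c1 + x * ((1 - x\<^sup>2) * d1)) - (?N + 1 + 2 * s) * ((1 - x\<^sup>2) * d0)"
      unfolding r2 by (simp add: algebra_simps)
    also have "\<dots> = (2 * ?N + 3 + 2 * s) * ((1 - x\<^sup>2) * c1 + x * ((?N + 1 + 2 * s) * c0 - (?N + 1) * (x * c1)))
       - (?N + 1 + 2 * s) * (((2 * ?N + 1 + 2 * s) * (x * c0) - (?N + 1) * c1) - ?N * (x * c0))"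
      unfolding i0 i1 r0 by simp
    also have "\<dots> = (?N + 2) * (?N + 2 + 2 * s) * c1 - (?N + 2) * (x * ((2 * ?N + 3 + 2 * s) * (x * c1) - (?N + 1 + 2 * s) * c0))"
      by (simp add: algebra_simps power2_eq_square)
    finally show ?thesis unfolding r1[symmetric] by (simp add: algebra_simps)
  qed
  then have "(1 - x\<^sup>2) * d2 = (?N + 2 + 2 * s) * c1 - (?N + 2) * (x * c2)" by simp
  then show ?case by (simp add: defs Cm1_def algebra_simps)
qed

text \<open>For \<open>p = gpol n\<close> the relation \<open>LP_recursion\<close> has on its left the images of the polynomials of degrees \<open>n + 2\<close>,
  \<open>n\<close> and \<open>n - 2\<close>, and on its right those of degrees \<open>n + 1\<close> and \<open>n - 1\<close>. All but the first are known by
  induction, so it remains to compare coefficients.\<close>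

lemma LP_gpol: "LP (gpol n) = smult (ell0 * gam n) (gpol n)"
proof (induction n rule: less_induct)
  case (less N)
  consider "N = 0" | "N = 1" | n where "N = Suc (Suc n)" by (cases N rule: gpol.cases) auto
  then show ?case
  proof cases
    case 1 then show ?thesis by (simp add: LP_1)
  next
    case 2 then show ?thesis by (simp add: LP_smult LP_X gam_Suc mult_ac)
  next
    case (3 n)
    let ?n = "real n"
    define lam where "lam j = ell0 * gam j" for j
    define A B where "A = (?n + 1) / (2 * ?n + 1 + 2 * s)" and "B = (?n + 2 * s) / (2 * ?n + 1 + 2 * s)"
    define A1 B1 where "A1 = (?n + 2) / (2 * ?n + 3 + 2 * s)" and "B1 = (?n + 1 + 2 * s) / (2 * ?n + 3 + 2 * s)"
    define A0 B0 where "A0 = ?n / (2 * ?n - 1 + 2 * s)" and "B0 = (?n - 1 + 2 * s) / (2 * ?n - 1 + 2 * s)"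
    have d: "2 * ?n + 1 + 2 * s > 0" "2 * ?n + 3 + 2 * s > 0" using s_pos by simp_all
    have E1: "x * poly (gpol n) x = A * poly (gpol (Suc n)) x + B * poly (Cm1 n) x" for x
      using gpol_rec[of n x] d by (simp add: A_def B_def divide_simps) (simp add: mult_ac)
    have E2: "x * poly (gpol (Suc n)) x = A1 * poly (gpol N) x + B1 * poly (gpol n) x" for x
      using gpol_rec[of "Suc n" x] d 3
      by (simp add: A1_def B1_def divide_simps Cm1_def del: gpol.simps) (simp add: algebra_simps del: gpol.simps)
    have E0: "x * poly (Cm1 n) x = A0 * poly (gpol n) x + B0 * poly (Cm2 n) x" for x
    proof (cases "n = 0")
      case False
      then have "2 * ?n - 1 + 2 * s > 0" using s_pos by simp
      with gpol_rec'[of n x] show ?thesis by (simp add: A0_def B0_def divide_simps) (simp add: mult_ac)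
    qed (simp add: A0_def Cm1_def Cm2_def)
    define q where "q = PX2 * pderiv (gpol n) - smult (2 * s + 2) (PX * gpol n)"
    have Bd: "?n + 2 * s = (2 * ?n + 1 + 2 * s) * B" using d by (simp add: B_def)
    have q_eq: "q = smult ((?n - 1) * B) (Cm1 n) - smult ((?n + 2 * s + 2) * A) (gpol (Suc n))"
    proof (rule poly_eq_on_interval)
      fix x
      have "poly q x = (?n + 2 * s) * poly (Cm1 n) x - (?n + 2 * s + 2) * (x * poly (gpol n) x)"
        using gpol_deriv[of x n] by (simp add: q_def algebra_simps)
      also have "\<dots> = (?n - 1) * B * poly (Cm1 n) x - (?n + 2 * s + 2) * A * poly (gpol (Suc n)) x"
      proof -
        have "(?n + 2 * s) * poly (Cm1 n) x = (2 * ?n + 1 + 2 * s) * B * poly (Cm1 n) x"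
          by (rule arg_cong[OF Bd])
        then show ?thesis unfolding E1 by (simp add: algebra_simps)
      qed
      finally show "poly q x = poly (smult ((?n - 1) * B) (Cm1 n) - smult ((?n + 2 * s + 2) * A) (gpol (Suc n))) x"
        by simp
    qed
    define c2 c0 cm where "c2 = - (?n + 2) * A * A1"
      and "c0 = (?n - 1 + 2 * s) * B * A0 - (?n + 2) * A * B1 - 2 * s"
      and "cm = (?n - 1 + 2 * s) * B * B0"
    have X2: "x\<^sup>2 * poly (gpol n) x = A * (A1 * poly (gpol N) x + B1 * poly (gpol n) x) + B * (A0 * poly (gpol n) x + B0 * poly (Cm2 n) x)" for x
    proof -
      have "x\<^sup>2 * poly (gpol n) x = x * (x * poly (gpol n) x)" by (simp add: power2_eq_square)
      also have "\<dots> = A * (x * poly (gpol (Suc n)) x) + B * (x * poly (Cm1 n) x)" unfolding E1 by (simp add: algebra_simps)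
      finally show ?thesis unfolding E2 E0 .
    qed
    have lhs: "PX * q - smult (2 * s) (PX2 * gpol n) = smult c2 (gpol N) + smult c0 (gpol n) + smult cm (Cm2 n)"
    proof (rule poly_eq_on_interval)
      fix x
      have "poly (PX * q - smult (2 * s) (PX2 * gpol n)) x =
         (?n - 1) * B * (x * poly (Cm1 n) x) - (?n + 2 * s + 2) * A * (x * poly (gpol (Suc n)) x)
         - 2 * s * poly (gpol n) x + 2 * s * (x\<^sup>2 * poly (gpol n) x)"
        unfolding q_eq by (simp add: algebra_simps)
      also have "\<dots> = c2 * poly (gpol N) x + c0 * poly (gpol n) x + cm * poly (Cm2 n) x"
        unfolding X2 E0 E2 c2_def c0_def cm_def by (simp add: algebra_simps)
      finally show "poly (PX * q - smult (2 * s) (PX2 * gpol n)) x = poly (smult c2 (gpol N) + smult c0 (gpol n) + smult cm (Cm2 n)) x"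
        by simp
    qed
    have L0: "LP (gpol n) = smult (lam n) (gpol n)" and L1: "LP (gpol (Suc n)) = smult (lam (Suc n)) (gpol (Suc n))"
      using less 3 by (auto simp: lam_def simp del: gpol.simps)
    have Lm1: "LP (Cm1 n) = smult (lam (n - 1)) (Cm1 n)" using less 3 by (auto simp: lam_def Cm1_def)
    have Lm2: "LP (Cm2 n) = smult (lam (n - 2)) (Cm2 n)" using less 3 by (auto simp: lam_def Cm2_def)
    have rec: "smult c2 (LP (gpol N)) + smult (c0 * lam n) (gpol n) + smult (cm * lam (n - 2)) (Cm2 n)
      = PX * (smult ((?n - 1) * B * lam (n - 1)) (Cm1 n) - smult ((?n + 2 * s + 2) * A * lam (Suc n)) (gpol (Suc n)))"
    proof -
      have "LP q = smult ((?n - 1) * B * lam (n - 1)) (Cm1 n) - smult ((?n + 2 * s + 2) * A * lam (Suc n)) (gpol (Suc n))"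
        unfolding q_eq LP_diff LP_smult L1 Lm1 by (simp del: gpol.simps)
      with LP_recursion[OF q_def] show ?thesis unfolding lhs LP_add LP_smult L0 Lm2 by (simp del: gpol.simps)
    qed
    have lamS: "lam (Suc j) = lam j * (real j + 1 + 2 * s) / (real j + 1)" for j by (simp add: lam_def gam_Suc)
    have I2: "(?n + 2 * s + 2) * A * lam (Suc n) * A1 = - c2 * lam N"
    proof -
      have l: "(?n + 2) * lam N = (?n + 2 * s + 2) * lam (Suc n)"
        unfolding 3 lamS[of "Suc n"] by (simp add: add_ac)
      have "- c2 * lam N = A * A1 * ((?n + 2) * lam N)" unfolding c2_def by (simp add: algebra_simps)
      then show ?thesis unfolding l by simp
    qed
    have Im: "cm * lam (n - 2) = (?n - 1) * B * lam (n - 1) * B0" if "n \<ge> 2"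
    proof -
      define m where "m = n - 2"
      have m: "n - 2 = m" "n - 1 = Suc m" "?n = real m + 2" using that by (auto simp: m_def)
      have l: "lam (Suc m) * (real m + 1) = lam m * (real m + 1 + 2 * s)" using lamS[of m] by simp
      have "cm * lam m = B * B0 * (lam m * (real m + 1 + 2 * s))"
        unfolding cm_def m(3) by (simp add: algebra_simps)
      also have "\<dots> = (?n - 1) * B * lam (Suc m) * B0" unfolding l[symmetric] m(3) by (simp add: algebra_simps)
      finally show ?thesis unfolding m(1,2) .
    qed
    have I0: "c0 * lam n = (?n - 1) * B * lam (n - 1) * A0 - (?n + 2 * s + 2) * A * lam (Suc n) * B1"
    proof (cases n)
      case 0
      have "(2 * s + 1) \<noteq> 0" "(2 * s + 3) \<noteq> 0" using s_pos by auto
      moreover have l: "lam (Suc 0) = lam 0 * (1 + 2 * s)" using lamS[of 0] by simp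
      ultimately show ?thesis unfolding c0_def A_def B_def A1_def B1_def A0_def 0 l
        by (simp add: divide_simps) (simp add: algebra_simps)
    next
      case (Suc m)
      have pos: "real m + 1 + 2 * s > 0" "2 * real m + 1 + 2 * s > 0" "2 * real m + 3 + 2 * s > 0" "2 * real m + 5 + 2 * s > 0"
        using s_pos by simp_all
      have nm: "?n = real m + 1" using Suc by simp
      have Bv: "B = (real m + 1 + 2 * s) / (2 * real m + 3 + 2 * s)" and Av: "A = (real m + 2) / (2 * real m + 3 + 2 * s)"
        and A0v: "A0 = (real m + 1) / (2 * real m + 1 + 2 * s)" and B1v: "B1 = (real m + 2 + 2 * s) / (2 * real m + 5 + 2 * s)"
        unfolding B_def A_def A0_def B1_def nm by (simp_all add: algebra_simps)
      define u where "u = 2 * real m + 3 + 2 * s"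
      have e1: "(?n - 1 + 2 * s) * B * A0 * lam n - (?n - 1) * B * lam (n - 1) * A0 = (2 * s * (real m + 1) / u) * lam n"
      proof -
        have l: "lam (n - 1) = lam n * (real m + 1) / (real m + 1 + 2 * s)" using lamS[of m] pos Suc by simp
        show ?thesis unfolding l Bv A0v nm u_def using pos
          by (simp add: divide_simps) (simp add: algebra_simps)
      qed
      have e2: "(?n + 2) * A * B1 * lam n - (?n + 2 * s + 2) * A * lam (Suc n) * B1 = - (2 * s * (real m + 2 + 2 * s) / u) * lam n"
      proof -
        have l: "lam (Suc n) = lam n * (real m + 2 + 2 * s) / (real m + 2)" using lamS[of n] nm by (simp add: add_ac)
        show ?thesis unfolding l Av B1v nm u_def using pos
          by (simp add: divide_simps) (simp add: algebra_simps)
      qed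
      have "c0 * lam n - ((?n - 1) * B * lam (n - 1) * A0 - (?n + 2 * s + 2) * A * lam (Suc n) * B1) =
         ((?n - 1 + 2 * s) * B * A0 * lam n - (?n - 1) * B * lam (n - 1) * A0)
         - ((?n + 2) * A * B1 * lam n - (?n + 2 * s + 2) * A * lam (Suc n) * B1) - 2 * s * lam n"
        unfolding c0_def by (simp add: algebra_simps)
      also have "\<dots> = lam n * (2 * s) * ((real m + 1) / u + (real m + 2 + 2 * s) / u - 1)"
        unfolding e1 e2 by (simp add: algebra_simps)
      also have "(real m + 1) / u + (real m + 2 + 2 * s) / u - 1 = 0"
        using pos unfolding add_divide_distrib[symmetric] by (simp add: u_def)
      finally show ?thesis by simp
    qed
    have "smult c2 (LP (gpol N)) = smult c2 (smult (lam N) (gpol N))"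
    proof (rule poly_eq_on_interval)
      fix x
      have "c2 * poly (LP (gpol N)) x + c0 * lam n * poly (gpol n) x + cm * lam (n - 2) * poly (Cm2 n) x =
         (?n - 1) * B * lam (n - 1) * (x * poly (Cm1 n) x) - (?n + 2 * s + 2) * A * lam (Suc n) * (x * poly (gpol (Suc n)) x)"
        using arg_cong[OF rec, of "\<lambda>p. poly p x"] by (simp add: algebra_simps del: gpol.simps)
      also have "\<dots> = c2 * lam N * poly (gpol N) x + c0 * lam n * poly (gpol n) x + (?n - 1) * B * lam (n - 1) * B0 * poly (Cm2 n) x"
        unfolding E0 E2 I0 using arg_cong[OF I2, of "\<lambda>t. t * poly (gpol N) x"] by (simp add: algebra_simps)
      also have "(?n - 1) * B * lam (n - 1) * B0 * poly (Cm2 n) x = cm * lam (n - 2) * poly (Cm2 n) x"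
        by (cases "n \<ge> 2") (simp_all add: Im Cm2_def)
      finally show "poly (smult c2 (LP (gpol N))) x = poly (smult c2 (smult (lam N) (gpol N))) x" by simp
    qed
    moreover have "c2 \<noteq> 0" using d unfolding c2_def A_def A1_def by simp
    ultimately show ?thesis unfolding lam_def by (metis smult_cancel)
  qed
qed

text \<open>The eigenvalues.\<close>

definition lam :: "nat \<Rightarrow> real" where "lam n = ell0 * gam n"

lemma gam_strict_mono: "i < j \<Longrightarrow> gam i < gam j"
proof -
  have "strict_mono gam"
  proof (rule strict_mono_Suc_iff[THEN iffD2], intro allI)
    fix n
    have "gam n * 1 < gam n * ((real n + 1 + 2 * s) / (real n + 1))"
      using gam_pos[of n] s_pos by (intro mult_strict_left_mono) (simp_all add: field_simps)
    then show "gam n < gam (Suc n)" by (simp add: gam_Suc)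
  qed
  then show "i < j \<Longrightarrow> gam i < gam j" by (rule strict_monoD)
qed

lemma lam_nonzero: "lam n \<noteq> 0"
  using ell0_nonzero gam_pos[of n] by (simp add: lam_def)

lemma lam_inj: "i \<noteq> j \<Longrightarrow> lam i \<noteq> lam j"
  using ell0_nonzero gam_strict_mono[of i j] gam_strict_mono[of j i] by (auto simp: lam_def neq_iff)

end

section \<open>Orthonormality and completeness\<close>

lemma AE_zero_if_interval_integrals_zero:
  fixes g :: "real \<Rightarrow> complex"
  assumes int: "integrable lborel g" and zero: "\<And>a b. a \<le> b \<Longrightarrow> (LINT x:{a..b}|lborel. g x) = 0"
  shows "AE x in lborel. g x = 0"
proof (rule sigma_finite_measure.density_zero[OF lborel.sigma_finite_measure_axioms int])
  fix A :: "real set" assume "A \<in> sets lborel"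
  then have A: "A \<in> sets borel" by simp
  have si: "set_integrable lborel B g" if "B \<in> sets borel" for B
    unfolding set_integrable_def using that int by (intro integrable_mult_indicator) auto
  have limit: "(\<lambda>n. LINT x:{- real n..real n}|lborel. g x) \<longlonglongrightarrow> (LINT x:UNIV|lborel. g x)"
    unfolding set_lebesgue_integral_def
  proof (rule integral_dominated_convergence[where w = "\<lambda>x. norm (g x)"])
    show "AE x in lborel. (\<lambda>n. indicat_real {- real n..real n} x *\<^sub>R g x) \<longlonglongrightarrow> indicat_real UNIV x *\<^sub>R g x"
    proof (intro AE_I2 tendsto_eventually)
      fix x :: real
      obtain N :: nat where N: "\<bar>x\<bar> \<le> real N" using real_arch_simple by blast
      show "\<forall>\<^sub>F n in sequentially. indicat_real {- real n..real n} x *\<^sub>R g x = indicat_real UNIV x *\<^sub>R g x"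
        unfolding eventually_sequentially
      proof (intro exI[of _ N] allI impI)
        fix n assume "N \<le> n"
        then have "x \<in> {- real n..real n}" using N by (auto simp: abs_le_iff)
        then show "indicat_real {- real n..real n} x *\<^sub>R g x = indicat_real UNIV x *\<^sub>R g x" by simp
      qed
    qed
    show "integrable lborel (\<lambda>x. norm (g x))" using int by (rule integrable_norm)
  qed (use int in \<open>auto simp: indicator_def\<close>)
  have "(LINT x:{- real n..real n}|lborel. g x) = 0" for n by (rule zero) simp
  with limit have U: "(LINT x:UNIV|lborel. g x) = 0" by (simp add: LIMSEQ_const_iff)
  show "(LINT x:A|lborel. g x) = 0"
    using A
  proof (induction A rule: borel_set_induct)
    case (compl A)
    have "(LINT x:A \<union> - A|lborel. g x) = (LINT x:A|lborel. g x) + (LINT x:- A|lborel. g x)"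
      using compl(1) by (intro set_integral_Un si) auto
    then show ?case using compl U by simp
  next
    case (union f)
    have "(LINT x:(\<Union>i. f i)|lborel. g x) = (\<Sum>i. LINT x:f i|lborel. g x)"
      using union by (intro lebesgue_integral_countable_add si) (auto simp: disjoint_family_on_def)
    then show ?case using union by simp
  next
    case (interval a b) then show ?case by (rule zero)
  qed (simp add: set_lebesgue_integral_def)
qed

context fractional_order
begin

text \<open>Polynomials are dense in the continuous functions on \<open>[-1, 1]\<close>, and indicators of intervals are bounded
  pointwise limits of continuous functions.\<close>

lemma AE_zero_if_moments_zero:
  fixes g :: "real \<Rightarrow> complex"
  assumes int: "set_integrable lborel {-1<..<1} g"
    and zero: "\<And>p. (LINT x:{-1<..<1}|lborel. poly p x *\<^sub>R g x) = 0"
  shows "AE x in lborel. x \<in> {-1<..<1} \<longrightarrow> g x = 0"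
proof -
  define G where "G x = indicator {-1<..<1} x *\<^sub>R g x" for x
  have G: "integrable lborel G" using int by (simp add: set_integrable_def G_def[abs_def])
  have mult: "integrable lborel (\<lambda>x. f x *\<^sub>R G x)" if f: "continuous_on {-1..1} f" for f :: "real \<Rightarrow> real"
  proof -
    have "bounded (f ` {-1..1})" using f by (intro compact_imp_bounded compact_continuous_image) auto
    then obtain B where B: "\<And>y. y \<in> {-1..1} \<Longrightarrow> norm (f y) \<le> B" "B > 0"
      by (metis bounded_pos imageI)
    have m: "(\<lambda>x. (indicator {-1<..<1} x *\<^sub>R f x) *\<^sub>R G x) \<in> borel_measurable lborel"
    proof (rule borel_measurable_scaleR)
      show "(\<lambda>x. indicator {-1<..<1} x *\<^sub>R f x) \<in> borel_measurable lborel"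
      proof -
        have "continuous_on {-1<..<1} f" by (rule continuous_on_subset[OF f]) auto
        from set_measurable_continuous[OF this] show ?thesis by (simp add: set_borel_measurable_def)
      qed
    qed (use G in auto)
    have e: "(\<lambda>x. (indicator {-1<..<1} x *\<^sub>R f x) *\<^sub>R G x) = (\<lambda>x. f x *\<^sub>R G x)"
      by (auto simp: G_def indicator_def)
    show ?thesis
    proof (rule Bochner_Integration.integrable_bound)
      show "integrable lborel (\<lambda>x. B * norm (G x))" using G by (intro integrable_mult_right integrable_norm)
      show "(\<lambda>x. f x *\<^sub>R G x) \<in> borel_measurable lborel" using m unfolding e .
      show "AE x in lborel. norm (f x *\<^sub>R G x) \<le> norm (B * norm (G x))"
      proof (rule AE_I2)
        fix x
        show "norm (f x *\<^sub>R G x) \<le> norm (B * norm (G x))"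
        proof (cases "x \<in> {-1<..<1}")
          case True
          then have "norm (f x) * norm (G x) \<le> B * norm (G x)" using B(1)[of x] by (intro mult_right_mono) auto
          then show ?thesis using B(2) by (simp add: abs_mult)
        qed (simp add: G_def)
      qed
    qed
  qed
  have cont0: "(LINT x|lborel. f x *\<^sub>R G x) = 0" if f: "continuous_on {-1..1} f" for f :: "real \<Rightarrow> real"
  proof (rule ccontr)
    let ?J = "norm (LINT x|lborel. f x *\<^sub>R G x)" and ?N = "LINT x|lborel. norm (G x)"
    assume "(LINT x|lborel. f x *\<^sub>R G x) \<noteq> 0"
    then have J: "?J > 0" by simp
    have N0: "?N \<ge> 0" by simp
    define M where "M = ?N + 1"
    have M: "M > 0" using N0 unfolding M_def by linarith
    \<comment> \<open>chosen so that the error of approximation is at most half of the integral\<close>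
    define \<epsilon> where "\<epsilon> = ?J / (2 * M)"
    have e: "\<epsilon> > 0" using J M unfolding \<epsilon>_def by (intro divide_pos_pos) auto
    obtain q where q: "real_polynomial_function q" "\<And>x. x \<in> {-1..1} \<Longrightarrow> \<bar>f x - q x\<bar> < \<epsilon>"
      using Stone_Weierstrass_real_polynomial_function[OF compact_Icc f e] by blast
    obtain a n where an: "q = (\<lambda>x. \<Sum>i\<le>n. a i * x ^ i)" using q(1) real_polynomial_function_iff_sum by blast
    define p where "p = (\<Sum>i\<le>n. monom (a i) i)"
    have p: "poly p x = q x" for x by (simp add: p_def an poly_sum poly_monom)
    have z: "(LINT x|lborel. poly p x *\<^sub>R G x) = 0"
      using zero[of p] by (simp add: set_lebesgue_integral_def G_def mult.commute)
    have ip: "integrable lborel (\<lambda>x. poly p x *\<^sub>R G x)" by (rule mult) (intro continuous_intros)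
    have "(LINT x|lborel. f x *\<^sub>R G x) = (LINT x|lborel. (f x - poly p x) *\<^sub>R G x)"
      using mult[OF f] ip z by (simp add: scaleR_diff_left)
    also have "norm \<dots> \<le> (LINT x|lborel. norm ((f x - poly p x) *\<^sub>R G x))" by (rule integral_norm_bound)
    also have "\<dots> \<le> (LINT x|lborel. \<epsilon> * norm (G x))"
    proof (rule integral_mono)
      show "integrable lborel (\<lambda>x. norm ((f x - poly p x) *\<^sub>R G x))"
        by (intro integrable_norm mult continuous_intros f)
      show "integrable lborel (\<lambda>x. \<epsilon> * norm (G x))" using G by (intro integrable_mult_right integrable_norm)
      show "norm ((f x - poly p x) *\<^sub>R G x) \<le> \<epsilon> * norm (G x)" for x
      proof (cases "x \<in> {-1<..<1}")
        case True
        then have "\<bar>f x - poly p x\<bar> \<le> \<epsilon>" using q(2)[of x] by (simp add: p)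
        then show ?thesis by (simp add: mult_right_mono)
      qed (simp add: G_def)
    qed
    also have "\<dots> = \<epsilon> * ?N" by simp
    also have "\<dots> \<le> \<epsilon> * M" using e by (simp add: M_def)
    also have "\<dots> = ?J / 2" using M unfolding \<epsilon>_def by (simp del: norm_eq_zero)
    finally show False using J by simp
  qed
  have "AE x in lborel. G x = 0"
  proof (rule AE_zero_if_interval_integrals_zero[OF G])
    fix a b :: real assume ab: "a \<le> b"
    \<comment> \<open>trapezoidal functions decreasing to the indicator of \<open>[a, b]\<close>\<close>
    define f where "f n x = max 0 (1 - real n * max 0 (max (a - x) (x - b)))" for n :: nat and x
    have fc: "continuous_on S (f n)" for n S unfolding f_def[abs_def] by (intro continuous_intros)
    have "(\<lambda>n. LINT x|lborel. f n x *\<^sub>R G x) \<longlonglongrightarrow> (LINT x|lborel. indicator {a..b} x *\<^sub>R G x)"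
    proof (rule integral_dominated_convergence[where w = "\<lambda>x. norm (G x)"])
      show "integrable lborel (\<lambda>x. norm (G x))" using G by (rule integrable_norm)
      show "AE x in lborel. (\<lambda>n. f n x *\<^sub>R G x) \<longlonglongrightarrow> indicator {a..b} x *\<^sub>R G x"
      proof (intro AE_I2 tendsto_scaleR tendsto_const)
        fix x :: real
        show "(\<lambda>n. f n x) \<longlonglongrightarrow> indicator {a..b} x"
        proof (cases "x \<in> {a..b}")
          case True then show ?thesis by (simp add: f_def)
        next
          case False
          define d where "d = max 0 (max (a - x) (x - b))"
          have d: "d > 0" using False by (auto simp: d_def)
          obtain N where N: "1 / d < real N" using reals_Archimedean2 by blast
          show ?thesis
          proof (rule tendsto_eventually, unfold eventually_sequentially, intro exI[of _ N] allI impI)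
            fix n assume "N \<le> n"
            then have "1 / d \<le> real n" using N by linarith
            then have "1 \<le> real n * d" using d by (simp add: field_simps)
            then have "f n x = 0" unfolding f_def d_def[symmetric] by simp
            then show "f n x = indicator {a..b} x" using False by simp
          qed
        qed
      qed
      show "AE x in lborel. norm (f n x *\<^sub>R G x) \<le> norm (G x)" for n
      proof (rule AE_I2)
        fix x
        have "0 \<le> real n * max 0 (max (a - x) (x - b))" by simp
        then have "\<bar>f n x\<bar> \<le> 1" unfolding f_def by linarith
        then show "norm (f n x *\<^sub>R G x) \<le> norm (G x)" by (simp add: mult_left_le_one_le)
      qed
    qed (use mult[OF fc] G in auto)
    moreover have "(LINT x|lborel. f n x *\<^sub>R G x) = 0" for n by (rule cont0[OF fc])
    ultimately have "(LINT x|lborel. indicator {a..b} x *\<^sub>R G x) = 0"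
      by (simp add: LIMSEQ_const_iff)
    then show "(LINT x:{a..b}|lborel. G x) = 0" by (simp add: set_lebesgue_integral_def)
  qed
  then show ?thesis by eventually_elim (auto simp: G_def)
qed

text \<open>The open interval, and the Gegenbauer coefficients of a function.\<close>

abbreviation I :: "real set" where "I \<equiv> {-1<..<1}"
abbreviation gc :: "(real \<Rightarrow> complex) \<Rightarrow> nat \<Rightarrow> complex" where "gc \<equiv> gegenbauer_coeff s"

lemma continuous_L2:
  assumes v: "continuous_on {-1..1} v" shows "v \<in> L2_weighted s"
proof -
  have v': "continuous_on I v" using v by (rule continuous_on_subset) auto
  have "set_borel_measurable lborel I v" using v' by (rule set_measurable_continuous) simp
  moreover have "\<exists>C. dens (\<lambda>x. (cmod (v x))\<^sup>2 * omega s x) C"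
    by (rule continuous_imp_dens) (intro continuous_intros v omega_cont)
  then have "set_integrable lborel I (\<lambda>x. (cmod (v x))\<^sup>2 * omega s x)" using dens_integrable by blast
  ultimately show ?thesis by (simp add: L2_weighted_def)
qed

lemma L2_lincomb:
  assumes v: "v \<in> L2_weighted s" and w: "w \<in> L2_weighted s"
  shows "(\<lambda>x. v x - c * w x) \<in> L2_weighted s"
proof -
  have m: "set_borel_measurable lborel I v" "set_borel_measurable lborel I w"
    using v w by (auto simp: L2_weighted_def)
  have i: "set_integrable lborel I (\<lambda>x. (cmod (v x))\<^sup>2 * omega s x)" "set_integrable lborel I (\<lambda>x. (cmod (w x))\<^sup>2 * omega s x)"
    using v w by (auto simp: L2_weighted_def)
  have "(\<lambda>x. indicator I x *\<^sub>R v x - c * (indicator I x *\<^sub>R w x)) \<in> borel_measurable lborel"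
    using m unfolding set_borel_measurable_def by measurable
  moreover have "(\<lambda>x. indicator I x *\<^sub>R v x - c * (indicator I x *\<^sub>R w x)) = (\<lambda>x. indicator I x *\<^sub>R (v x - c * w x))"
    by (simp add: fun_eq_iff scaleR_diff_right)
  ultimately have m2: "set_borel_measurable lborel I (\<lambda>x. v x - c * w x)"
    unfolding set_borel_measurable_def by simp
  have m3: "set_borel_measurable lborel I (\<lambda>x. (cmod (v x - c * w x))\<^sup>2 * omega s x)"
  proof -
    have "(\<lambda>x. (cmod (indicator I x *\<^sub>R (v x - c * w x)))\<^sup>2 * omega s x) \<in> borel_measurable lborel"
      using m2 unfolding set_borel_measurable_def by measurable
    moreover have "(\<lambda>x. (cmod (indicator I x *\<^sub>R (v x - c * w x)))\<^sup>2 * omega s x) = (\<lambda>x. indicator I x *\<^sub>R ((cmod (v x - c * w x))\<^sup>2 * omega s x))"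
      by (auto simp: indicator_def)
    ultimately show ?thesis unfolding set_borel_measurable_def by simp
  qed
  have "set_integrable lborel I (\<lambda>x. (cmod (v x - c * w x))\<^sup>2 * omega s x)"
  proof (rule set_integral_dominated(1)[OF _ m3])
    show "set_integrable lborel I (\<lambda>x. 2 * ((cmod (v x))\<^sup>2 * omega s x) + 2 * (cmod c)\<^sup>2 * ((cmod (w x))\<^sup>2 * omega s x))"
      using i by (intro set_integral_add set_integrable_mult_right) auto
    fix x :: real
    have "(cmod (v x - c * w x))\<^sup>2 \<le> (cmod (v x) + cmod (c * w x))\<^sup>2"
      by (intro power_mono norm_triangle_ineq4) auto
    also have "\<dots> \<le> 2 * (cmod (v x))\<^sup>2 + 2 * (cmod (c * w x))\<^sup>2"
      using zero_le_power2[of "cmod (v x) - cmod (c * w x)"] by (simp add: power2_eq_square algebra_simps)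
    finally have "(cmod (v x - c * w x))\<^sup>2 * omega s x \<le> (2 * (cmod (v x))\<^sup>2 + 2 * (cmod (c * w x))\<^sup>2) * omega s x"
      by (rule mult_right_mono) simp
    then show "norm ((cmod (v x - c * w x))\<^sup>2 * omega s x) \<le> 2 * ((cmod (v x))\<^sup>2 * omega s x) + 2 * (cmod c)\<^sup>2 * ((cmod (w x))\<^sup>2 * omega s x)"
      by (simp add: norm_mult power_mult_distrib algebra_simps)
  qed
  with m2 show ?thesis by (simp add: L2_weighted_def)
qed

lemma L2_diff: "v \<in> L2_weighted s \<Longrightarrow> w \<in> L2_weighted s \<Longrightarrow> (\<lambda>x. v x - w x) \<in> L2_weighted s"
  using L2_lincomb[of v w 1] by simp

lemma poly_weight_integrable: "set_integrable lborel I (\<lambda>x. poly p x * omega s x)"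
  using dens_wt[of p] dens_integrable by (auto simp: wt_def[abs_def] mult.commute)

text \<open>Eigenfunctions of a symmetric operator for different eigenvalues.\<close>

lemma gpol_orthogonal:
  assumes "i \<noteq> j"
  shows "(LINT x:I|lborel. poly (gpol i) x * poly (gpol j) x * omega s x) = 0" (is "?J = 0")
proof -
  have L2: "(\<lambda>x. complex_of_real (poly (LP (gpol j)) x)) \<in> L2_weighted s"
    by (intro continuous_L2 continuous_intros)
  have "(LINT x:I|lborel. (poly (gpol i) x * omega s x) *\<^sub>R complex_of_real (poly (LP (gpol j)) x)) =
        complex_of_real (lam j * ?J)"
    unfolding set_integral_mult_right[symmetric] set_integral_complex_of_real[symmetric]
    by (intro set_lebesgue_integral_cong) (auto simp: LP_gpol lam_def scaleR_conv_of_real mult_ac)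
  moreover have "(LINT x:I|lborel. (poly (LP (gpol i)) x * omega s x) *\<^sub>R complex_of_real (poly (gpol j) x)) =
        complex_of_real (lam i * ?J)"
    unfolding set_integral_mult_right[symmetric] set_integral_complex_of_real[symmetric]
    by (intro set_lebesgue_integral_cong) (auto simp: LP_gpol lam_def scaleR_conv_of_real mult_ac)
  ultimately have "lam j * ?J = lam i * ?J"
    using weighted_frac_lap_symmetric[OF weighted_frac_lap_poly L2, of "gpol i"] by (simp only: of_real_eq_iff)
  then show ?thesis using lam_inj[OF assms] by simp
qed

lemma gpol_nonzero: "gpol n \<noteq> 0"
proof -
  have *: "(real n + 1) * poly (gpol (Suc n)) 1 = (real n + 1 + 2 * s) * poly (gpol n) 1 \<and> poly (gpol n) 1 > 0" for n
  proof (induction n)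
    case (Suc n)
    have "poly (gpol (Suc n)) 1 = (real n + 1 + 2 * s) * poly (gpol n) 1 / (real n + 1)"
      using Suc by (simp add: field_simps)
    then have pos: "poly (gpol (Suc n)) 1 > 0" using Suc s_pos by simp
    have "(real n + 2) * poly (gpol (Suc (Suc n))) 1 =
      (2 * real n + 3 + 2 * s) * poly (gpol (Suc n)) 1 - (real n + 1 + 2 * s) * poly (gpol n) 1"
      by (simp add: diff_divide_distrib[symmetric])
    also have "\<dots> = (2 * real n + 3 + 2 * s) * poly (gpol (Suc n)) 1 - (real n + 1) * poly (gpol (Suc n)) 1"
      using Suc by (simp only:)
    finally show ?case using pos by (simp add: algebra_simps)
  qed simp
  from *[of n] show ?thesis by (metis poly_0 less_irrefl)
qed

text \<open>The squared norm of a Gegenbauer polynomial, and the orthonormal polynomials.\<close>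

definition gnorm_sq :: "nat \<Rightarrow> real" where "gnorm_sq j = (LINT x:I|lborel. (poly (gpol j) x)\<^sup>2 * omega s x)"

lemma gnorm_sq_pos: "gnorm_sq j > 0"
proof -
  let ?f = "\<lambda>x. indicator I x * ((poly (gpol j) x)\<^sup>2 * omega s x)"
  have int: "integrable lborel ?f"
    using poly_weight_integrable[of "gpol j ^ 2"] by (simp add: set_integrable_def poly_power)
  have e: "gnorm_sq j = (LINT x|lborel. ?f x)" by (simp add: gnorm_sq_def set_lebesgue_integral_def)
  have "gnorm_sq j \<noteq> 0"
  proof
    assume "gnorm_sq j = 0"
    then have "AE x in lborel. ?f x = 0"
      unfolding e using int by (subst (asm) integral_nonneg_eq_0_iff_AE) auto
    moreover have "AE x in lborel. x \<notin> {x. poly (gpol j) x = 0}"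
      using poly_roots_finite[OF gpol_nonzero[of j]]
      by (intro AE_not_in finite_imp_null_set_lborel)
    ultimately have "AE x in lborel. x \<notin> I"
      by eventually_elim (auto simp: omega_def indicator_def power2_eq_1_iff)
    then have "emeasure lborel I = 0"
      by (subst (asm) AE_iff_measurable[of I]) auto
    then show False by simp
  qed
  moreover have "gnorm_sq j \<ge> 0" unfolding e by (rule Bochner_Integration.integral_nonneg) simp
  ultimately show ?thesis by simp
qed

definition ep :: "nat \<Rightarrow> real poly" where "ep j = smult (1 / sqrt (gnorm_sq j)) (gpol j)"

lemma normalized_eq: "normalized_gegenbauer s j x = poly (ep j) x"
  by (simp add: normalized_gegenbauer_def ep_def gnorm_sq_def poly_gpol)

lemma LP_ep: "LP (ep j) = smult (lam j) (ep j)"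
  by (simp add: ep_def LP_smult LP_gpol lam_def mult_ac)

lemma ep_orthonormal:
  "(LINT x:I|lborel. poly (ep i) x * poly (ep j) x * omega s x) = (if i = j then 1 else 0)"
proof -
  have "(LINT x:I|lborel. poly (ep i) x * poly (ep j) x * omega s x) =
     (LINT x:I|lborel. (1 / sqrt (gnorm_sq i) * (1 / sqrt (gnorm_sq j))) * (poly (gpol i) x * poly (gpol j) x * omega s x))"
    by (intro set_lebesgue_integral_cong) (auto simp: ep_def)
  also have "\<dots> = (1 / sqrt (gnorm_sq i) * (1 / sqrt (gnorm_sq j))) * (LINT x:I|lborel. poly (gpol i) x * poly (gpol j) x * omega s x)"
    by (rule set_integral_mult_right)
  also have "\<dots> = (if i = j then 1 else 0)"
  proof (cases "i = j")
    case True
    then have "(LINT x:I|lborel. poly (gpol i) x * poly (gpol j) x * omega s x) = gnorm_sq i"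
      by (simp add: gnorm_sq_def power2_eq_square)
    then show ?thesis using True gnorm_sq_pos[of i] by simp
  qed (simp add: gpol_orthogonal)
  finally show ?thesis .
qed

lemma gc_eq: "gc v j = (LINT x:I|lborel. (poly (ep j) x * omega s x) *\<^sub>R v x)"
  by (simp add: gegenbauer_coeff_def normalized_eq)

lemma gc_integrable: "v \<in> L2_weighted s \<Longrightarrow> set_integrable lborel I (\<lambda>x. (poly (ep j) x * omega s x) *\<^sub>R v x)"
  by (rule L2_weighted_mult_integrable) (auto intro!: continuous_intros)

lemma gc_lincomb:
  assumes "v \<in> L2_weighted s" "w \<in> L2_weighted s"
  shows "gc (\<lambda>x. v x - c * w x) j = gc v j - c * gc w j"
proof -
  have "gc (\<lambda>x. v x - c * w x) j =
    (LINT x:I|lborel. (poly (ep j) x * omega s x) *\<^sub>R v x - c * ((poly (ep j) x * omega s x) *\<^sub>R w x))"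
    unfolding gc_eq by (intro set_lebesgue_integral_cong) (auto simp: scaleR_diff_right)
  also have "\<dots> = gc v j - c * gc w j"
    unfolding gc_eq set_integral_mult_right[symmetric]
    by (rule set_integral_diff(2)[OF gc_integrable[OF assms(1)] set_integrable_mult_right[OF gc_integrable[OF assms(2)]]])
  finally show ?thesis .
qed

lemma gc_diff: "v \<in> L2_weighted s \<Longrightarrow> w \<in> L2_weighted s \<Longrightarrow> gc (\<lambda>x. v x - w x) j = gc v j - gc w j"
  using gc_lincomb[of v w 1] by simp

lemma gc_ep: "gc (\<lambda>x. complex_of_real (poly (ep i) x)) j = (if i = j then 1 else 0)"
proof -
  have "gc (\<lambda>x. complex_of_real (poly (ep i) x)) j = (LINT x:I|lborel. complex_of_real (poly (ep i) x * poly (ep j) x * omega s x))"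
    unfolding gc_eq by (intro set_lebesgue_integral_cong) (auto simp: scaleR_conv_of_real)
  then show ?thesis by (simp only: set_integral_complex_of_real ep_orthonormal) simp
qed

lemma gc_lap:
  assumes "weighted_frac_lap s \<phi> g" "g \<in> L2_weighted s"
  shows "gc g j = complex_of_real (lam j) * gc \<phi> j"
proof -
  have "gc g j = (LINT x:I|lborel. complex_of_real (lam j) * ((poly (ep j) x * omega s x) *\<^sub>R \<phi> x))"
    unfolding gc_eq weighted_frac_lap_symmetric[OF assms, of "ep j"]
    by (intro set_lebesgue_integral_cong) (auto simp: LP_ep scaleR_conv_of_real)
  then show ?thesis unfolding gc_eq set_integral_mult_right .
qed

text \<open>The square of the weighted norm.\<close>

definition L2sq :: "(real \<Rightarrow> complex) \<Rightarrow> real" where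
  "L2sq v = (LINT x:I|lborel. (cmod (v x))\<^sup>2 * omega s x)"

lemma L2sq_nonneg: "L2sq v \<ge> 0"
  unfolding L2sq_def set_lebesgue_integral_def by (rule Bochner_Integration.integral_nonneg) simp

lemma L2_norm_eq: "L2_weighted_norm s v = sqrt (L2sq v)"
  by (simp add: L2_weighted_norm_def L2sq_def)

lemma L2sq_minus_projection:
  assumes v: "v \<in> L2_weighted s"
  shows "L2sq (\<lambda>x. v x - gc v n * complex_of_real (poly (ep n) x)) = L2sq v - (cmod (gc v n))\<^sup>2"
proof -
  let ?c = "gc v n" and ?e = "\<lambda>x. poly (ep n) x"
  have i1: "set_integrable lborel I (\<lambda>x. (cmod (v x))\<^sup>2 * omega s x)" using v by (simp add: L2_weighted_def)
  note i2 = gc_integrable[OF v, of n]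
  have i3: "set_integrable lborel I (\<lambda>x. ?e x * ?e x * omega s x)"
    using poly_weight_integrable[of "ep n * ep n"] by simp
  have i2': "set_integrable lborel I (\<lambda>x. cnj ?c * ((?e x * omega s x) *\<^sub>R v x))"
    using i2 by (intro set_integrable_mult_right) auto
  have i2'': "set_integrable lborel I (\<lambda>x. Re (cnj ?c * ((?e x * omega s x) *\<^sub>R v x)))"
  proof -
    have "integrable lborel (\<lambda>x. Re (indicator I x *\<^sub>R (cnj ?c * ((?e x * omega s x) *\<^sub>R v x))))"
      using i2' unfolding set_integrable_def by (rule integrable_Re)
    then show ?thesis by (simp only: set_integrable_def scaleR_complex.sel real_scaleR_def)
  qed
  have r: "(LINT x:I|lborel. Re (cnj ?c * ((?e x * omega s x) *\<^sub>R v x))) = (cmod ?c)\<^sup>2"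
  proof -
    have "(LINT x:I|lborel. Re (cnj ?c * ((?e x * omega s x) *\<^sub>R v x))) =
       (LINT x|lborel. Re (indicator I x *\<^sub>R (cnj ?c * ((?e x * omega s x) *\<^sub>R v x))))"
      by (simp only: set_lebesgue_integral_def scaleR_complex.sel real_scaleR_def)
    also have "\<dots> = Re (LINT x:I|lborel. cnj ?c * ((?e x * omega s x) *\<^sub>R v x))"
      using i2' unfolding set_lebesgue_integral_def set_integrable_def by (rule integral_Re)
    also have "(LINT x:I|lborel. cnj ?c * ((?e x * omega s x) *\<^sub>R v x)) = cnj ?c * ?c"
      unfolding gc_eq by (rule set_integral_mult_right)
    also have "Re (cnj ?c * ?c) = (cmod ?c)\<^sup>2"
      by (metis Re_complex_of_real complex_norm_square mult.commute of_real_power)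
    finally show ?thesis .
  qed
  have pt: "(cmod (v x - ?c * complex_of_real (?e x)))\<^sup>2 * omega s x =
      (cmod (v x))\<^sup>2 * omega s x - 2 * Re (cnj ?c * ((?e x * omega s x) *\<^sub>R v x)) + (cmod ?c)\<^sup>2 * (?e x * ?e x * omega s x)" for x
    by (simp add: cmod_power2) (simp add: power2_eq_square algebra_simps)
  have "L2sq (\<lambda>x. v x - ?c * complex_of_real (?e x)) =
     (LINT x:I|lborel. (cmod (v x))\<^sup>2 * omega s x - 2 * Re (cnj ?c * ((?e x * omega s x) *\<^sub>R v x)) + (cmod ?c)\<^sup>2 * (?e x * ?e x * omega s x))"
    unfolding L2sq_def pt ..
  also have "\<dots> = L2sq v - 2 * (LINT x:I|lborel. Re (cnj ?c * ((?e x * omega s x) *\<^sub>R v x))) + (cmod ?c)\<^sup>2 * (LINT x:I|lborel. ?e x * ?e x * omega s x)"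
    using i1 i2'' i3 unfolding L2sq_def by (simp add: set_integral_add set_integral_diff)
  also have "\<dots> = L2sq v - (cmod ?c)\<^sup>2"
    unfolding r ep_orthonormal by simp
  finally show ?thesis .
qed

lemma Bessel: "v \<in> L2_weighted s \<Longrightarrow> (\<Sum>j<N. (cmod (gc v j))\<^sup>2) \<le> L2sq v"
proof (induction N arbitrary: v)
  case 0 then show ?case by (simp add: L2sq_nonneg)
next
  case (Suc N)
  define w where "w x = v x - gc v N * complex_of_real (poly (ep N) x)" for x
  have e: "(\<lambda>x. complex_of_real (poly (ep N) x)) \<in> L2_weighted s"
    by (intro continuous_L2 continuous_intros)
  have w: "w \<in> L2_weighted s" unfolding w_def[abs_def] by (rule L2_lincomb[OF Suc.prems e])
  have "gc w j = gc v j" if "j < N" for j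
    unfolding w_def[abs_def] gc_lincomb[OF Suc.prems e] gc_ep using that by simp
  then have "(\<Sum>j<N. (cmod (gc v j))\<^sup>2) = (\<Sum>j<N. (cmod (gc w j))\<^sup>2)" by simp
  also have "\<dots> \<le> L2sq w" by (rule Suc.IH[OF w])
  also have "\<dots> = L2sq v - (cmod (gc v N))\<^sup>2" unfolding w_def[abs_def] by (rule L2sq_minus_projection[OF Suc.prems])
  finally show ?case by simp
qed

lemma gc_le_norm: "v \<in> L2_weighted s \<Longrightarrow> (cmod (gc v j))\<^sup>2 \<le> L2sq v"
  using Bessel[of v "Suc j"] sum_nonneg[of "{..<j}" "\<lambda>j. (cmod (gc v j))\<^sup>2"] by simp

text \<open>Membership in the linear span of the Gegenbauer polynomials.\<close>

inductive gspan :: "real poly \<Rightarrow> bool" where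
  gspan_0: "gspan 0"
| gspan_step: "gspan p \<Longrightarrow> gspan (p + smult c (gpol n))"

lemma gspan_add: "gspan q \<Longrightarrow> gspan p \<Longrightarrow> gspan (p + q)"
proof (induction rule: gspan.induct)
  case (gspan_step q c n)
  then have "gspan ((p + q) + smult c (gpol n))" by (intro gspan.gspan_step) auto
  then show ?case by (simp add: add.assoc)
qed simp

lemma gspan_gpol: "gspan (smult c (gpol n))"
  using gspan_step[OF gspan_0] by simp

lemma gspan_X_gpol: "gspan (smult c (PX * gpol n))"
proof -
  have "smult c (PX * gpol n) = smult (c * (real n + 1) / (2 * real n + 1 + 2 * s)) (gpol (Suc n))
     + smult (c * (real n + 2 * s) / (2 * real n + 1 + 2 * s)) (Cm1 n)"
  proof (rule poly_eq_on_interval)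
    fix x
    define a b d where abd: "a = real n + 1" "b = real n + 2 * s" "d = 2 * real n + 1 + 2 * s"
    have "d > 0" using s_pos by (simp add: abd)
    moreover have "d * (x * poly (gpol n) x) = a * poly (gpol (Suc n)) x + b * poly (Cm1 n) x"
      unfolding abd by (rule gpol_rec)
    ultimately have "x * poly (gpol n) x = (a * poly (gpol (Suc n)) x + b * poly (Cm1 n) x) / d"
      by (simp add: eq_divide_eq mult.commute del: gpol.simps)
    then show "poly (smult c (PX * gpol n)) x = poly (smult (c * (real n + 1) / (2 * real n + 1 + 2 * s)) (gpol (Suc n))
     + smult (c * (real n + 2 * s) / (2 * real n + 1 + 2 * s)) (Cm1 n)) x"
      unfolding abd[symmetric] by (simp add: add_divide_distrib distrib_left mult.assoc del: gpol.simps)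
  qed
  moreover have "gspan (smult d (Cm1 n))" for d
    by (cases "n = 0") (simp_all add: Cm1_def gspan_gpol gspan_0)
  ultimately show ?thesis using gspan_add gspan_gpol by metis
qed

lemma gspan_X: "gspan p \<Longrightarrow> gspan (PX * p)"
proof (induction rule: gspan.induct)
  case (gspan_step p c n)
  have "PX * (p + smult c (gpol n)) = smult c (PX * gpol n) + PX * p"
    by (simp add: algebra_simps del: gpol.simps)
  then show ?case using gspan_add[OF gspan_step.IH gspan_X_gpol] by simp
qed (simp add: gspan_0)

lemma gspan_all: "gspan p"
proof (induction p rule: pCons_induct)
  case (pCons a p)
  have "pCons a p = smult a (gpol 0) + PX * p" unfolding gpol.simps by (rule pCons_eq_PX)
  then show ?case by (metis gspan_add[OF gspan_X[OF pCons.IH(1)] gspan_gpol])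
qed (rule gspan_0)

lemma completeness:
  assumes v: "v \<in> L2_weighted s" and zero: "\<And>j. gc v j = 0"
  shows "AE x in lborel. x \<in> I \<longrightarrow> v x = 0"
proof -
  let ?g = "\<lambda>x. omega s x *\<^sub>R v x"
  have i: "set_integrable lborel I (\<lambda>x. (poly p x * omega s x) *\<^sub>R v x)" for p
    by (rule L2_weighted_mult_integrable[OF v]) (intro continuous_intros)
  have "(LINT x:I|lborel. (poly p x * omega s x) *\<^sub>R v x) = 0" for p
    using gspan_all[of p]
  proof (induction rule: gspan.induct)
    case gspan_0 then show ?case by (simp add: set_lebesgue_integral_def)
  next
    case (gspan_step p c n)
    have "gpol n = smult (sqrt (gnorm_sq n)) (ep n)" using gnorm_sq_pos[of n] by (simp add: ep_def)
    then have "(poly (p + smult c (gpol n)) x * omega s x) *\<^sub>R v x =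
       (poly p x * omega s x) *\<^sub>R v x + (c * sqrt (gnorm_sq n)) *\<^sub>R ((poly (ep n) x * omega s x) *\<^sub>R v x)" for x
      by (simp add: algebra_simps)
    then have "(LINT x:I|lborel. (poly (p + smult c (gpol n)) x * omega s x) *\<^sub>R v x) =
      (LINT x:I|lborel. (poly p x * omega s x) *\<^sub>R v x) + (c * sqrt (gnorm_sq n)) *\<^sub>R gc v n"
      unfolding gc_eq using i[of p] i[of "ep n"] by (simp only: set_integral_add set_integral_scaleR_right set_integrable_scaleR_right)
    then show ?case using gspan_step zero by simp
  qed
  then have "AE x in lborel. x \<in> I \<longrightarrow> ?g x = 0"
    using i[of 1] by (intro AE_zero_if_moments_zero) auto
  then show ?thesis
    by eventually_elim (auto simp: omega_def power2_eq_1_iff)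
qed

end

section \<open>The extended operator and its inverse\<close>

context fractional_order
begin

lemma gam_lower: "\<exists>c>0. \<forall>n. c * (real n + 1) powr (2 * s) \<le> gam n"
proof -
  let ?G = "\<lambda>n. Gamma_series' (1 + 2 * s) n"
  have "convergent ?G" using Gamma_series'_LIMSEQ[of "1 + 2 * s"] by (rule convergentI)
  then have "Bseq ?G" by (rule convergent_imp_Bseq)
  then obtain B where B: "B > 0" "\<And>n. norm (?G n) \<le> B" by (auto simp: Bseq_def)
  have G: "gam n \<ge> real n powr (2 * s) / B" if n: "n > 0" for n
  proof -
    have e: "exp ((1 + 2 * s) * ln (real n)) = real n * real n powr (2 * s)"
      using n by (simp add: powr_def exp_add distrib_right)
    have pp: "pochhammer (1 + 2 * s) n > 0" using s_pos by (intro pochhammer_pos) simp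
    have "fact (n - 1) * real n = (fact n :: real)" using n by (simp add: fact_reduce)
    then have "?G n = fact n * real n powr (2 * s) / pochhammer (1 + 2 * s) n"
      unfolding Gamma_series'_def by (simp add: e mult.assoc[symmetric])
    moreover have "?G n \<le> B" using B(2)[of n] by simp
    ultimately have "fact n * real n powr (2 * s) \<le> B * pochhammer (1 + 2 * s) n"
      using pp by (simp add: divide_le_eq)
    then show ?thesis using B(1) by (simp add: gam_def divide_simps mult.commute)
  qed
  define c where "c = min 1 (1 / (B * 4))"
  have c: "c > 0" using B(1) by (simp add: c_def)
  have "c * (real n + 1) powr (2 * s) \<le> gam n" for n
  proof (cases "n = 0")
    case True then show ?thesis by (simp add: c_def)
  next
    case False
    have "(real n + 1) powr (2 * s) \<le> (2 * real n) powr (2 * s)"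
      using False s_pos by (intro powr_mono2) auto
    also have "\<dots> = 2 powr (2 * s) * real n powr (2 * s)" by (simp add: powr_mult)
    also have "\<dots> \<le> 2 powr 2 * real n powr (2 * s)"
      using s_less by (intro mult_right_mono powr_mono) auto
    finally have "(real n + 1) powr (2 * s) \<le> 4 * real n powr (2 * s)" by simp
    then have "c * (real n + 1) powr (2 * s) \<le> c * (4 * real n powr (2 * s))"
      using c by (intro mult_left_mono) auto
    also have "\<dots> \<le> (1 / (B * 4)) * (4 * real n powr (2 * s))"
      unfolding c_def by (intro mult_right_mono) auto
    also have "\<dots> = real n powr (2 * s) / B" by simp
    also have "\<dots> \<le> gam n" using False by (intro G) simp
    finally show ?thesis .
  qed
  with c show ?thesis by blast
qed

lemma sobolev_weight_bound: "\<exists>K>0. \<forall>j. (1 + (real j)\<^sup>2) powr (2 * s) \<le> K * (lam j)\<^sup>2"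
proof -
  obtain c where c: "c > 0" "\<And>n. c * (real n + 1) powr (2 * s) \<le> gam n" using gam_lower by blast
  have "(1 + (real j)\<^sup>2) powr (2 * s) \<le> (1 / (c * ell0)\<^sup>2) * (lam j)\<^sup>2" for j
  proof -
    have "(1 + (real j)\<^sup>2) powr (2 * s) \<le> ((real j + 1)\<^sup>2) powr (2 * s)"
      using s_pos by (intro powr_mono2) (auto simp: power2_eq_square algebra_simps)
    also have "\<dots> = ((real j + 1) powr (2 * s))\<^sup>2"
      by (simp add: power2_eq_square powr_mult)
    also have "\<dots> \<le> (gam j / c)\<^sup>2"
      using c(2)[of j] c(1) by (intro power_mono) (simp_all add: field_simps)
    also have "\<dots> = (1 / (c * ell0)\<^sup>2) * (lam j)\<^sup>2"
      using c(1) ell0_nonzero by (simp add: lam_def power_mult_distrib power_divide)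
    finally show ?thesis .
  qed
  moreover have "1 / (c * ell0)\<^sup>2 > 0" using c(1) ell0_nonzero by simp
  ultimately show ?thesis by blast
qed

lemma gc_summable:
  assumes "v \<in> L2_weighted s"
  shows "summable (\<lambda>j. (cmod (gc v j))\<^sup>2)" "(\<Sum>j. (cmod (gc v j))\<^sup>2) \<le> L2sq v"
proof -
  show 1: "summable (\<lambda>j. (cmod (gc v j))\<^sup>2)"
    using Bessel[OF assms] by (intro summableI_nonneg_bounded[of _ "L2sq v"]) auto
  show "(\<Sum>j. (cmod (gc v j))\<^sup>2) \<le> L2sq v"
    using Bessel[OF assms] by (intro suminf_le_const[OF 1]) auto
qed

text \<open>The weights in the Sobolev norm.\<close>

abbreviation sw :: "nat \<Rightarrow> real" where "sw j \<equiv> (1 + (real j)\<^sup>2) powr (2 * s)"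

lemma sw_ge_1: "sw j \<ge> 1"
  using s_pos by (intro ge_one_powr_ge_zero) auto

lemma sobolev_diff:
  assumes "v \<in> sobolev s" "w \<in> sobolev s"
  shows "(\<lambda>x. v x - w x) \<in> sobolev s"
proof -
  have L: "v \<in> L2_weighted s" "w \<in> L2_weighted s"
    and S: "summable (\<lambda>j. sw j * (cmod (gc v j))\<^sup>2)" "summable (\<lambda>j. sw j * (cmod (gc w j))\<^sup>2)"
    using assms by (auto simp: sobolev_def)
  have "summable (\<lambda>j. sw j * (cmod (gc (\<lambda>x. v x - w x) j))\<^sup>2)"
  proof (rule summable_comparison_test')
    show "summable (\<lambda>j. 2 * (sw j * (cmod (gc v j))\<^sup>2) + 2 * (sw j * (cmod (gc w j))\<^sup>2))"
      using S by (intro summable_add summable_mult)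
    fix j :: nat
    have "(cmod (gc v j - gc w j))\<^sup>2 \<le> (cmod (gc v j) + cmod (gc w j))\<^sup>2"
      by (intro power_mono norm_triangle_ineq4) auto
    also have "\<dots> \<le> 2 * (cmod (gc v j))\<^sup>2 + 2 * (cmod (gc w j))\<^sup>2"
      using zero_le_power2[of "cmod (gc v j) - cmod (gc w j)"] by (simp add: power2_eq_square algebra_simps)
    finally have "sw j * (cmod (gc v j - gc w j))\<^sup>2 \<le> sw j * (2 * (cmod (gc v j))\<^sup>2 + 2 * (cmod (gc w j))\<^sup>2)"
      by (rule mult_left_mono) simp
    then show "norm (sw j * (cmod (gc (\<lambda>x. v x - w x) j))\<^sup>2) \<le> 2 * (sw j * (cmod (gc v j))\<^sup>2) + 2 * (sw j * (cmod (gc w j))\<^sup>2)"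
      by (simp add: gc_diff[OF L] algebra_simps)
  qed
  then show ?thesis using L2_diff[OF L] by (simp add: sobolev_def)
qed

lemma gc_le_sobolev_norm:
  assumes "v \<in> sobolev s"
  shows "cmod (gc v j) \<le> sobolev_norm s v"
proof -
  have S: "summable (\<lambda>j. sw j * (cmod (gc v j))\<^sup>2)" using assms by (simp add: sobolev_def)
  have "1 * (cmod (gc v j))\<^sup>2 \<le> sw j * (cmod (gc v j))\<^sup>2" by (intro mult_right_mono sw_ge_1) simp
  also have "\<dots> \<le> (\<Sum>j. sw j * (cmod (gc v j))\<^sup>2)"
    using sum_le_suminf[OF S, of "{j}"] by simp
  finally show ?thesis unfolding sobolev_norm_def by (intro real_le_rsqrt) simp
qed

lemma gc_le_L2_norm: "v \<in> L2_weighted s \<Longrightarrow> cmod (gc v j) \<le> L2_weighted_norm s v"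
  unfolding L2_norm_eq by (intro real_le_rsqrt gc_le_norm)

lemma ext_coeff:
  assumes "weighted_frac_lap_ext s v f"
  shows "gc f j = complex_of_real (lam j) * gc v j"
proof -
  obtain \<phi> h where v: "v \<in> sobolev s" and f: "f \<in> L2_weighted s"
    and \<phi>: "\<And>n. \<phi> n \<in> sobolev s" and h: "\<And>n. h n \<in> L2_weighted s" and L: "\<And>n::nat. weighted_frac_lap s (\<phi> n) (h n)"
    and l1: "(\<lambda>n. sobolev_norm s (\<lambda>x. \<phi> n x - v x)) \<longlonglongrightarrow> 0"
    and l2: "(\<lambda>n. L2_weighted_norm s (\<lambda>x. h n x - f x)) \<longlonglongrightarrow> 0"
    using assms unfolding weighted_frac_lap_ext_def by blast
  have L2: "v \<in> L2_weighted s" "\<And>n. \<phi> n \<in> L2_weighted s" using v \<phi> by (auto simp: sobolev_def)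
  have "(\<lambda>n. gc (\<phi> n) j - gc v j) \<longlonglongrightarrow> 0"
    by (rule Lim_null_comparison[OF _ l1], rule always_eventually)
      (use gc_le_sobolev_norm[OF sobolev_diff[OF \<phi> v]] gc_diff[OF L2(2) L2(1)] in auto)
  then have 1: "(\<lambda>n. gc (\<phi> n) j) \<longlonglongrightarrow> gc v j" by (rule LIM_zero_cancel)
  have "(\<lambda>n. gc (h n) j - gc f j) \<longlonglongrightarrow> 0"
    by (rule Lim_null_comparison[OF _ l2], rule always_eventually)
      (use gc_le_L2_norm[OF L2_diff[OF h f]] gc_diff[OF h f] in auto)
  then have "(\<lambda>n. gc (h n) j) \<longlonglongrightarrow> gc f j" by (rule LIM_zero_cancel)
  moreover have "(\<lambda>n. gc (h n) j) \<longlonglongrightarrow> complex_of_real (lam j) * gc v j"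
    unfolding gc_lap[OF L h] by (intro tendsto_intros 1)
  ultimately show ?thesis by (rule LIMSEQ_unique)
qed

lemma ext_unique:
  assumes "weighted_frac_lap_ext s v f" "weighted_frac_lap_ext s w f"
  shows "AE x in lborel. x \<in> I \<longrightarrow> v x = w x"
proof -
  have L: "v \<in> L2_weighted s" "w \<in> L2_weighted s"
    using assms by (auto simp: weighted_frac_lap_ext_def sobolev_def)
  have "gc (\<lambda>x. v x - w x) j = 0" for j
    using ext_coeff[OF assms(1), of j] ext_coeff[OF assms(2), of j] lam_nonzero[of j]
    unfolding gc_diff[OF L] by simp
  from completeness[OF L2_diff[OF L] this] show ?thesis by eventually_elim simp
qed

lemma uniform_imp_L2:
  fixes h :: "nat \<Rightarrow> real \<Rightarrow> complex" and f :: "real \<Rightarrow> complex"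
  assumes cont: "\<And>n. continuous_on {-1..1} (h n)" "continuous_on {-1..1} f"
    and lim: "uniform_limit {-1..1} h f sequentially"
  shows "(\<lambda>n. L2sq (\<lambda>x. h n x - f x)) \<longlonglongrightarrow> 0"
proof (rule LIMSEQ_I)
  fix r :: real assume r: "r > 0"
  define Q where "Q = (LINT x:I|lborel. omega s x) + 1"
  have Q0: "(LINT x:I|lborel. omega s x) \<ge> 0"
    unfolding set_lebesgue_integral_def by (rule Bochner_Integration.integral_nonneg) simp
  then have Q: "Q > 0" by (simp add: Q_def)
  define e where "e = sqrt (r / (2 * Q))"
  have e: "e > 0" "e\<^sup>2 = r / (2 * Q)" using r Q by (auto simp: e_def)
  obtain N where N: "\<And>n x. n \<ge> N \<Longrightarrow> x \<in> {-1..1} \<Longrightarrow> dist (h n x) (f x) < e"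
    using uniform_limitD[OF lim e(1)] unfolding eventually_sequentially by blast
  have "norm (L2sq (\<lambda>x. h n x - f x) - 0) < r" if n: "n \<ge> N" for n
  proof -
    have L: "(\<lambda>x. h n x - f x) \<in> L2_weighted s" by (intro continuous_L2 continuous_intros cont)
    have "L2sq (\<lambda>x. h n x - f x) \<le> (LINT x:I|lborel. e\<^sup>2 * omega s x)"
      unfolding L2sq_def
    proof (rule set_integral_mono)
      show "set_integrable lborel I (\<lambda>x. (cmod (h n x - f x))\<^sup>2 * omega s x)" using L by (simp add: L2_weighted_def)
      show "set_integrable lborel I (\<lambda>x. e\<^sup>2 * omega s x)" using omega_integrable by (intro set_integrable_mult_right) auto
      show "(cmod (h n x - f x))\<^sup>2 * omega s x \<le> e\<^sup>2 * omega s x" if "x \<in> I" for x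
        using N[OF n, of x] that by (intro mult_right_mono power_mono) (auto simp: dist_norm)
    qed
    also have "\<dots> = e\<^sup>2 * (LINT x:I|lborel. omega s x)" by simp
    also have "\<dots> \<le> e\<^sup>2 * Q" by (intro mult_left_mono) (auto simp: Q_def)
    also have "\<dots> = r / 2" using Q by (simp add: e(2))
    also have "\<dots> < r" using r by simp
    finally show ?thesis using L2sq_nonneg[of "\<lambda>x. h n x - f x"] by simp
  qed
  then show "\<exists>N. \<forall>n\<ge>N. norm (L2sq (\<lambda>x. h n x - f x) - 0) < r" by blast
qed

text \<open>The coefficients of \<open>f\<close> are those of \<open>v\<close> multiplied by \<open>lam\<close>, whose square dominates the Sobolev weight; so
  convergence of the images in the weighted \<open>L\<^sup>2\<close> space implies convergence of the preimages in the
  Sobolev norm.\<close>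

lemma ext_from_uniform_limits:
  fixes \<phi> h :: "nat \<Rightarrow> real \<Rightarrow> complex" and v f :: "real \<Rightarrow> complex"
  assumes L: "\<And>n. weighted_frac_lap s (\<phi> n) (h n)"
    and c: "\<And>n. continuous_on {-1..1} (\<phi> n)" "\<And>n. continuous_on {-1..1} (h n)"
    and cv: "continuous_on {-1..1} v" and cf: "continuous_on {-1..1} f"
    and lv: "uniform_limit {-1..1} \<phi> v sequentially" and lf: "uniform_limit {-1..1} h f sequentially"
  shows "weighted_frac_lap_ext s v f"
proof -
  have L2: "\<And>n. \<phi> n \<in> L2_weighted s" "\<And>n. h n \<in> L2_weighted s" "v \<in> L2_weighted s" "f \<in> L2_weighted s"
    using c cv cf continuous_L2 by auto
  have lim: "(\<lambda>n. gc (g n) j) \<longlonglongrightarrow> gc u j"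
    if g: "\<And>n. continuous_on {-1..1} (g n)" and u: "continuous_on {-1..1} u" and "uniform_limit {-1..1} g u sequentially"
    for g u j
  proof -
    have l: "(\<lambda>n. sqrt (L2sq (\<lambda>x. g n x - u x))) \<longlonglongrightarrow> 0"
      using tendsto_real_sqrt[OF uniform_imp_L2[OF g u that(3)]] by simp
    have "(\<lambda>n. gc (g n) j - gc u j) \<longlonglongrightarrow> 0"
      by (rule Lim_null_comparison[OF _ l], rule always_eventually)
        (use gc_le_L2_norm[OF L2_diff[OF continuous_L2[OF g] continuous_L2[OF u]]]
          gc_diff[OF continuous_L2[OF g] continuous_L2[OF u]] in \<open>auto simp: L2_norm_eq\<close>)
    then show ?thesis by (rule LIM_zero_cancel)
  qed
  have rel: "gc f j = complex_of_real (lam j) * gc v j" for j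
  proof (rule LIMSEQ_unique)
    show "(\<lambda>n. gc (h n) j) \<longlonglongrightarrow> gc f j" by (rule lim[OF c(2) cf lf])
    show "(\<lambda>n. gc (h n) j) \<longlonglongrightarrow> complex_of_real (lam j) * gc v j"
      unfolding gc_lap[OF L L2(2)] by (intro tendsto_intros lim[OF c(1) cv lv])
  qed
  obtain K where K: "K > 0" "\<And>j. sw j \<le> K * (lam j)\<^sup>2" using sobolev_weight_bound by blast
  have sob: "u \<in> sobolev s \<and> (\<Sum>j. sw j * (cmod (gc u j))\<^sup>2) \<le> K * L2sq g"
    if u: "u \<in> L2_weighted s" and g: "g \<in> L2_weighted s" and r: "\<And>j. gc g j = complex_of_real (lam j) * gc u j" for u g
  proof -
    have b: "sw j * (cmod (gc u j))\<^sup>2 \<le> K * (cmod (gc g j))\<^sup>2" for j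
      using mult_right_mono[OF K(2)[of j], of "(cmod (gc u j))\<^sup>2"]
      by (simp add: r norm_mult power_mult_distrib mult.assoc)
    have sm: "summable (\<lambda>j. K * (cmod (gc g j))\<^sup>2)" by (intro summable_mult gc_summable g)
    have s1: "summable (\<lambda>j. sw j * (cmod (gc u j))\<^sup>2)"
      using b by (intro summable_comparison_test'[OF sm]) auto
    have "(\<Sum>j. sw j * (cmod (gc u j))\<^sup>2) \<le> (\<Sum>j. K * (cmod (gc g j))\<^sup>2)"
      by (intro suminf_le b s1 sm)
    also have "\<dots> = K * (\<Sum>j. (cmod (gc g j))\<^sup>2)" by (intro suminf_mult gc_summable g)
    also have "\<dots> \<le> K * L2sq g" using K(1) by (intro mult_left_mono gc_summable g) auto
    finally show ?thesis using u s1 by (simp add: sobolev_def)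
  qed
  have v: "v \<in> sobolev s" using sob[OF L2(3,4) rel] by blast
  have \<phi>: "\<phi> n \<in> sobolev s" for n using sob[OF L2(1,2) gc_lap[OF L L2(2)]] by blast
  have sn: "sobolev_norm s (\<lambda>x. \<phi> n x - v x) \<le> sqrt (K * L2sq (\<lambda>x. h n x - f x))" for n
    unfolding sobolev_norm_def
  proof (rule real_sqrt_le_mono)
    have "gc (\<lambda>x. h n x - f x) j = complex_of_real (lam j) * gc (\<lambda>x. \<phi> n x - v x) j" for j
      using gc_lap[OF L L2(2), of n j] rel[of j] by (simp add: gc_diff L2 algebra_simps)
    then show "(\<Sum>j. sw j * (cmod (gc (\<lambda>x. \<phi> n x - v x) j))\<^sup>2) \<le> K * L2sq (\<lambda>x. h n x - f x)"
      using sob[OF L2_diff[OF L2(1,3)] L2_diff[OF L2(2,4)]] by blast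
  qed
  have l0: "(\<lambda>n. L2sq (\<lambda>x. h n x - f x)) \<longlonglongrightarrow> 0" by (rule uniform_imp_L2[OF c(2) cf lf])
  have "(\<lambda>n. sqrt (K * L2sq (\<lambda>x. h n x - f x))) \<longlonglongrightarrow> sqrt (K * 0)"
    by (intro tendsto_intros l0)
  then have l1: "(\<lambda>n. sqrt (K * L2sq (\<lambda>x. h n x - f x))) \<longlonglongrightarrow> 0" by simp
  have "(\<lambda>n. sobolev_norm s (\<lambda>x. \<phi> n x - v x)) \<longlonglongrightarrow> 0"
  proof (rule Lim_null_comparison[OF _ l1], rule always_eventually, intro allI)
    fix n
    have "sobolev_norm s (\<lambda>x. \<phi> n x - v x) \<ge> cmod (gc (\<lambda>x. \<phi> n x - v x) 0)"
      by (rule gc_le_sobolev_norm[OF sobolev_diff[OF \<phi> v]])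
    then have "sobolev_norm s (\<lambda>x. \<phi> n x - v x) \<ge> 0" using norm_ge_zero order_trans by blast
    then show "norm (sobolev_norm s (\<lambda>x. \<phi> n x - v x)) \<le> sqrt (K * L2sq (\<lambda>x. h n x - f x))"
      using sn by simp
  qed
  moreover have "(\<lambda>n. L2_weighted_norm s (\<lambda>x. h n x - f x)) \<longlonglongrightarrow> 0"
    unfolding L2_norm_eq using tendsto_real_sqrt[OF l0] by simp
  ultimately show ?thesis
    unfolding weighted_frac_lap_ext_def using v L2 \<phi> L by blast
qed

lemma inv_eq_AE:
  assumes "weighted_frac_lap_ext s v f"
  shows "AE x in lborel. x \<in> I \<longrightarrow> v x = weighted_frac_lap_inv s f x"
proof -
  have "weighted_frac_lap_ext s (weighted_frac_lap_inv s f) f"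
    unfolding weighted_frac_lap_inv_def by (rule someI[of "\<lambda>v. weighted_frac_lap_ext s v f", OF assms])
  then show ?thesis by (rule ext_unique[OF assms])
qed

end

section \<open>The generating function of the operator on Chebyshev polynomials\<close>

text \<open>Twice the Chebyshev polynomials \<open>T\<^sub>n\<close>, and the variant that is \<open>1\<close> at degree \<open>0\<close>. The former satisfy
  one recursion for all degrees, the latter occur in the Chebyshev expansion.\<close>

fun Dpol :: "nat \<Rightarrow> real poly" where
  "Dpol 0 = [:2:]"
| "Dpol (Suc 0) = smult 2 PX"
| "Dpol (Suc (Suc n)) = smult 2 (PX * Dpol (Suc n)) - Dpol n"

definition Epol :: "nat \<Rightarrow> real poly" where "Epol n = (if n = 0 then 1 else Dpol n)"

lemma Dpol_deriv:
  "(1 - x\<^sup>2) * poly (pderiv (Dpol n)) x = real n * (x * poly (Dpol n) x - poly (Dpol (Suc n)) x)"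
proof (induction n rule: Dpol.induct)
  case 1 then show ?case by (simp add: pderiv_pCons)
next
  case 2 then show ?case by (simp add: pderiv_smult power2_eq_square algebra_simps)
next
  case (3 n)
  define D0 D1 d0 d1 where "D0 = poly (Dpol n) x" "D1 = poly (Dpol (Suc n)) x"
    "d0 = poly (pderiv (Dpol n)) x" "d1 = poly (pderiv (Dpol (Suc n))) x"
  note defs = this
  have i0: "(1 - x\<^sup>2) * d0 = real n * (x * D0 - D1)" using 3(2) by (simp add: defs)
  have i1: "(1 - x\<^sup>2) * d1 = (real n + 1) * (x * D1 - (2 * x * D1 - D0))"
    using 3(1) by (simp add: defs algebra_simps)
  have "(1 - x\<^sup>2) * poly (pderiv (Dpol (Suc (Suc n)))) x = 2 * ((1 - x\<^sup>2) * D1) + 2 * x * ((1 - x\<^sup>2) * d1) - (1 - x\<^sup>2) * d0"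
    by (simp add: defs pderiv_diff pderiv_smult pderiv_mult algebra_simps)
  also have "\<dots> = (real n + 2) * (x * (2 * x * D1 - D0) - (2 * x * (2 * x * D1 - D0) - D1))"
    unfolding i0 i1 by (simp add: power2_eq_square algebra_simps)
  finally show ?case by (simp add: defs algebra_simps)
qed

lemma Dpol_cos: "poly (Dpol n) (cos t) = 2 * cos (real n * t)"
proof (induction n rule: Dpol.induct)
  case (3 n)
  define a where "a = real (Suc n) * t"
  have "cos (a + t) + cos (a - t) = 2 * cos t * cos a" by (simp add: cos_add cos_diff)
  moreover have "a + t = real (Suc (Suc n)) * t" "a - t = real n * t" by (simp_all add: a_def algebra_simps)
  ultimately show ?case using 3 unfolding a_def by (simp del: of_nat_Suc)
qed simp_all

context fractional_order
begin

text \<open>The exponent of the generating function.\<close>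

abbreviation b :: real where "b \<equiv> 1 + 2 * s"

text \<open>The image of \<open>Dpol n\<close> under the operator, as a function.\<close>

definition LD :: "nat \<Rightarrow> real \<Rightarrow> real" where "LD n x = poly (LP (Dpol n)) x"

text \<open>\<open>LP_recursion\<close> for \<open>p = Dpol n\<close>.\<close>

lemma LD_rec:
  assumes n: "n = Suc (Suc m)"
  shows "(real n + 2) * LD (Suc (Suc n)) x + 4 * b * LD n x - (real n - 2) * LD m x =
    2 * x * ((real n + 1 + b) * LD (Suc n) x - (real n - 1 - b) * LD (Suc m) x)"
proof -
  let ?n = "real n"
  define q where "q = PX2 * pderiv (Dpol n) - smult (2 * s + 2) (PX * Dpol n)"
  have D2: "poly (Dpol (Suc n)) x = 2 * x * poly (Dpol n) x - poly (Dpol (Suc m)) x" for x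
    unfolding n by simp
  have D3: "poly (Dpol (Suc (Suc n))) x = 2 * x * poly (Dpol (Suc n)) x - poly (Dpol n) x" for x
    by simp
  have D0: "poly (Dpol m) x = 2 * x * poly (Dpol (Suc m)) x - poly (Dpol n) x" for x
    unfolding n by simp
  have qv: "poly q x = (?n - 2 * s - 2) * (x * poly (Dpol n) x) - ?n * poly (Dpol (Suc n)) x" for x
    using Dpol_deriv[of x n] by (simp add: q_def algebra_simps del: Dpol.simps)
  have q_eq: "q = smult (?n / 2 - s - 1) (Dpol (Suc m)) - smult (?n / 2 + s + 1) (Dpol (Suc n))"
    by (rule poly_eq_on_interval) (simp add: qv D2 algebra_simps del: Dpol.simps)
  have lhs: "PX * q - smult (2 * s) (PX2 * Dpol n) =
      smult (?n / 4 - 1 / 2) (Dpol m) - smult (1 + 2 * s) (Dpol n) - smult (?n / 4 + 1 / 2) (Dpol (Suc (Suc n)))"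
    by (rule poly_eq_on_interval) (simp add: qv D3 D0 D2 power2_eq_square algebra_simps del: Dpol.simps)
  have "(?n / 4 - 1 / 2) * LD m x - (1 + 2 * s) * LD n x - (?n / 4 + 1 / 2) * LD (Suc (Suc n)) x =
     x * ((?n / 2 - s - 1) * LD (Suc m) x - (?n / 2 + s + 1) * LD (Suc n) x)"
  proof -
    have "LP (smult (?n / 4 - 1 / 2) (Dpol m) - smult (1 + 2 * s) (Dpol n) - smult (?n / 4 + 1 / 2) (Dpol (Suc (Suc n)))) = PX * LP q"
      using LP_recursion[OF q_def] unfolding lhs .
    from arg_cong[OF this, of "\<lambda>p. poly p x"] show ?thesis
      unfolding q_eq by (simp add: LP_diff LP_smult LD_def del: Dpol.simps)
  qed
  then show ?thesis by (simp add: algebra_simps)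
qed

lemma LP_X_sq: "LP (PX * PX) = smult (ell0 * b * (s + 1)) (PX * PX) - smult (ell0 * s) 1"
proof (rule poly_eq_on_interval)
  fix x
  define q where "q = PX2 * pderiv 1 - smult (2 * s + 2) (PX * 1)"
  have q: "q = smult (- (2 * s + 2)) PX" by (rule poly_eq_on_interval) (simp add: q_def algebra_simps)
  have "PX * q - smult (2 * s) (PX2 * 1) = smult (-2) (PX * PX) + smult (- 2 * s) 1"
    by (rule poly_eq_on_interval) (simp add: q power2_eq_square algebra_simps)
  with LP_recursion[OF q_def] have "smult (-2) (LP (PX * PX)) + smult (- 2 * s) (LP 1) = PX * smult (- (2 * s + 2)) (LP PX)"
    unfolding q by (simp only: LP_add LP_smult)
  from arg_cong[OF this, of "\<lambda>p. poly p x"]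
  show "poly (LP (PX * PX)) x = poly (smult (ell0 * b * (s + 1)) (PX * PX) - smult (ell0 * s) 1) x"
    by (simp add: LP_1 LP_X algebra_simps)
qed

lemma LP_X_cube: "3 * poly (LP (PX * (PX * PX))) x =
   (1 - 2 * s) * b * ell0 * x - x * (ell0 - (2 * s + 3) * poly (LP (PX * PX)) x)"
proof -
  define q where "q = PX2 * pderiv PX - smult (2 * s + 2) (PX * PX)"
  have q: "q = 1 + smult (- (2 * s + 3)) (PX * PX)"
    by (rule poly_eq_on_interval) (simp add: q_def power2_eq_square algebra_simps)
  have "PX * q - smult (2 * s) (PX2 * PX) = smult (1 - 2 * s) PX + smult (-3) (PX * (PX * PX))"
    by (rule poly_eq_on_interval) (simp add: q power2_eq_square algebra_simps)
  with LP_recursion[OF q_def] have "smult (1 - 2 * s) (LP PX) + smult (-3) (LP (PX * (PX * PX))) = PX * (LP 1 + smult (- (2 * s + 3)) (LP (PX * PX)))"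
    unfolding q by (simp only: LP_add LP_smult)
  from arg_cong[OF this, of "\<lambda>p. poly p x"] show ?thesis
    by (simp add: LP_1 LP_X algebra_simps)
qed

text \<open>The power series of \<open>(1 - c z) powr -b\<close>.\<close>

definition gam_ser :: "complex \<Rightarrow> complex fps" where "gam_ser c = Abs_fps (\<lambda>n. complex_of_real (gam n) * c ^ n)"

text \<open>The coefficients of \<open>(1 - z) powr b\<close>, and the power series of \<open>(1 - z\<^sup>2) powr b\<close>.\<close>

primrec ecoef :: "nat \<Rightarrow> real" where
  "ecoef 0 = 1"
| "ecoef (Suc i) = ecoef i * (real i - b) / (real i + 1)"

definition ecoef_ser :: "complex fps" where
  "ecoef_ser = Abs_fps (\<lambda>n. if even n then complex_of_real (ecoef (n div 2)) else 0)"

lemma gam_ser_ode: "(1 - fps_const c * fps_X) * fps_deriv (gam_ser c) = fps_const (complex_of_real b * c) * gam_ser c"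
proof (rule fps_ext)
  fix n
  have "(real n + 1) * gam (Suc n) = (real n + b) * gam n" by (simp add: gam_Suc field_simps)
  then have e: "(of_nat n + 1) * complex_of_real (gam (Suc n)) = (of_nat n + complex_of_real b) * complex_of_real (gam n)"
    by (metis (mono_tags, lifting) of_real_add of_real_mult of_real_of_nat_eq of_real_1)
  show "fps_nth ((1 - fps_const c * fps_X) * fps_deriv (gam_ser c)) n = fps_nth (fps_const (complex_of_real b * c) * gam_ser c) n"
  proof (cases n)
    case 0 then show ?thesis using e by (simp add: gam_ser_def left_diff_distrib mult.assoc)
  next
    case (Suc m)
    have "fps_nth ((1 - fps_const c * fps_X) * fps_deriv (gam_ser c)) n =
        ((of_nat n + 1) * complex_of_real (gam (Suc n))) * c ^ Suc n - c * (of_nat n * (complex_of_real (gam n) * c ^ n))"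
      using Suc by (simp add: gam_ser_def left_diff_distrib mult.assoc)
    also have "\<dots> = complex_of_real b * c * (complex_of_real (gam n) * c ^ n)"
      unfolding e by (simp add: algebra_simps)
    finally show ?thesis by (simp add: gam_ser_def)
  qed
qed

lemma ecoef_ser_ode: "(1 - fps_X ^ 2) * fps_deriv ecoef_ser = - fps_const (2 * complex_of_real b) * fps_X * ecoef_ser"
proof (rule fps_ext)
  fix n
  have e: "(of_nat i + 1) * complex_of_real (ecoef (Suc i)) = (of_nat i - complex_of_real b) * complex_of_real (ecoef i)" for i
  proof -
    have "(real i + 1) * ecoef (Suc i) = (real i - b) * ecoef i" by simp
    then show ?thesis by (metis (mono_tags, lifting) of_real_add of_real_diff of_real_mult of_real_of_nat_eq of_real_1)
  qed
  consider "n = 0" | "n = 1" | m where "n = Suc (Suc m)" by (cases n rule: gpol.cases) auto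
  then show "fps_nth ((1 - fps_X ^ 2) * fps_deriv ecoef_ser) n = fps_nth (- fps_const (2 * complex_of_real b) * fps_X * ecoef_ser) n"
  proof cases
    case 1 then show ?thesis by (simp add: ecoef_ser_def left_diff_distrib fps_X_power_mult_nth mult.assoc)
  next
    case 2 then show ?thesis using e[of 0]
      by (simp add: ecoef_ser_def left_diff_distrib fps_X_power_mult_nth mult.assoc numeral_2_eq_2 del: ecoef.simps)
  next
    case (3 m)
    show ?thesis
    proof (cases "even m")
      case True then show ?thesis using 3 by (simp add: ecoef_ser_def left_diff_distrib fps_X_power_mult_nth mult.assoc)
    next
      case False
      then obtain i where i: "m = 2 * i + 1" by (elim oddE)
      have d: "Suc (Suc (Suc m)) div 2 = Suc (Suc i)" "Suc m div 2 = Suc i" using i by auto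
      have "fps_nth ((1 - fps_X ^ 2) * fps_deriv ecoef_ser) n =
          of_nat (m + 3) * complex_of_real (ecoef (Suc (Suc i))) - of_nat (m + 1) * complex_of_real (ecoef (Suc i))"
        using 3 False d by (simp add: ecoef_ser_def left_diff_distrib fps_X_power_mult_nth mult.assoc del: ecoef.simps)
      also have "\<dots> = 2 * ((of_nat (Suc i) + 1) * complex_of_real (ecoef (Suc (Suc i)))) - of_nat (m + 1) * complex_of_real (ecoef (Suc i))"
        using i by (simp add: algebra_simps del: ecoef.simps)
      also have "\<dots> = - 2 * complex_of_real b * complex_of_real (ecoef (Suc i))"
        unfolding e[of "Suc i"] using i by (simp add: algebra_simps del: ecoef.simps)
      finally show ?thesis using 3 False d by (simp add: ecoef_ser_def mult.assoc del: ecoef.simps)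
    qed
  qed
qed

text \<open>The power series of \<open>((1 - z\<^sup>2) / ((1 - w z) (1 - z / w))) powr b\<close>. Up to the factor \<open>ell0\<close> it is the generating
  function of the images of the polynomials \<open>Epol n\<close> at \<open>x = (w + 1/w)/2\<close>.\<close>

definition LPgen :: "complex \<Rightarrow> complex fps" where "LPgen w = ecoef_ser * (gam_ser w * gam_ser (inverse w))"

text \<open>The logarithmic derivatives of the three factors add up; \<open>(1 - w z) (1 - z / w) = 1 - 2xz + z\<^sup>2\<close>.\<close>

lemma LPgen_ode:
  assumes w: "w \<noteq> 0" and x: "w + inverse w = 2 * x"
  shows "(1 - fps_const (2 * x) * fps_X + fps_const (2 * x) * fps_X ^ 3 - fps_X ^ 4) * fps_deriv (LPgen w)
    = fps_const (2 * complex_of_real b) * (fps_const x - 2 * fps_X + fps_const x * fps_X ^ 2) * LPgen w"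
proof -
  define B A C where "B = ecoef_ser" "A = gam_ser w" "C = gam_ser (inverse w)"
  define P where "P = 1 - (fps_X :: complex fps) ^ 2"
  define c d e where "c = fps_const w" "d = fps_const (inverse w)" "e = fps_const (complex_of_real b)"
  note defs = \<open>c = _\<close> \<open>d = _\<close> \<open>e = _\<close>
  define Q R where "Q = 1 - c * (fps_X :: complex fps)" "R = 1 - d * (fps_X :: complex fps)"
  have cd: "c * d = 1" using w by (simp add: defs)
  have cpd: "c + d = fps_const (2 * x)" using x by (simp add: defs)
  have 2: "fps_const (2 * complex_of_real b) = 2 * e" "fps_const (2 * x) = 2 * fps_const x"
    by (simp_all add: defs numeral_fps_const)
  have o1: "P * fps_deriv B = - (2 * e) * fps_X * B"
    unfolding P_def B_A_C_def(1) using ecoef_ser_ode[unfolded 2(1)] .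
  have o2: "Q * fps_deriv A = e * c * A" and o3: "R * fps_deriv C = e * d * C"
    using gam_ser_ode[of w] gam_ser_ode[of "inverse w"] unfolding Q_R_def B_A_C_def defs by (simp_all only: fps_const_mult)
  have QR: "Q * R = 1 - fps_const (2 * x) * fps_X + fps_X ^ 2"
  proof -
    have "Q * R = 1 - (c + d) * fps_X + (c * d) * fps_X ^ 2"
      unfolding Q_R_def by (simp add: power2_eq_square algebra_simps)
    then show ?thesis unfolding cd cpd by simp
  qed
  have "P * Q * R * fps_deriv (LPgen w) = (P * fps_deriv B) * (Q * R) * (A * C) + P * R * B * C * (Q * fps_deriv A) + P * Q * B * A * (R * fps_deriv C)"
    unfolding LPgen_def B_A_C_def[symmetric] by (simp add: algebra_simps)
  also have "\<dots> = (- (2 * fps_X) * (Q * R) + P * (c * R + d * Q)) * e * LPgen w"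
    unfolding o1 o2 o3 LPgen_def B_A_C_def[symmetric] by (simp add: algebra_simps)
  also have "c * R + d * Q = fps_const (2 * x) - 2 * fps_X"
  proof -
    have "c * R + d * Q = (c + d) - 2 * (c * d) * fps_X"
      unfolding Q_R_def by (simp add: algebra_simps)
    then show ?thesis unfolding cd cpd by simp
  qed
  finally have main: "P * (Q * R) * fps_deriv (LPgen w) = (- (2 * fps_X) * (Q * R) + P * (fps_const (2 * x) - 2 * fps_X)) * e * LPgen w"
    by (simp add: mult.assoc)
  have l: "P * (Q * R) = 1 - fps_const (2 * x) * fps_X + fps_const (2 * x) * fps_X ^ 3 - fps_X ^ 4"
    unfolding QR P_def by (simp add: algebra_simps power2_eq_square power3_eq_cube power4_eq_xxxx)
  have r: "(- (2 * fps_X) * (Q * R) + P * (fps_const (2 * x) - 2 * fps_X)) * e =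
     fps_const (2 * complex_of_real b) * (fps_const x - 2 * fps_X + fps_const x * fps_X ^ 2)"
    unfolding QR P_def 2 by (simp add: algebra_simps power2_eq_square)
  show ?thesis using main unfolding l r .
qed

lemma LPgen_rec:
  assumes w: "w \<noteq> 0" and x: "w + inverse w = 2 * x"
  defines "G \<equiv> \<lambda>n. fps_nth (LPgen w) n"
  shows "G 0 = 1" "G 1 = 2 * complex_of_real b * x"
    "2 * G 2 = 2 * x * G 1 + 2 * complex_of_real b * (x * G 1 - 2 * G 0)"
    "3 * G 3 = 4 * x * G 2 + 2 * complex_of_real b * (x * G 2 - 2 * G 1 + x * G 0)"
    "of_nat (m + 4) * G (m + 4) - 2 * x * of_nat (m + 3) * G (m + 3) + 2 * x * of_nat (m + 1) * G (m + 1) - of_nat m * G m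
       = 2 * complex_of_real b * (x * G (m + 3) - 2 * G (m + 2) + x * G (m + 1))"
proof -
  note ode = LPgen_ode[OF w x]
  have c: "fps_nth ((1 - fps_const (2 * x) * fps_X + fps_const (2 * x) * fps_X ^ 3 - fps_X ^ 4) * fps_deriv (LPgen w)) n =
     of_nat (n + 1) * G (n + 1) - (if n = 0 then 0 else 2 * x * (of_nat n * G n))
      + (if n < 3 then 0 else 2 * x * (of_nat (n - 2) * G (n - 2))) - (if n < 4 then 0 else of_nat (n - 3) * G (n - 3))" for n
  proof -
    have "fps_nth ((1 - fps_const (2 * x) * fps_X + fps_const (2 * x) * fps_X ^ 3 - fps_X ^ 4) * fps_deriv (LPgen w)) n =
      fps_nth (fps_deriv (LPgen w)) n - 2 * x * fps_nth (fps_X * fps_deriv (LPgen w)) n + 2 * x * fps_nth (fps_X ^ 3 * fps_deriv (LPgen w)) n - fps_nth (fps_X ^ 4 * fps_deriv (LPgen w)) n"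
      by (simp only: left_diff_distrib distrib_right mult.assoc fps_sub_nth fps_add_nth fps_mult_left_const_nth mult_1_left)
    note E = this
    have "n = 0 \<or> n = 1 \<or> n = 2 \<or> n = 3 \<or> (\<exists>m. n = m + 4)" by presburger
    then consider "n = 0" | "n = 1" | "n = 2" | "n = 3" | m where "n = m + 4" by blast
    then show ?thesis
      unfolding E fps_X_power_mult_nth by cases (simp_all add: G_def eval_nat_numeral)
  qed
  have d: "fps_nth (fps_const (2 * complex_of_real b) * (fps_const x - 2 * fps_X + fps_const x * fps_X ^ 2) * LPgen w) n =
    2 * complex_of_real b * (x * G n - (if n = 0 then 0 else 2 * G (n - 1)) + (if n < 2 then 0 else x * G (n - 2)))" for n
  proof -
    have "fps_nth (fps_const (2 * complex_of_real b) * (fps_const x - 2 * fps_X + fps_const x * fps_X ^ 2) * LPgen w) n =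
      2 * complex_of_real b * (x * fps_nth (LPgen w) n - 2 * fps_nth (fps_X * LPgen w) n + x * fps_nth (fps_X ^ 2 * LPgen w) n)"
      by (simp only: left_diff_distrib distrib_right mult.assoc fps_sub_nth fps_add_nth fps_mult_left_const_nth numeral_fps_const)
    then show ?thesis unfolding fps_X_power_mult_nth by (auto simp: G_def)
  qed
  have cd: "of_nat (n + 1) * G (n + 1) - (if n = 0 then 0 else 2 * x * (of_nat n * G n))
      + (if n < 3 then 0 else 2 * x * (of_nat (n - 2) * G (n - 2))) - (if n < 4 then 0 else of_nat (n - 3) * G (n - 3)) =
      2 * complex_of_real b * (x * G n - (if n = 0 then 0 else 2 * G (n - 1)) + (if n < 2 then 0 else x * G (n - 2)))" for n
    using arg_cong[OF ode, of "\<lambda>f. fps_nth f n"] unfolding c d .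
  show g0: "G 0 = 1" by (simp add: G_def LPgen_def ecoef_ser_def gam_ser_def)
  show "G 1 = 2 * complex_of_real b * x" using cd[of 0] g0 by simp
  show "2 * G 2 = 2 * x * G 1 + 2 * complex_of_real b * (x * G 1 - 2 * G 0)" using cd[of 1]
    by (simp add: algebra_simps numeral_2_eq_2)
  show "3 * G 3 = 4 * x * G 2 + 2 * complex_of_real b * (x * G 2 - 2 * G 1 + x * G 0)" using cd[of 2]
    by (simp add: algebra_simps numeral_2_eq_2 numeral_3_eq_3)
  show "of_nat (m + 4) * G (m + 4) - 2 * x * of_nat (m + 3) * G (m + 3) + 2 * x * of_nat (m + 1) * G (m + 1) - of_nat m * G m
       = 2 * complex_of_real b * (x * G (m + 3) - 2 * G (m + 2) + x * G (m + 1))"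
  proof -
    have a: "m + 3 + 1 = m + 4" "m + 3 - 2 = m + 1" "m + 3 - 1 = m + 2" "m + 3 - 3 = m" by simp_all
    show ?thesis using cd[of "m + 3"] unfolding a by (cases "m = 0") (simp_all add: mult.assoc)
  qed
qed

end

section \<open>The inverse operator in the Chebyshev basis\<close>

lemma sum_fold_symmetric:
  fixes T :: "nat \<Rightarrow> 'a::comm_monoid_add"
  shows "(\<Sum>i\<le>m. T i) = (\<Sum>c\<le>m div 2. if 2 * c = m then T c else T c + T (m - c))"
proof (induction m arbitrary: T rule: nat_induct2)
  case (step m)
  have "(\<Sum>i\<le>m + 2. T i) = T 0 + (\<Sum>i\<le>Suc m. T (Suc i))" by (simp add: sum.atMost_Suc_shift del: sum.atMost_Suc)
  also have "\<dots> = T 0 + T (m + 2) + (\<Sum>i\<le>m. T (Suc i))" by (simp add: add_ac)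
  also have "(\<Sum>i\<le>m. T (Suc i)) = (\<Sum>c\<le>m div 2. if 2 * c = m then T (Suc c) else T (Suc c) + T (Suc (m - c)))"
    by (rule step.IH)
  also have "\<dots> = (\<Sum>c\<le>m div 2. if 2 * Suc c = m + 2 then T (Suc c) else T (Suc c) + T (m + 2 - Suc c))"
    by (intro sum.cong refl) (auto simp: Suc_diff_le)
  also have "T 0 + T (m + 2) + \<dots> = (\<Sum>c\<le>Suc (m div 2). if 2 * c = m + 2 then T c else T c + T (m + 2 - c))"
    by (subst sum.atMost_Suc_shift) simp
  finally show ?case by simp
qed simp_all

lemma sum_even_indices:
  fixes f :: "nat \<Rightarrow> 'a::comm_monoid_add"
  shows "(\<Sum>j\<le>n. if even j then f j else 0) = (\<Sum>i\<le>n div 2. f (2 * i))"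
proof -
  have "(\<Sum>j\<le>n. if even j then f j else 0) = (\<Sum>j\<in>{j. j \<le> n \<and> even j}. f j)"
    by (intro sum.mono_neutral_cong_right) auto
  also have "{j. j \<le> n \<and> even j} = (\<lambda>i. 2 * i) ` {..n div 2}" by (auto elim!: evenE)
  also have "(\<Sum>j\<in>(\<lambda>i. 2 * i) ` {..n div 2}. f j) = (\<Sum>i\<le>n div 2. f (2 * i))"
    by (subst sum.reindex) (auto simp: inj_on_def)
  finally show ?thesis .
qed

lemma sum_triangle:
  fixes f :: "nat \<Rightarrow> nat \<Rightarrow> 'a::comm_monoid_add"
  shows "(\<Sum>i\<le>N. \<Sum>c\<le>N - i. f i c) = (\<Sum>k\<le>N. \<Sum>i\<le>k. f i (k - i))"
proof -
  have "(\<Sum>i\<le>N. \<Sum>c\<le>N - i. f i c) = (\<Sum>(i, c)\<in>(SIGMA i:{..N}. {..N - i}). f i c)"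
    by (rule sum.Sigma) auto
  also have "(SIGMA i:{..N}. {..N - i}) = {(i, j). i + j \<le> N}" by auto
  also have "(\<Sum>(i, c)\<in>{(i, j). i + j \<le> N}. f i c) = (\<Sum>k\<le>N. \<Sum>i\<le>k. f i (k - i))"
    by (rule sum.triangle_reindex_eq)
  finally show ?thesis .
qed

lemma smult_sum_right: "smult c (\<Sum>i\<in>A. f i) = (\<Sum>i\<in>A. smult c (f i))"
  by (induction A rule: infinite_finite_induct) (simp_all add: smult_add_right)

text \<open>The Laurent polynomial that \<open>Epol n\<close> becomes under the substitution \<open>x = (w + 1/w)/2\<close>.\<close>

definition EL :: "nat \<Rightarrow> complex \<Rightarrow> complex" where
  "EL n w = (if n = 0 then 1 else w ^ n + inverse w ^ n)"

lemma Epol_cos: "complex_of_real (poly (Epol n) (cos t)) = EL n (cis t)"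
proof (cases "n = 0")
  case False
  have "inverse (cis t) ^ n = cis (- (real n * t))" using Complex.DeMoivre[of "- t" n] by simp
  moreover have "cis t ^ n = cis (real n * t)" by (rule Complex.DeMoivre)
  ultimately show ?thesis using False
    by (simp add: Epol_def EL_def Dpol_cos complex_eq_iff)
qed (simp add: Epol_def EL_def)

context fractional_order
begin

text \<open>The matrix of the operator in the basis \<open>Epol\<close>, up to the factor \<open>ell0\<close>: \<open>lcoef n k\<close> is the coefficient of
  degree \<open>n - 2k\<close> in the image of \<open>Epol n\<close>.\<close>

definition lcoef :: "nat \<Rightarrow> nat \<Rightarrow> real" where
  "lcoef n k = (\<Sum>i\<le>k. ecoef i * gam (k - i) * gam (n - k - i))"

lemma gam_ser_prod_nth:
  assumes w: "w \<noteq> 0"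
  shows "fps_nth (gam_ser w * gam_ser (inverse w)) m = (\<Sum>c\<le>m div 2. complex_of_real (gam c * gam (m - c)) * EL (m - 2 * c) w)"
proof -
  define T where "T i = complex_of_real (gam i * gam (m - i)) * (w ^ i * inverse w ^ (m - i))" for i
  have "fps_nth (gam_ser w * gam_ser (inverse w)) m = (\<Sum>i\<le>m. T i)"
    by (simp add: fps_mult_nth gam_ser_def T_def atLeast0AtMost mult_ac)
  also have "\<dots> = (\<Sum>c\<le>m div 2. if 2 * c = m then T c else T c + T (m - c))" by (rule sum_fold_symmetric)
  also have "\<dots> = (\<Sum>c\<le>m div 2. complex_of_real (gam c * gam (m - c)) * EL (m - 2 * c) w)"
  proof (rule sum.cong[OF refl])
    fix c assume "c \<in> {..m div 2}"
    then have c: "2 * c \<le> m" by auto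
    then obtain d where d: "m = 2 * c + d" using le_Suc_ex by blast
    have i: "w ^ c * inverse w ^ c = 1" using w by (simp flip: power_mult_distrib)
    have m1: "m - c = c + d" and m2: "m - 2 * c = d" and m3: "m - (m - c) = c" using d by auto
    have t1: "w ^ c * inverse w ^ (c + d) = inverse w ^ d" unfolding power_add mult.assoc[symmetric] i by simp
    have t2: "w ^ (c + d) * inverse w ^ c = w ^ d"
      unfolding power_add using i by (metis mult.commute mult.left_commute mult.right_neutral)
    show "(if 2 * c = m then T c else T c + T (m - c)) = complex_of_real (gam c * gam (m - c)) * EL (m - 2 * c) w"
    proof (cases "d = 0")
      case True then show ?thesis using d t1 unfolding T_def m1 m2 by (simp add: EL_def)
    next
      case False
      then have "2 * c \<noteq> m" using d by simp
      then show ?thesis using False unfolding T_def m3 unfolding m1 m2 t1 t2 by (simp add: EL_def algebra_simps)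
    qed
  qed
  finally show ?thesis .
qed

lemma LPgen_nth:
  assumes w: "w \<noteq> 0"
  shows "fps_nth (LPgen w) n = (\<Sum>k\<le>n div 2. complex_of_real (lcoef n k) * EL (n - 2 * k) w)"
proof -
  let ?H = "\<lambda>m. fps_nth (gam_ser w * gam_ser (inverse w)) m"
  have "fps_nth (LPgen w) n = (\<Sum>j\<le>n. if even j then complex_of_real (ecoef (j div 2)) * ?H (n - j) else 0)"
    unfolding LPgen_def fps_mult_nth[of ecoef_ser] by (intro sum.cong) (auto simp: ecoef_ser_def)
  also have "\<dots> = (\<Sum>i\<le>n div 2. complex_of_real (ecoef i) * ?H (n - 2 * i))"
    by (subst sum_even_indices) simp
  also have "\<dots> = (\<Sum>i\<le>n div 2. \<Sum>c\<le>n div 2 - i. complex_of_real (ecoef i * (gam c * gam (n - 2 * i - c))) * EL (n - 2 * (i + c)) w)"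
  proof (rule sum.cong[OF refl])
    fix i assume "i \<in> {..n div 2}"
    have e: "(n - 2 * i) div 2 = n div 2 - i" by (simp add: div_diff)
    show "complex_of_real (ecoef i) * ?H (n - 2 * i) = (\<Sum>c\<le>n div 2 - i. complex_of_real (ecoef i * (gam c * gam (n - 2 * i - c))) * EL (n - 2 * (i + c)) w)"
      unfolding gam_ser_prod_nth[OF w] e sum_distrib_left
      by (intro sum.cong refl) (simp add: mult.assoc)
  qed
  also have "\<dots> = (\<Sum>k\<le>n div 2. \<Sum>i\<le>k. complex_of_real (ecoef i * (gam (k - i) * gam (n - 2 * i - (k - i)))) * EL (n - 2 * (i + (k - i))) w)"
    by (rule sum_triangle)
  also have "\<dots> = (\<Sum>k\<le>n div 2. complex_of_real (lcoef n k) * EL (n - 2 * k) w)"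
  proof (rule sum.cong[OF refl])
    fix k assume "k \<in> {..n div 2}"
    have "(\<Sum>i\<le>k. complex_of_real (ecoef i * (gam (k - i) * gam (n - 2 * i - (k - i)))) * EL (n - 2 * (i + (k - i))) w) =
      (\<Sum>i\<le>k. complex_of_real (ecoef i * gam (k - i) * gam (n - k - i)) * EL (n - 2 * k) w)"
    proof (rule sum.cong[OF refl])
      fix i assume "i \<in> {..k}"
      then have "n - 2 * i - (k - i) = n - k - i" "i + (k - i) = k" by auto
      then show "complex_of_real (ecoef i * (gam (k - i) * gam (n - 2 * i - (k - i)))) * EL (n - 2 * (i + (k - i))) w =
        complex_of_real (ecoef i * gam (k - i) * gam (n - k - i)) * EL (n - 2 * k) w" by (simp only: mult.assoc)
    qed
    then show "(\<Sum>i\<le>k. complex_of_real (ecoef i * (gam (k - i) * gam (n - 2 * i - (k - i)))) * EL (n - 2 * (i + (k - i))) w) = complex_of_real (lcoef n k) * EL (n - 2 * k) w"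
      by (simp add: lcoef_def sum_distrib_right)
  qed
  finally show ?thesis .
qed

text \<open>The five-term recursion of the generating function is the one that \<open>LD_rec\<close> states for the operator; degrees
  up to \<open>3\<close> are computed.\<close>

lemma LP_Epol_eq_LPgen:
  "complex_of_real (poly (LP (Epol n)) (cos t)) = complex_of_real ell0 * fps_nth (LPgen (cis t)) n"
proof -
  define x where "x = cos t"
  define G where "G n = fps_nth (LPgen (cis t)) n" for n
  define L where "L n = complex_of_real (poly (LP (Epol n)) x)" for n
  have w: "cis t \<noteq> 0" "cis t + inverse (cis t) = 2 * complex_of_real x"
    by (simp_all add: cis_neq_zero) (simp add: x_def complex_eq_iff)
  note G = LPgen_rec[OF w, folded G_def]
  have E2: "Epol 2 = smult 4 (PX * PX) - smult 2 1"
    by (rule poly_eq_on_interval) (simp add: Epol_def numeral_2_eq_2)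
  have E3: "Epol 3 = smult 8 (PX * (PX * PX)) - smult 6 PX"
    by (rule poly_eq_on_interval) (simp add: Epol_def numeral_3_eq_3 algebra_simps)
  have "L n = complex_of_real ell0 * G n"
  proof (induction n rule: less_induct)
    case (less n)
    have "n = 0 \<or> n = 1 \<or> n = 2 \<or> n = 3 \<or> (\<exists>m. n = m + 4)" by presburger
    then consider "n = 0" | "n = 1" | "n = 2" | "n = 3" | m where "n = m + 4" by blast
    then show ?case
    proof cases
      case 1 then show ?thesis by (simp add: L_def Epol_def LP_1 G)
    next
      case 2
      have "L 1 = complex_of_real (2 * (b * ell0) * x)" by (simp add: L_def Epol_def LP_X LP_smult)
      then show ?thesis unfolding 2 G(2) by (simp add: mult_ac)
    next
      case 3
      have "L 2 = complex_of_real (ell0 * (4 * b * (s + 1) * x\<^sup>2 - 2 * b))"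
      proof -
        have "LP [:2:] = smult 2 [:ell0:]" using LP_smult[of 2 1] LP_1 by simp
        then show ?thesis
          by (simp add: L_def E2 LP_diff LP_smult LP_X_sq LP_1 power2_eq_square) (simp add: algebra_simps)
      qed
      moreover have "2 * G 2 = 2 * complex_of_real (4 * b * (s + 1) * x\<^sup>2 - 2 * b)"
        unfolding G(3) G(2) G(1) by (simp add: power2_eq_square) (simp add: algebra_simps)
      then have "G 2 = complex_of_real (4 * b * (s + 1) * x\<^sup>2 - 2 * b)"
        by (simp only: mult_left_cancel[OF numeral_neq_zero])
      ultimately show ?thesis using 3 by simp
    next
      case 4
      have g2: "G 2 = complex_of_real (4 * b * (s + 1) * x\<^sup>2 - 2 * b)"
      proof -
        have "2 * G 2 = 2 * complex_of_real (4 * b * (s + 1) * x\<^sup>2 - 2 * b)"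
          unfolding G(3) G(2) G(1) by (simp add: power2_eq_square) (simp add: algebra_simps)
        then show ?thesis by (simp only: mult_left_cancel[OF numeral_neq_zero])
      qed
      have p2: "poly (LP (PX * PX)) x = ell0 * (b * (s + 1) * x\<^sup>2 - s)"
        by (simp add: LP_X_sq power2_eq_square algebra_simps)
      have "3 * poly (LP (Epol 3)) x = 8 * (3 * poly (LP (PX * (PX * PX))) x) - 18 * (b * ell0 * x)"
        by (simp add: E3 LP_diff LP_smult LP_X)
      also have "\<dots> = ell0 * (4 * x * (4 * b * (s + 1) * x\<^sup>2 - 2 * b) + 2 * b * (x * (4 * b * (s + 1) * x\<^sup>2 - 2 * b) - 2 * (2 * b * x) + x))"
        unfolding LP_X_cube p2 by (simp add: algebra_simps power2_eq_square)
      finally have r3: "3 * poly (LP (Epol 3)) x = \<dots>" .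
      have "3 * G 3 = complex_of_real (4 * x * (4 * b * (s + 1) * x\<^sup>2 - 2 * b) + 2 * b * (x * (4 * b * (s + 1) * x\<^sup>2 - 2 * b) - 2 * (2 * b * x) + x))"
        unfolding G(4) g2 G(2) G(1) by simp
      then have "3 * (complex_of_real ell0 * G 3) = complex_of_real (3 * poly (LP (Epol 3)) x)"
        unfolding r3 by simp
      then show ?thesis using 4 unfolding L_def by simp
    next
      case (5 m)
      have LDL: "complex_of_real (LD j x) = L j" if "j > 0" for j
        using that by (simp add: LD_def L_def Epol_def)
      have LDm: "of_nat m * complex_of_real (LD m x) = of_nat m * L m" by (cases "m = 0") (simp_all add: LDL)
      have sm: "real (m + 2) + 2 = real (m + 4)" "real (m + 2) - 2 = real m" "real (m + 2) + 1 + b = real (m + 3) + b"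
          "real (m + 2) - 1 - b = real (m + 1) - b" by simp_all
      have si: "Suc (m + 3) = m + 4" "Suc (Suc (m + 2)) = m + 4" "Suc (m + 2) = m + 3" "Suc m = m + 1" by simp_all
      have R: "real (m + 4) * LD (m + 4) x + 4 * b * LD (m + 2) x - real m * LD m x =
        2 * x * ((real (m + 3) + b) * LD (m + 3) x - (real (m + 1) - b) * LD (m + 1) x)"
        using LD_rec[of "m + 2" m x, OF add_2_eq_Suc'] unfolding sm si .
      have LL: "complex_of_real (LD (m + 4) x) = L (m + 4)" "complex_of_real (LD (m + 3) x) = L (m + 3)"
        "complex_of_real (LD (m + 2) x) = L (m + 2)" "complex_of_real (LD (m + 1) x) = L (m + 1)"
        by (rule LDL; simp)+
      have "of_nat (m + 4) * L (m + 4) + 4 * complex_of_real b * L (m + 2) - of_nat m * L m =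
        2 * complex_of_real x * ((of_nat (m + 3) + complex_of_real b) * L (m + 3) - (of_nat (m + 1) - complex_of_real b) * L (m + 1))"
        unfolding LL[symmetric] LDm[symmetric] using arg_cong[OF R, of complex_of_real]
        by (simp only: of_real_add of_real_diff of_real_mult of_real_of_nat_eq of_real_numeral)
      then have "of_nat (m + 4) * L (m + 4) = of_nat m * L m - 4 * complex_of_real b * L (m + 2) +
        2 * complex_of_real x * ((of_nat (m + 3) + complex_of_real b) * L (m + 3) - (of_nat (m + 1) - complex_of_real b) * L (m + 1))"
        by (simp only: algebra_simps)
      also have "\<dots> = complex_of_real ell0 * (of_nat m * G m - 4 * complex_of_real b * G (m + 2) +
        2 * complex_of_real x * ((of_nat (m + 3) + complex_of_real b) * G (m + 3) - (of_nat (m + 1) - complex_of_real b) * G (m + 1)))"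
        using less 5 by (simp add: algebra_simps)
      also have "\<dots> = complex_of_real ell0 * (of_nat (m + 4) * G (m + 4))"
      proof -
        have g: "of_nat (m + 4) * G (m + 4) = 2 * complex_of_real x * of_nat (m + 3) * G (m + 3) - 2 * complex_of_real x * of_nat (m + 1) * G (m + 1) + of_nat m * G m
           + 2 * complex_of_real b * (complex_of_real x * G (m + 3) - 2 * G (m + 2) + complex_of_real x * G (m + 1))"
          using G(5)[of m] by (simp only: algebra_simps)
        show ?thesis
          by (rule arg_cong[of _ _ "\<lambda>t. complex_of_real ell0 * t"], unfold g) (simp add: algebra_simps)
      qed
      finally have "of_nat (m + 4) * L (m + 4) = of_nat (m + 4) * (complex_of_real ell0 * G (m + 4))" by (simp only: mult_ac)
      moreover have "(of_nat (m + 4) :: complex) \<noteq> 0" by (simp only: of_nat_eq_0_iff)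
      ultimately show ?thesis using 5 by (metis mult_left_cancel)
    qed
  qed
  then show ?thesis by (simp add: L_def G_def x_def)
qed

lemma LP_Epol: "LP (Epol n) = smult ell0 (\<Sum>k\<le>n div 2. smult (lcoef n k) (Epol (n - 2 * k)))"
proof (rule poly_eq_on_interval)
  fix x :: real assume x: "x \<in> {-1<..<1}"
  define t where "t = arccos x"
  have t: "cos t = x" using x by (simp add: t_def)
  have "complex_of_real (poly (LP (Epol n)) x) = complex_of_real (poly (smult ell0 (\<Sum>k\<le>n div 2. smult (lcoef n k) (Epol (n - 2 * k)))) x)"
    unfolding t[symmetric] LP_Epol_eq_LPgen by (simp add: LPgen_nth poly_sum Epol_cos)
  then show "poly (LP (Epol n)) x = poly (smult ell0 (\<Sum>k\<le>n div 2. smult (lcoef n k) (Epol (n - 2 * k)))) x"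
    by (simp only: of_real_eq_iff)
qed

lemma gam_mono: "m \<le> n \<Longrightarrow> gam m \<le> gam n"
  using gam_strict_mono[of m n] by (cases "m = n") auto

text \<open>The sequence \<open>gam\<close> is submultiplicative, since the quotients \<open>gam (n + 1) / gam n\<close> decrease.\<close>

lemma gam_add_le: "gam (m + j) \<le> gam m * gam j"
proof (induction j)
  case (Suc j)
  have "gam (m + Suc j) = gam (m + j) * ((real (m + j) + 1 + 2 * s) / (real (m + j) + 1))" by (simp add: gam_Suc)
  also have "(real (m + j) + 1 + 2 * s) / (real (m + j) + 1) \<le> (real j + 1 + 2 * s) / (real j + 1)"
    using s_pos by (simp add: divide_simps) (simp add: algebra_simps)
  then have "gam (m + j) * ((real (m + j) + 1 + 2 * s) / (real (m + j) + 1)) \<le> (gam m * gam j) * ((real j + 1 + 2 * s) / (real j + 1))"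
    using Suc gam_pos[of "m + j"] gam_pos[of m] gam_pos[of j] s_pos by (intro mult_mono) (auto intro!: divide_nonneg_nonneg)
  also have "\<dots> = gam m * gam (Suc j)" by (simp add: gam_Suc)
  finally show ?case .
qed simp

lemma gam_le_sq: "gam k \<le> (real k + 2)\<^sup>2"
proof -
  have "gam k \<le> (real k + 1) * (real k + 2) / 2"
  proof (induction k)
    case (Suc k)
    have "gam (Suc k) = gam k * ((real k + 1 + 2 * s) / (real k + 1))" by (simp add: gam_Suc)
    also have "\<dots> \<le> ((real k + 1) * (real k + 2) / 2) * ((real k + 3) / (real k + 1))"
      using Suc gam_pos[of k] s_less s_pos by (intro mult_mono divide_right_mono) auto
    also have "\<dots> = (real (Suc k) + 1) * (real (Suc k) + 2) / 2" by (simp add: field_simps)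
    finally show ?case .
  qed simp
  also have "\<dots> \<le> (real k + 2)\<^sup>2" by (simp add: power2_eq_square algebra_simps)
  finally show ?thesis .
qed

lemma ecoef_bound: "\<bar>ecoef i\<bar> \<le> 3"
proof -
  have "\<bar>ecoef (Suc i)\<bar> \<le> 3" for i
  proof (induction i)
    case 0 then show ?case using s_pos s_less by simp
  next
    case (Suc i)
    have "\<bar>ecoef (Suc (Suc i))\<bar> = \<bar>ecoef (Suc i)\<bar> * (\<bar>real (Suc i) - b\<bar> / (real (Suc i) + 1))"
      by (simp add: abs_mult del: ecoef.simps(2)) (simp add: abs_mult)
    also have "\<dots> \<le> 3 * 1"
      using s_pos s_less by (intro mult_mono Suc.IH) (auto simp: divide_simps)
    finally show ?case by simp
  qed
  then show ?thesis by (cases i) auto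
qed

text \<open>The product of \<open>(1 - z) powr b\<close> and \<open>(1 - z) powr -b\<close> is \<open>1\<close>.\<close>

lemma ecoef_gam_convolution: "(\<Sum>i\<le>k. ecoef i * gam (k - i)) = (if k = 0 then 1 else 0)"
proof -
  define A B where "A = Abs_fps gam" and "B = Abs_fps ecoef"
  have a: "(1 - fps_X) * fps_deriv A = fps_const b * A"
  proof (rule fps_ext)
    fix n
    have "(real n + 1) * gam (Suc n) = (real n + b) * gam n" by (simp add: gam_Suc field_simps)
    then show "fps_nth ((1 - fps_X) * fps_deriv A) n = fps_nth (fps_const b * A) n"
      by (cases n) (simp_all add: A_def left_diff_distrib algebra_simps)
  qed
  have b: "(1 - fps_X) * fps_deriv B = - fps_const b * B"
  proof (rule fps_ext)
    fix n
    have "(real n + 1) * ecoef (Suc n) = (real n - b) * ecoef n" by simp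
    then show "fps_nth ((1 - fps_X) * fps_deriv B) n = fps_nth (- fps_const b * B) n"
      by (cases n) (simp_all add: B_def left_diff_distrib algebra_simps del: ecoef.simps(2))
  qed
  have "(1 - fps_X) * fps_deriv (B * A) = ((1 - fps_X) * fps_deriv B) * A + B * ((1 - fps_X) * fps_deriv A)"
    by (simp add: algebra_simps)
  also have "\<dots> = 0"
  proof -
    have "- c * B * A + B * (c * A) = 0" for c :: "real fps" by (simp add: algebra_simps)
    then show ?thesis unfolding a b .
  qed
  finally have "(1 - fps_X) * fps_deriv (B * A) = 0" .
  moreover have "(1 - fps_X :: real fps) \<noteq> 0"
  proof
    assume "(1 - fps_X :: real fps) = 0"
    from arg_cong[OF this, of "\<lambda>f. fps_nth f 0"] show False by simp
  qed
  ultimately have d: "fps_deriv (B * A) = 0" by simp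
  have n: "fps_nth (B * A) k = (\<Sum>i\<le>k. ecoef i * gam (k - i))"
    by (simp add: fps_mult_nth A_def B_def atLeast0AtMost)
  show ?thesis
  proof (cases k)
    case (Suc j)
    have "fps_nth (fps_deriv (B * A)) j = 0" unfolding d by simp
    then have "fps_nth (B * A) (Suc j) = 0" by (simp only: fps_deriv_nth) simp
    then show ?thesis using n Suc by simp
  qed simp
qed

text \<open>A majorant of the matrix entries on the \<open>k\<close>-th diagonal, of polynomial growth.\<close>

definition lmaj :: "nat \<Rightarrow> real" where "lmaj k = 6 * real k * (real k + 1) * (gam k)\<^sup>2"

lemma lmaj_nonneg: "lmaj k \<ge> 0" by (simp add: lmaj_def)

lemma gam_diff_bound:
  assumes "d \<le> k"
  shows "\<bar>gam (m + d) - gam m\<bar> \<le> 2 * real k * gam k * gam m / (real m + 1)"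
proof -
  have "gam (m + d) - gam m \<le> real d * (2 * gam k * gam m / (real m + 1))" if "d \<le> k" for d
    using that
  proof (induction d)
    case (Suc d)
    have "gam (m + Suc d) - gam (m + d) = gam (m + d) * (2 * s) / (real (m + d) + 1)"
      by (simp add: gam_Suc divide_simps) (simp add: algebra_simps)
    also have "\<dots> \<le> (gam m * gam k) * 2 / (real m + 1)"
    proof (intro frac_le mult_mono)
      have "gam (m + d) \<le> gam m * gam d" by (rule gam_add_le)
      also have "\<dots> \<le> gam m * gam k" using Suc.prems gam_pos[of m] by (intro mult_left_mono gam_mono) auto
      finally show "gam (m + d) \<le> gam m * gam k" .
    qed (use gam_pos[of m] gam_pos[of k] s_pos s_less in auto)
    finally have "gam (m + Suc d) - gam (m + d) \<le> 2 * gam k * gam m / (real m + 1)" by (simp add: mult_ac)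
    moreover have "gam (m + d) - gam m \<le> real d * (2 * gam k * gam m / (real m + 1))" using Suc by simp
    ultimately have "gam (m + Suc d) - gam m \<le> real d * (2 * gam k * gam m / (real m + 1)) + 2 * gam k * gam m / (real m + 1)"
      by linarith
    then show ?case by (simp only: of_nat_Suc distrib_right mult_1_left add.commute)
  qed simp
  from this[OF assms] have "gam (m + d) - gam m \<le> real d * (2 * gam k * gam m / (real m + 1))" .
  also have "\<dots> \<le> real k * (2 * gam k * gam m / (real m + 1))"
    using assms gam_pos[of m] gam_pos[of k] by (intro mult_right_mono) auto
  finally show ?thesis using gam_mono[of m "m + d"] by (simp add: mult_ac)
qed

lemma lcoef_0: "lcoef n 0 = gam n"
  by (simp add: lcoef_def)

text \<open>By \<open>ecoef_gam_convolution\<close>, \<open>gam (n - k - i)\<close> may be replaced by its difference to \<open>gam (n - 2k)\<close>, which is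
  smaller by a factor of the order of \<open>n - 2k + 1\<close>. This gain is what makes the lower order terms of the
  inverse summable.\<close>

lemma lcoef_bound:
  assumes k: "k \<ge> 1" "2 * k \<le> n"
  shows "\<bar>lcoef n k\<bar> \<le> lmaj k * gam (n - 2 * k) / (real (n - 2 * k) + 1)"
proof -
  define m where "m = n - 2 * k"
  have n: "n = m + 2 * k" using k by (simp add: m_def)
  have "lcoef n k = (\<Sum>i\<le>k. ecoef i * gam (k - i) * gam (m + (k - i)))"
    unfolding lcoef_def
  proof (intro sum.cong refl)
    fix i assume "i \<in> {..k}"
    then have "n - k - i = m + (k - i)" by (auto simp: n)
    then show "ecoef i * gam (k - i) * gam (n - k - i) = ecoef i * gam (k - i) * gam (m + (k - i))" by simp
  qed
  also have "\<dots> = (\<Sum>i\<le>k. ecoef i * gam (k - i) * (gam (m + (k - i)) - gam m)) + (\<Sum>i\<le>k. ecoef i * gam (k - i)) * gam m"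
    by (simp add: algebra_simps sum_subtractf sum_distrib_left)
  also have "(\<Sum>i\<le>k. ecoef i * gam (k - i)) = 0" using k by (simp add: ecoef_gam_convolution)
  finally have "\<bar>lcoef n k\<bar> = \<bar>\<Sum>i\<le>k. ecoef i * gam (k - i) * (gam (m + (k - i)) - gam m)\<bar>" by simp
  also have "\<dots> \<le> (\<Sum>i\<le>k. 3 * gam k * (2 * real k * gam k * gam m / (real m + 1)))"
  proof (rule order_trans[OF sum_abs], rule sum_mono)
    fix i assume "i \<in> {..k}"
    have "\<bar>ecoef i\<bar> * \<bar>gam (k - i)\<bar> * \<bar>gam (m + (k - i)) - gam m\<bar> \<le> 3 * gam k * (2 * real k * gam k * gam m / (real m + 1))"
      using gam_pos[of k] gam_pos[of "k - i"] gam_pos[of m] gam_mono[of "k - i" k]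
      by (intro mult_mono ecoef_bound gam_diff_bound) auto
    then show "\<bar>ecoef i * gam (k - i) * (gam (m + (k - i)) - gam m)\<bar> \<le> 3 * gam k * (2 * real k * gam k * gam m / (real m + 1))"
      by (simp only: abs_mult)
  qed
  also have "\<dots> = lmaj k * gam m / (real m + 1)"
    by (simp add: lmaj_def power2_eq_square algebra_simps)
  finally show ?thesis by (simp add: m_def)
qed

text \<open>The entries of the inverse matrix by forward substitution, and the preimage of \<open>Epol n\<close> that they define.\<close>

fun qc :: "nat \<Rightarrow> nat \<Rightarrow> real" where
  "qc n k = (if k = 0 then 1 / (ell0 * gam n)
     else - (\<Sum>i\<in>{..<k}. qc n i * lcoef (n - 2 * i) (k - i)) / gam (n - 2 * k))"

declare qc.simps [simp del]

lemma qc_0: "qc n 0 = 1 / (ell0 * gam n)" by (simp add: qc.simps)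

lemma qc_rec: "k > 0 \<Longrightarrow> (\<Sum>i\<le>k. qc n i * lcoef (n - 2 * i) (k - i)) = 0"
  using gam_pos[of "n - 2 * k"]
  by (subst lessThan_Suc_atMost[symmetric]) (simp add: lcoef_0 qc.simps[of n k])

definition Qpol :: "nat \<Rightarrow> real poly" where
  "Qpol n = (\<Sum>k\<le>n div 2. smult (qc n k) (Epol (n - 2 * k)))"

lemma LP_Qpol: "LP (Qpol n) = Epol n"
proof -
  let ?N = "n div 2"
  have "LP (Qpol n) = (\<Sum>i\<le>?N. smult (qc n i) (smult ell0 (\<Sum>c\<le>?N - i. smult (lcoef (n - 2 * i) c) (Epol (n - 2 * (i + c))))))"
    unfolding Qpol_def LP_sum LP_smult LP_Epol
  proof (rule sum.cong[OF refl])
    fix i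
    have e: "(n - 2 * i) div 2 = ?N - i" by (simp add: div_diff)
    show "smult (qc n i) (smult ell0 (\<Sum>k\<le>(n - 2 * i) div 2. smult (lcoef (n - 2 * i) k) (Epol (n - 2 * i - 2 * k)))) =
       smult (qc n i) (smult ell0 (\<Sum>c\<le>?N - i. smult (lcoef (n - 2 * i) c) (Epol (n - 2 * (i + c)))))"
      unfolding e by simp
  qed
  also have "\<dots> = (\<Sum>i\<le>?N. \<Sum>c\<le>?N - i. smult (ell0 * qc n i * lcoef (n - 2 * i) c) (Epol (n - 2 * (i + c))))"
    by (simp add: smult_sum_right mult_ac)
  also have "\<dots> = (\<Sum>k\<le>?N. \<Sum>i\<le>k. smult (ell0 * qc n i * lcoef (n - 2 * i) (k - i)) (Epol (n - 2 * (i + (k - i)))))"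
    by (rule sum_triangle)
  also have "\<dots> = (\<Sum>k\<le>?N. smult (ell0 * (\<Sum>i\<le>k. qc n i * lcoef (n - 2 * i) (k - i))) (Epol (n - 2 * k)))"
  proof (rule sum.cong[OF refl])
    fix k
    have "(\<Sum>i\<le>k. smult (ell0 * qc n i * lcoef (n - 2 * i) (k - i)) (Epol (n - 2 * (i + (k - i))))) =
       (\<Sum>i\<le>k. smult (ell0 * (qc n i * lcoef (n - 2 * i) (k - i))) (Epol (n - 2 * k)))"
      by (intro sum.cong refl) (simp add: mult.assoc)
    then show "(\<Sum>i\<le>k. smult (ell0 * qc n i * lcoef (n - 2 * i) (k - i)) (Epol (n - 2 * (i + (k - i))))) =
      smult (ell0 * (\<Sum>i\<le>k. qc n i * lcoef (n - 2 * i) (k - i))) (Epol (n - 2 * k))"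
      by (simp add: smult_sum sum_distrib_left)
  qed
  also have "\<dots> = (\<Sum>k\<le>?N. if k = 0 then Epol n else 0)"
    using ell0_nonzero gam_pos[of n] by (intro sum.cong refl) (auto simp: qc_rec qc_0 lcoef_0)
  finally show ?thesis by simp
qed

lemma lmaj_summable:
  assumes "r > 1"
  shows "summable (\<lambda>d. lmaj d / r ^ d)"
proof -
  \<comment> \<open>half of the geometric decay absorbs the polynomial growth, the other half makes the sum converge\<close>
  define x where "x = 1 / sqrt r"
  have x: "0 < x" "x < 1" using assms by (simp_all add: x_def)
  have "(\<lambda>d. (real d + 2) ^ 6 * x ^ d) \<longlonglongrightarrow> 0"
    using x by real_asymp
  then have "Bseq (\<lambda>d. (real d + 2) ^ 6 * x ^ d)" by (intro convergent_imp_Bseq convergentI)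
  then obtain B where B: "B > 0" "\<And>d. norm ((real d + 2) ^ 6 * x ^ d) \<le> B" by (auto simp: Bseq_def)
  have g: "summable (\<lambda>d. 6 * B * x ^ d)" using x by (intro summable_mult summable_geometric) auto
  show ?thesis
  proof (rule summable_comparison_test'[OF g])
    fix d :: nat
    have "lmaj d \<le> 6 * (real d + 2) ^ 6"
    proof -
      have "(gam d)\<^sup>2 \<le> ((real d + 2)\<^sup>2)\<^sup>2" using gam_pos[of d] gam_le_sq[of d] by (intro power_mono) auto
      then have "real d * (real d + 1) * (gam d)\<^sup>2 \<le> (real d + 2) * (real d + 2) * ((real d + 2)\<^sup>2)\<^sup>2"
        by (intro mult_mono) auto
      also have "\<dots> = (real d + 2) ^ 6" by (simp add: power_mult[symmetric] eval_nat_numeral)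
      finally show ?thesis by (simp add: lmaj_def)
    qed
    moreover have "1 / r ^ d = x ^ d * x ^ d"
      using assms by (simp add: x_def power_mult_distrib[symmetric] power_one_over)
    then have "lmaj d / r ^ d = lmaj d * (x ^ d * x ^ d)" by (metis mult.right_neutral times_divide_eq_right)
    ultimately have "lmaj d / r ^ d \<le> (6 * (real d + 2) ^ 6) * (x ^ d * x ^ d)"
      using x by (simp only: mult_right_mono zero_le_mult_iff zero_le_power less_imp_le simp_thms)
    also have "\<dots> = 6 * ((real d + 2) ^ 6 * x ^ d) * x ^ d" by simp
    also have "\<dots> \<le> 6 * B * x ^ d" using B(2)[of d] x by (intro mult_right_mono) auto
    finally show "norm (lmaj d / r ^ d) \<le> 6 * B * x ^ d"
      using assms lmaj_nonneg[of d] by simp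
  qed
qed

text \<open>The recursion for \<open>qc n k\<close> has the kernel \<open>lmaj\<close>, summable with weights \<open>r powr -d\<close>, and a gain of \<open>1 / (j + 1)\<close>
  for \<open>j = n - 2k\<close>. If the sum \<open>S\<close> of the kernel is at most \<open>j + 1\<close>, the gain absorbs it, and this fails
  for at most \<open>J\<close> values of \<open>j\<close>; so the entries grow at most like \<open>r ^ k\<close>, up to the constant factor \<open>S ^ J\<close>. One further
  application of the recursion retains the gain, and \<open>1 / (j + 1) \<le> (2k + 1) / (n + 1)\<close>.\<close>

lemma qc_bound:
  assumes r: "r > 1"
  shows "\<exists>C>0. \<forall>n k. 1 \<le> k \<longrightarrow> 2 * k \<le> n \<longrightarrow> \<bar>qc n k\<bar> \<le> C * ((2 * real k + 1) * r ^ k) / ((real n + 1) * gam n)"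
proof -
  define S where "S = max 1 (\<Sum>d. lmaj d / r ^ d)"
  obtain J :: nat where J: "S \<le> real J" using real_arch_simple by blast
  have S1: "S \<ge> 1" by (simp add: S_def)
  have part: "(\<Sum>i<k. lmaj (k - i) / r ^ (k - i)) \<le> S" for k
  proof -
    have "(\<Sum>i<k. lmaj (k - i) / r ^ (k - i)) = (\<Sum>i<k. lmaj (Suc (k - Suc i)) / r ^ Suc (k - Suc i))"
      by (intro sum.cong refl) (simp add: Suc_diff_Suc)
    also have "\<dots> = (\<Sum>i<k. lmaj (Suc i) / r ^ Suc i)" by (rule sum.nat_diff_reindex)
    also have "\<dots> \<le> (\<Sum>i<Suc k. lmaj i / r ^ i)"
      by (subst sum.lessThan_Suc_shift) (use lmaj_nonneg[of 0] in simp)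
    also have "\<dots> \<le> (\<Sum>d. lmaj d / r ^ d)"
      using lmaj_nonneg r by (intro sum_le_suminf lmaj_summable) auto
    also have "\<dots> \<le> S" by (simp add: S_def)
    finally show ?thesis .
  qed
  have step: "\<bar>qc n k\<bar> \<le> (\<Sum>i<k. \<bar>qc n i\<bar> * lmaj (k - i)) / (real (n - 2 * k) + 1)" if k: "1 \<le> k" "2 * k \<le> n" for n k
  proof -
    define j where "j = n - 2 * k"
    have "\<bar>\<Sum>i<k. qc n i * lcoef (n - 2 * i) (k - i)\<bar> \<le> (\<Sum>i<k. \<bar>qc n i\<bar> * (lmaj (k - i) * gam j / (real j + 1)))"
    proof (rule order_trans[OF sum_abs], rule sum_mono)
      fix i assume i: "i \<in> {..<k}"
      have e: "n - 2 * i - 2 * (k - i) = j" using i by (auto simp: j_def)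
      have "\<bar>lcoef (n - 2 * i) (k - i)\<bar> \<le> lmaj (k - i) * gam j / (real j + 1)"
        using lcoef_bound[of "k - i" "n - 2 * i"] i k unfolding e by auto
      then show "\<bar>qc n i * lcoef (n - 2 * i) (k - i)\<bar> \<le> \<bar>qc n i\<bar> * (lmaj (k - i) * gam j / (real j + 1))"
        unfolding abs_mult by (rule mult_left_mono) simp
    qed
    also have "\<dots> = gam j * ((\<Sum>i<k. \<bar>qc n i\<bar> * lmaj (k - i)) / (real j + 1))"
      by (simp add: sum_distrib_left sum_divide_distrib mult_ac)
    finally have *: "\<bar>\<Sum>i<k. qc n i * lcoef (n - 2 * i) (k - i)\<bar> \<le> gam j * ((\<Sum>i<k. \<bar>qc n i\<bar> * lmaj (k - i)) / (real j + 1))" .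
    have "\<bar>qc n k\<bar> = \<bar>\<Sum>i<k. qc n i * lcoef (n - 2 * i) (k - i)\<bar> / gam j"
      using k gam_pos[of j] by (subst qc.simps) (simp add: j_def abs_divide)
    also have "\<dots> \<le> (\<Sum>i<k. \<bar>qc n i\<bar> * lmaj (k - i)) / (real j + 1)"
      using * gam_pos[of j] by (simp add: divide_le_eq mult.commute)
    finally show ?thesis by (simp add: j_def)
  qed
  \<comment> \<open>bounds the number of steps in which the gain did not absorb \<open>S\<close>, all at values from \<open>j\<close> up to \<open>J - 1\<close>\<close>
  define e where "e j = J - j" for j :: nat
  have crude: "\<bar>qc n k\<bar> \<le> \<bar>qc n 0\<bar> * r ^ k * S ^ e (n - 2 * k)" if "2 * k \<le> n" for n k
    using that
  proof (induction k rule: less_induct)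
    case (less k)
    show ?case
    proof (cases "k = 0")
      case True then show ?thesis using S1 by (simp add: mult_le_cancel_left1)
    next
      case False
      define j where "j = n - 2 * k"
      define y where "y = \<bar>qc n 0\<bar>"
      \<comment> \<open>an earlier entry has \<open>n - 2i \<ge> j + 2\<close>, so its exponent is smaller by at least one unless it is already \<open>0\<close>\<close>
      define e' where "e' = (if J \<le> j then 0 else e j - 1)"
      have ee: "e (n - 2 * i) \<le> e'" if "i < k" for i
        using that less.prems by (auto simp: e_def e'_def j_def)
      have "(\<Sum>i<k. \<bar>qc n i\<bar> * lmaj (k - i)) \<le> (\<Sum>i<k. y * r ^ k * S ^ e' * (lmaj (k - i) / r ^ (k - i)))"
      proof (rule sum_mono)
        fix i assume i: "i \<in> {..<k}"
        have "\<bar>qc n i\<bar> \<le> y * r ^ i * S ^ e (n - 2 * i)" unfolding y_def using i less by auto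
        also have "\<dots> \<le> y * r ^ i * S ^ e'"
          using ee[of i] i S1 r by (intro mult_left_mono power_increasing) (auto simp: y_def)
        finally have "\<bar>qc n i\<bar> * lmaj (k - i) \<le> y * r ^ i * S ^ e' * lmaj (k - i)"
          using lmaj_nonneg by (rule mult_right_mono)
        also have "r ^ k = r ^ i * r ^ (k - i)" using i by (simp flip: power_add)
        then have "y * r ^ i * S ^ e' * lmaj (k - i) = y * r ^ k * S ^ e' * (lmaj (k - i) / r ^ (k - i))"
          using r by simp
        finally show "\<bar>qc n i\<bar> * lmaj (k - i) \<le> y * r ^ k * S ^ e' * (lmaj (k - i) / r ^ (k - i))" .
      qed
      also have "\<dots> = y * r ^ k * S ^ e' * (\<Sum>i<k. lmaj (k - i) / r ^ (k - i))"
        by (simp add: sum_distrib_left)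
      also have "\<dots> \<le> y * r ^ k * S ^ e' * S"
        using S1 r by (intro mult_left_mono part) (auto simp: y_def)
      finally have sm: "(\<Sum>i<k. \<bar>qc n i\<bar> * lmaj (k - i)) \<le> y * r ^ k * (S ^ e' * S)" by (simp add: mult.assoc)
      have "\<bar>qc n k\<bar> \<le> (\<Sum>i<k. \<bar>qc n i\<bar> * lmaj (k - i)) / (real j + 1)"
        using step[of k n] False less.prems by (simp add: j_def)
      also have "\<dots> \<le> y * r ^ k * (S ^ e' * S) / (real j + 1)"
        by (intro divide_right_mono sm) auto
      also have "\<dots> = y * r ^ k * (S ^ e' * S / (real j + 1))" by simp
      also have "\<dots> \<le> y * r ^ k * S ^ e j"
      proof (intro mult_left_mono)
        show "S ^ e' * S / (real j + 1) \<le> S ^ e j"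
        proof (cases "J \<le> j")
          case True
          then have "S \<le> real j + 1" using J by linarith
          then show ?thesis using True by (simp add: e'_def e_def)
        next
          case F: False
          then have "e j = Suc (e j - 1)" by (simp add: e_def)
          then have "S ^ e' * S = S ^ e j" using F by (metis e'_def power_Suc2)
          moreover have "S ^ e j / (real j + 1) \<le> S ^ e j / 1" using S1 by (intro divide_left_mono) auto
          ultimately show ?thesis by simp
        qed
      qed (use r in \<open>auto simp: y_def\<close>)
      finally show ?thesis by (simp add: y_def j_def)
    qed
  qed
  define C where "C = S ^ J * S / \<bar>ell0\<bar>"
  have "C > 0" using S1 ell0_nonzero by (simp add: C_def)
  moreover have "\<bar>qc n k\<bar> \<le> C * ((2 * real k + 1) * r ^ k) / ((real n + 1) * gam n)" if k: "1 \<le> k" "2 * k \<le> n" for n k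
  proof -
    define j where "j = n - 2 * k"
    define y where "y = \<bar>qc n 0\<bar>"
    have "(\<Sum>i<k. \<bar>qc n i\<bar> * lmaj (k - i)) \<le> (\<Sum>i<k. y * r ^ k * S ^ J * (lmaj (k - i) / r ^ (k - i)))"
    proof (rule sum_mono)
      fix i assume i: "i \<in> {..<k}"
      have "\<bar>qc n i\<bar> \<le> y * r ^ i * S ^ e (n - 2 * i)" unfolding y_def using i k by (intro crude) auto
      also have "\<dots> \<le> y * r ^ i * S ^ J"
        using S1 r by (intro mult_left_mono power_increasing) (auto simp: y_def e_def)
      finally have "\<bar>qc n i\<bar> * lmaj (k - i) \<le> y * r ^ i * S ^ J * lmaj (k - i)"
        using lmaj_nonneg by (rule mult_right_mono)
      also have "r ^ k = r ^ i * r ^ (k - i)" using i by (simp flip: power_add)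
      then have "y * r ^ i * S ^ J * lmaj (k - i) = y * r ^ k * S ^ J * (lmaj (k - i) / r ^ (k - i))"
        using r by simp
      finally show "\<bar>qc n i\<bar> * lmaj (k - i) \<le> y * r ^ k * S ^ J * (lmaj (k - i) / r ^ (k - i))" .
    qed
    also have "\<dots> = y * r ^ k * S ^ J * (\<Sum>i<k. lmaj (k - i) / r ^ (k - i))"
      by (simp add: sum_distrib_left)
    also have "\<dots> \<le> y * r ^ k * S ^ J * S"
      using S1 r by (intro mult_left_mono part) (auto simp: y_def)
    finally have sm: "(\<Sum>i<k. \<bar>qc n i\<bar> * lmaj (k - i)) \<le> y * r ^ k * S ^ J * S" .
    have n: "real n = real j + 2 * real k" using k by (simp add: j_def)
    have inv: "1 / (real j + 1) \<le> (2 * real k + 1) / (real n + 1)"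
    proof -
      have "0 \<le> 2 * (real k * real j)" by simp
      then show ?thesis by (simp add: n divide_simps) (simp add: algebra_simps)
    qed
    have "\<bar>qc n k\<bar> \<le> (\<Sum>i<k. \<bar>qc n i\<bar> * lmaj (k - i)) / (real j + 1)"
      using step[OF k] by (simp add: j_def)
    also have "\<dots> \<le> (y * r ^ k * S ^ J * S) * (1 / (real j + 1))"
      using divide_right_mono[OF sm, of "real j + 1"] by simp
    also have "\<dots> \<le> (y * r ^ k * S ^ J * S) * ((2 * real k + 1) / (real n + 1))"
      using inv S1 r by (intro mult_left_mono) (auto simp: y_def)
    also have "\<dots> = C * ((2 * real k + 1) * r ^ k) / ((real n + 1) * gam n)"
      using gam_pos[of n] by (simp add: C_def y_def qc_0 abs_mult mult_ac)
    finally show ?thesis .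
  qed
  ultimately show ?thesis by blast
qed

end

section \<open>The Joukowski map and Chebyshev series\<close>

text \<open>The Joukowski map. It maps both \<open>\<bar>w\<bar> = \<rho>\<close> and \<open>\<bar>w\<bar> = 1 / \<rho>\<close> onto the Bernstein ellipse.\<close>

definition Jou :: "complex \<Rightarrow> complex" where "Jou w = (w + inverse w) / 2"

lemma Jou_inverse [simp]: "Jou (inverse w) = Jou w"
  by (simp add: Jou_def add.commute)

lemma Jou_cis: "Jou (cis t) = complex_of_real (cos t)"
  by (simp add: Jou_def complex_eq_iff)

lemma Jou_norm_sum:
  assumes "w \<noteq> 0"
  shows "cmod (Jou w - 1) + cmod (Jou w + 1) = cmod w + 1 / cmod w"
proof -
  have "Jou w - 1 = (w - 1)\<^sup>2 / (2 * w)" "Jou w + 1 = (w + 1)\<^sup>2 / (2 * w)"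
    using assms by (simp_all add: Jou_def field_simps power2_eq_square)
  then have "cmod (Jou w - 1) + cmod (Jou w + 1) = ((cmod (w - 1))\<^sup>2 + (cmod (w + 1))\<^sup>2) / (2 * cmod w)"
    by (simp add: norm_divide norm_power norm_mult add_divide_distrib)
  also have "(cmod (w - 1))\<^sup>2 + (cmod (w + 1))\<^sup>2 = 2 * ((cmod w)\<^sup>2 + 1)"
    by (simp add: cmod_power2) (simp add: power2_eq_square algebra_simps)
  also have "2 * ((cmod w)\<^sup>2 + 1) / (2 * cmod w) = cmod w + 1 / cmod w"
    using assms by (simp add: field_simps power2_eq_square)
  finally show ?thesis .
qed

lemma add_inverse_strict_mono:
  fixes s t :: real
  assumes "1 \<le> s" "s < t"
  shows "s + 1 / s < t + 1 / t"
proof -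
  have "s * t > 1" using assms mult_less_cancel_left2[of s t] by (smt (verit) mult_le_cancel_left1 mult_less_cancel_left1)
  then have "0 < (t - s) * (1 - 1 / (s * t))" using assms by (intro mult_pos_pos) auto
  also have "\<dots> = (t + 1 / t) - (s + 1 / s)" using assms by (simp add: field_simps)
  finally show ?thesis by simp
qed

text \<open>The two preimages of \<open>z\<close> have product \<open>1\<close>, so one of them has modulus at least \<open>1\<close>.\<close>

lemma Jou_surj: "\<exists>w. 1 \<le> cmod w \<and> z = Jou w"
proof -
  define v where "v = z + csqrt (z\<^sup>2 - 1)"
  have e: "v * (z - csqrt (z\<^sup>2 - 1)) = 1"
    by (simp add: v_def algebra_simps power2_eq_square[symmetric])
  then have v0: "v \<noteq> 0" by auto
  have "inverse v = z - csqrt (z\<^sup>2 - 1)" using e by (rule inverse_unique)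
  then have J: "Jou v = z" by (simp add: Jou_def v_def)
  show ?thesis
  proof (cases "1 \<le> cmod v")
    case False
    then have "1 \<le> cmod (inverse v)" using v0 by (simp add: norm_inverse one_le_inverse_iff)
    then show ?thesis using J by (intro exI[of _ "inverse v"]) simp
  qed (use J in auto)
qed

lemma Jou_region:
  assumes "1 \<le> \<rho>" "1 \<le> cmod w"
  shows "Jou w \<in> bernstein_region \<rho> \<longleftrightarrow> cmod w \<le> \<rho>"
proof -
  have "w \<noteq> 0" using assms(2) by auto
  then have "Jou w \<in> bernstein_region \<rho> \<longleftrightarrow> cmod w + 1 / cmod w \<le> \<rho> + 1 / \<rho>"
    by (simp add: bernstein_region_def Jou_norm_sum)
  also have "\<dots> \<longleftrightarrow> cmod w \<le> \<rho>"
    using add_inverse_strict_mono[of "cmod w" \<rho>] add_inverse_strict_mono[of \<rho> "cmod w"] assms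
    by (cases "cmod w" \<rho> rule: linorder_cases) auto
  finally show ?thesis .
qed

text \<open>The interior of the Bernstein region.\<close>

definition open_ellipse :: "real \<Rightarrow> complex set" where
  "open_ellipse \<rho> = {z. cmod (z - 1) + cmod (z + 1) < \<rho> + 1 / \<rho>}"

lemma open_open_ellipse: "open (open_ellipse \<rho>)"
  unfolding open_ellipse_def by (intro open_Collect_less continuous_intros)

lemma convex_open_ellipse: "convex (open_ellipse \<rho>)"
proof -
  have "convex_on UNIV (\<lambda>z. cmod (z - 1) + cmod (z - (-1)))"
    using convex_on_add[OF convex_on_dist[of UNIV "1::complex"] convex_on_dist[of UNIV "-1::complex"]]
    by (simp add: dist_norm norm_minus_commute)
  then have "convex_on UNIV (\<lambda>z. cmod (z - 1) + cmod (z + 1))" by simp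
  then have c: "cmod (u *\<^sub>R x + v *\<^sub>R y - 1) + cmod (u *\<^sub>R x + v *\<^sub>R y + 1)
      \<le> u * (cmod (x - 1) + cmod (x + 1)) + v * (cmod (y - 1) + cmod (y + 1))"
    if "0 \<le> u" "0 \<le> v" "u + v = 1" for u v x y using that unfolding convex_on_def by blast
  show ?thesis
    unfolding convex_def open_ellipse_def mem_Collect_eq
    by (intro ballI allI impI) (rule le_less_trans[OF c convex_bound_lt], auto)
qed

lemma Jou_open_ellipse:
  assumes "1 < \<rho>" "1 / \<rho> < cmod w" "cmod w < \<rho>"
  shows "Jou w \<in> open_ellipse \<rho>"
proof -
  have pos: "cmod w > 0" using assms by (meson divide_pos_pos less_trans zero_less_one)
  then have w0: "w \<noteq> 0" by auto
  have "cmod w + 1 / cmod w < \<rho> + 1 / \<rho>"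
  proof (cases "1 \<le> cmod w")
    case True then show ?thesis using assms add_inverse_strict_mono by blast
  next
    case False
    have "1 / cmod w < \<rho>" "1 \<le> 1 / cmod w" using assms pos False by (simp_all add: field_simps)
    from add_inverse_strict_mono[OF this(2,1)] show ?thesis by simp
  qed
  then show ?thesis using w0 by (simp add: open_ellipse_def Jou_norm_sum)
qed

lemma bernstein_subset_open_ellipse:
  assumes "1 \<le> \<rho>" "\<rho> < \<rho>'"
  shows "bernstein_region \<rho> \<subseteq> open_ellipse \<rho>'"
  using add_inverse_strict_mono[OF assms] by (auto simp: bernstein_region_def open_ellipse_def)

text \<open>The derivative of the Joukowski map is at most \<open>1\<close> in modulus outside the unit disc, so the region of
  parameter \<open>\<rho> + \<epsilon>\<close> lies in the \<open>\<epsilon>\<close>-neighbourhood of the region of parameter \<open>\<rho>\<close>.\<close>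

lemma analytic_on_larger_ellipse:
  assumes \<rho>: "1 < \<rho>" and F: "F analytic_on bernstein_region \<rho>"
  shows "\<exists>\<rho>'>\<rho>. F holomorphic_on open_ellipse \<rho>'"
proof -
  obtain S where S: "open S" "bernstein_region \<rho> \<subseteq> S" "F holomorphic_on S"
    using F unfolding analytic_on_holomorphic by blast
  obtain \<epsilon> where \<epsilon>: "\<epsilon> > 0" "(\<Union>x\<in>bernstein_region \<rho>. ball x \<epsilon>) \<subseteq> S"
    using compact_subset_open_imp_ball_epsilon_subset[OF compact_bernstein_region S(1,2)] by blast
  define \<rho>' where "\<rho>' = \<rho> + \<epsilon>"
  have "open_ellipse \<rho>' \<subseteq> S"
  proof
    fix z assume z: "z \<in> open_ellipse \<rho>'"
    obtain w where w: "1 \<le> cmod w" "z = Jou w" using Jou_surj by blast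
    have w0: "w \<noteq> 0" using w(1) by auto
    have "cmod w < \<rho>'"
    proof (rule ccontr)
      assume "\<not> cmod w < \<rho>'"
      then have "\<rho>' + 1 / \<rho>' \<le> cmod w + 1 / cmod w"
        using add_inverse_strict_mono[of \<rho>' "cmod w"] \<rho> \<epsilon>(1) by (cases "\<rho>' = cmod w") (auto simp: \<rho>'_def)
      then show False using z w0 by (simp add: w(2) open_ellipse_def Jou_norm_sum)
    qed
    show "z \<in> S"
    proof (cases "cmod w \<le> \<rho>")
      case True
      then have "z \<in> bernstein_region \<rho>" using Jou_region[of \<rho> w] \<rho> w by simp
      then show ?thesis using S(2) by blast
    next
      case False
      define v where "v = of_real (\<rho> / cmod w) * w"
      have nv: "cmod v = \<rho>" using w0 \<rho> by (simp add: v_def norm_mult norm_divide)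
      then have v0: "v \<noteq> 0" using \<rho> by auto
      have vr: "Jou v \<in> bernstein_region \<rho>" using Jou_region[of \<rho> v] \<rho> nv by simp
      have "w - v = of_real (1 - \<rho> / cmod w) * w" by (simp add: v_def algebra_simps)
      then have "cmod (w - v) = \<bar>1 - \<rho> / cmod w\<bar> * cmod w" by (simp only: norm_mult norm_of_real)
      also have "\<dots> = cmod w - \<rho>" using False w0 \<rho> by (simp add: field_simps abs_if)
      finally have wv: "cmod (w - v) < \<epsilon>" using \<open>cmod w < \<rho>'\<close> by (simp add: \<rho>'_def)
      have "Jou w - Jou v = (w - v) * ((1 - inverse (w * v)) / 2)"
        using w0 v0 by (simp add: Jou_def field_simps)
      moreover have "cmod (1 - inverse (w * v)) \<le> 1 + 1"
      proof (rule order_trans[OF norm_triangle_ineq4 add_mono])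
        have "1 \<le> cmod w * cmod v" using w(1) nv \<rho> mult_mono[of 1 "cmod w" 1 "cmod v"] by simp
        then show "cmod (inverse (w * v)) \<le> 1" by (simp add: norm_inverse norm_mult inverse_le_1_iff del: inverse_mult_distrib)
      qed simp
      ultimately have "cmod (Jou w - Jou v) \<le> cmod (w - v) * 1"
        by (simp only: norm_mult norm_divide) (intro mult_left_mono, auto)
      then have "Jou w \<in> ball (Jou v) \<epsilon>" using wv by (simp add: dist_norm norm_minus_commute)
      then show ?thesis using \<epsilon>(2) vr w(2) by blast
    qed
  qed
  then have "F holomorphic_on open_ellipse \<rho>'" using S(3) holomorphic_on_subset by blast
  then show ?thesis using \<epsilon>(1) by (intro exI[of _ \<rho>']) (auto simp: \<rho>'_def)
qed

text \<open>The derivative of the Joukowski map.\<close>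

definition Jou' :: "complex \<Rightarrow> complex" where "Jou' w = (1 - inverse (w\<^sup>2)) / 2"

lemma Jou_deriv: "w \<noteq> 0 \<Longrightarrow> (Jou has_field_derivative Jou' w) (at w)"
  unfolding Jou_def[abs_def] Jou'_def
  by (auto intro!: derivative_eq_intros simp: power2_eq_square)

text \<open>The Laurent polynomials \<open>EL n\<close> generate the logarithmic derivative in \<open>v\<close> of \<open>Jou v - Jou w\<close>, see the next
  lemma; this turns Cauchy's formula into the Chebyshev expansion.\<close>

lemma EL_sums:
  assumes "1 \<le> cmod w" "cmod w < cmod v"
  shows "(\<lambda>n. EL n w / v ^ Suc n) sums (1 / (v - w) + 1 / (v - inverse w) - 1 / v)"
proof -
  have w0: "w \<noteq> 0" "v \<noteq> 0" using assms by auto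
  have a: "cmod (w / v) < 1" using assms w0 by (simp add: norm_divide)
  have iw: "cmod (inverse w) \<le> 1" using assms(1) by (simp add: norm_inverse inverse_le_1_iff)
  have b: "cmod (inverse w / v) < 1" using iw assms w0 by (simp add: norm_divide)
  have ne: "v \<noteq> w" "v \<noteq> inverse w" using a b w0 by auto
  have "(\<lambda>n. (w / v) ^ n / v + (inverse w / v) ^ n / v - (if n = 0 then 1 / v else 0)) sums
     (1 / (1 - w / v) / v + 1 / (1 - inverse w / v) / v - 1 / v)"
    using a b by (intro sums_diff sums_add sums_divide geometric_sums sums_single)
  moreover have "(w / v) ^ n / v + (inverse w / v) ^ n / v - (if n = 0 then 1 / v else 0) = EL n w / v ^ Suc n" for n
    using w0 by (simp add: EL_def power_divide add_divide_distrib mult.commute)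
  moreover have "1 / (1 - w / v) / v = 1 / (v - w)" "1 / (1 - inverse w / v) / v = 1 / (v - inverse w)"
    using w0 ne by (simp_all add: field_simps)
  ultimately show ?thesis by simp
qed

lemma Jou_log_deriv:
  assumes "v \<noteq> 0" "w \<noteq> 0" "v \<noteq> w" "v \<noteq> inverse w"
  shows "1 / (v - w) + 1 / (v - inverse w) - 1 / v = Jou' v / (Jou v - Jou w)"
proof -
  have wi: "v * w \<noteq> 1" using assms by (metis inverse_unique inverse_inverse_eq mult.commute)
  have e: "Jou v - Jou w = (v - w) * (v - inverse w) / (2 * v)"
    using assms by (simp add: Jou_def field_simps)
  have ne: "v - inverse w \<noteq> 0" "v - w \<noteq> 0" using assms by auto
  have "(1 - inverse (v\<^sup>2)) / 2 / (p * q / (2 * v)) = (v\<^sup>2 - 1) / (v * (p * q))"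
    if "p \<noteq> 0" "q \<noteq> 0" for p q using assms(1) that by (simp add: field_simps power2_eq_square)
  from this[OF ne(2,1)] have "Jou' v / (Jou v - Jou w) = (v\<^sup>2 - 1) / (v * ((v - w) * (v - inverse w)))"
    unfolding e Jou'_def .
  moreover have "1 / (v - w) + 1 / (v - inverse w) - 1 / v = (v\<^sup>2 - w * inverse w) / (v * ((v - w) * (v - inverse w)))"
  proof -
    have "1 / (v - w) + 1 / (v - u) - 1 / v = (v\<^sup>2 - w * u) / (v * ((v - w) * (v - u)))"
      if "v - u \<noteq> 0" "v - w \<noteq> 0" for u
      using that assms(1) by (simp add: divide_simps) (simp add: algebra_simps power2_eq_square)
    from this[OF ne] show ?thesis .
  qed
  ultimately show ?thesis using assms(2) by simp
qed

text \<open>The Chebyshev coefficients, that is, the coefficients of \<open>v\<^sup>n\<close> in the Laurent series of \<open>F (Jou v)\<close>.\<close>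

definition cheb :: "real \<Rightarrow> (complex \<Rightarrow> complex) \<Rightarrow> nat \<Rightarrow> complex" where
  "cheb r F n = contour_integral (circlepath 0 r) (\<lambda>v. F (Jou v) / v ^ Suc n) / (2 * of_real pi * \<i>)"

lemma Jou_holomorphic: "0 \<notin> S \<Longrightarrow> Jou holomorphic_on S"
  unfolding Jou_def[abs_def] by (intro holomorphic_intros) auto

lemma cheb_integrand_holomorphic:
  assumes \<rho>: "1 < \<rho>" and F: "F holomorphic_on open_ellipse \<rho>"
  shows "(\<lambda>v. F (Jou v) / v ^ Suc n) holomorphic_on {v. 1 / \<rho> < cmod v \<and> cmod v < \<rho>}"
proof -
  have z: "0 \<notin> {v. 1 / \<rho> < cmod v \<and> cmod v < \<rho>}" using \<rho> by (auto simp: divide_less_0_iff)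
  have "(F \<circ> Jou) holomorphic_on {v. 1 / \<rho> < cmod v \<and> cmod v < \<rho>}"
    using Jou_open_ellipse[OF \<rho>] by (intro holomorphic_on_compose_gen[OF Jou_holomorphic[OF z] F]) auto
  then show ?thesis using z by (auto simp: o_def intro!: holomorphic_intros)
qed

lemma annulus_open: "open {v::complex. a < cmod v \<and> cmod v < c}"
  by (intro open_Collect_conj open_Collect_less continuous_intros)

lemma cheb_radius_independent:
  assumes \<rho>: "1 < \<rho>" and F: "F holomorphic_on open_ellipse \<rho>" and r: "1 \<le> r1" "r1 < \<rho>" "1 \<le> r2" "r2 < \<rho>"
  shows "cheb r1 F n = cheb r2 F n"
proof -
  let ?A = "{v::complex. 1 / \<rho> < cmod v \<and> cmod v < \<rho>}"
  have "homotopic_loops ?A (circlepath 0 r1) (circlepath 0 r2)"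
  proof (rule homotopic_loops_linear)
    fix t x :: real assume "t \<in> {0..1}"
    show "closed_segment (circlepath 0 r1 t) (circlepath 0 r2 t) \<subseteq> ?A"
    proof
      fix z assume "z \<in> closed_segment (circlepath 0 r1 t) (circlepath 0 r2 t)"
      then obtain u where u: "0 \<le> u" "u \<le> 1" "z = (1 - u) *\<^sub>R circlepath 0 r1 t + u *\<^sub>R circlepath 0 r2 t"
        by (auto simp: closed_segment_def)
      have "z = of_real ((1 - u) * r1 + u * r2) * exp (2 * of_real pi * \<i> * of_real t)"
        unfolding u(3) circlepath by (simp add: scaleR_conv_of_real algebra_simps)
      then have "cmod z = \<bar>(1 - u) * r1 + u * r2\<bar>" by (simp only: norm_mult norm_of_real) simp
      moreover have "1 \<le> (1 - u) * r1 + u * r2"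
        using convex_bound_le[of "-r1" "-1" "-r2" "1 - u" u] u r by simp
      moreover have "(1 - u) * r1 + u * r2 < \<rho>"
        using convex_bound_lt[of r1 \<rho> r2 "1 - u" u] u r by simp
      moreover have "1 / \<rho> < 1" using \<rho> by simp
      ultimately have "1 / \<rho> < cmod z" "cmod z < \<rho>" by linarith+
      then show "z \<in> ?A" by simp
    qed
  qed auto
  from Cauchy_theorem_homotopic_loops[OF this annulus_open cheb_integrand_holomorphic[OF \<rho> F]]
  have "contour_integral (circlepath 0 r1) (\<lambda>v. F (Jou v) / v ^ Suc n) = contour_integral (circlepath 0 r2) (\<lambda>v. F (Jou v) / v ^ Suc n)"
    by simp
  then show ?thesis by (simp only: cheb_def)
qed

lemma cheb_bound:
  assumes r: "r \<ge> 1" and c: "continuous_on (sphere 0 r) (\<lambda>v. F (Jou v))"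
    and M: "\<And>v. cmod v = r \<Longrightarrow> cmod (F (Jou v)) \<le> M"
  shows "cmod (cheb r F n) \<le> M / r ^ n"
proof -
  let ?g = "\<lambda>v. F (Jou v) / v ^ Suc n"
  have M0: "M \<ge> 0" using M[of "of_real r"] r norm_ge_zero order_trans by (metis norm_of_real abs_of_nonneg le_numeral_extra(1))
  have "continuous_on (path_image (circlepath 0 r)) ?g"
    using r c by (intro continuous_intros) auto
  then have "(?g has_contour_integral contour_integral (circlepath 0 r) ?g) (circlepath 0 r)"
    by (intro has_contour_integral_integral contour_integrable_continuous_circlepath)
  then have "cmod (contour_integral (circlepath 0 r) ?g) \<le> (M / r ^ Suc n) * (2 * pi * r)"
  proof (rule has_contour_integral_bound_circlepath)
    fix v :: complex assume "cmod (v - 0) = r"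
    then have v: "cmod v = r" by simp
    show "cmod (?g v) \<le> M / r ^ Suc n"
      unfolding norm_divide norm_power v using M[OF v] r by (intro divide_right_mono) auto
  qed (use M0 r in auto)
  then have "cmod (cheb r F n) \<le> (M / r ^ Suc n) * (2 * pi * r) / (2 * pi)"
    unfolding cheb_def norm_divide by (simp add: norm_mult divide_right_mono)
  also have "\<dots> = M / r ^ n" using r by simp
  finally show ?thesis .
qed

lemma EL_norm:
  assumes "1 \<le> cmod w" shows "cmod (EL n w) \<le> 2 * cmod w ^ n"
proof (cases "n = 0")
  case False
  have "cmod (EL n w) \<le> cmod w ^ n + cmod (inverse w) ^ n"
    using False norm_triangle_ineq[of "w ^ n" "inverse w ^ n"] by (simp add: EL_def norm_power)
  moreover have "cmod (inverse w) \<le> cmod w"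
    using assms by (simp add: norm_inverse) (meson inverse_le_1_iff order_trans)
  then have "cmod (inverse w) ^ n \<le> cmod w ^ n" by (intro power_mono) auto
  ultimately show ?thesis by simp
qed (simp add: EL_def)

text \<open>The value \<open>F (Jou w)\<close> is subtracted from \<open>F\<close>: the quotient \<open>g\<close> of differences has a primitive \<open>G\<close> on the convex
  open ellipse, so \<open>g (Jou v) Jou' v\<close> integrates to \<open>0\<close>, and the subtracted term contributes \<open>1 + 1 - 1\<close> times
  \<open>2 \<pi> \<i> F (Jou w)\<close>.\<close>

lemma Cauchy_ellipse:
  assumes \<rho>: "1 < \<rho>" and F: "F holomorphic_on open_ellipse \<rho>" and r: "1 < r" "r < \<rho>"
    and w: "1 \<le> cmod w" "cmod w < r"
  shows "((\<lambda>v. F (Jou v) * (1 / (v - w) + 1 / (v - inverse w) - 1 / v)) has_contour_integral 2 * of_real pi * \<i> * F (Jou w)) (circlepath 0 r)"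
proof -
  define a where "a = Jou w"
  have w0: "w \<noteq> 0" using w by auto
  have iw: "cmod (inverse w) \<le> 1" using w(1) by (simp add: norm_inverse inverse_le_1_iff)
  have iwr: "cmod (inverse w) < r" using iw r by simp
  let ?A = "{v::complex. 1 / \<rho> < cmod v \<and> cmod v < \<rho>}"
  define g where "g z = (if z = a then deriv F a else (F z - F a) / (z - a))" for z
  have g: "g holomorphic_on open_ellipse \<rho>"
    unfolding g_def[abs_def] by (rule pole_lemma_open[OF F open_open_ellipse])
  obtain G where G: "\<And>z. z \<in> open_ellipse \<rho> \<Longrightarrow> (G has_field_derivative g z) (at z within open_ellipse \<rho>)"
    using holomorphic_convex_primitive'[OF convex_open_ellipse open_open_ellipse g] by blast
  have GJ: "((\<lambda>v. G (Jou v)) has_field_derivative g (Jou v) * Jou' v) (at v within ?A)" if v: "v \<in> ?A" for v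
  proof -
    have "Jou v \<in> open_ellipse \<rho>" using Jou_open_ellipse[OF \<rho>] v by auto
    then have "(G has_field_derivative g (Jou v)) (at (Jou v))"
      using G at_within_open[OF _ open_open_ellipse] by metis
    moreover have "v \<noteq> 0" using v \<rho> by (auto simp: divide_less_0_iff)
    ultimately have "((\<lambda>v. G (Jou v)) has_field_derivative g (Jou v) * Jou' v) (at v)"
      using DERIV_chain2 Jou_deriv by blast
    then show ?thesis by (rule has_field_derivative_at_within)
  qed
  have "1 / \<rho> < 1" using \<rho> by simp
  then have "1 / \<rho> < r" using r by linarith
  then have "path_image (circlepath 0 r) \<subseteq> ?A" using r by auto
  then have "((\<lambda>v. g (Jou v) * Jou' v) has_contour_integral
      G (Jou (pathfinish (circlepath 0 r))) - G (Jou (pathstart (circlepath 0 r)))) (circlepath 0 r)"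
    by (intro contour_integral_primitive[OF GJ]) auto
  then have i1: "((\<lambda>v. g (Jou v) * Jou' v) has_contour_integral 0) (circlepath 0 r)" by simp
  have c: "((\<lambda>v. 1 / (v - p)) has_contour_integral 2 * of_real pi * \<i> * 1) (circlepath 0 r)" if "cmod p < r" for p
    using Cauchy_integral_circlepath_simple[of "\<lambda>_. 1" 0 r p] that by simp
  have i2: "((\<lambda>v. F a * ((1 / (v - w) + 1 / (v - inverse w)) - 1 / (v - 0))) has_contour_integral
     F a * ((2 * of_real pi * \<i> * 1 + 2 * of_real pi * \<i> * 1) - 2 * of_real pi * \<i> * 1)) (circlepath 0 r)"
    using w iwr r by (intro has_contour_integral_lmul has_contour_integral_diff has_contour_integral_add c) auto
  have i3: "((\<lambda>v. g (Jou v) * Jou' v + F a * ((1 / (v - w) + 1 / (v - inverse w)) - 1 / (v - 0))) has_contour_integral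
     0 + F a * ((2 * of_real pi * \<i> * 1 + 2 * of_real pi * \<i> * 1) - 2 * of_real pi * \<i> * 1)) (circlepath 0 r)"
    by (rule has_contour_integral_add[OF i1 i2])
  have "((\<lambda>v. F (Jou v) * (1 / (v - w) + 1 / (v - inverse w) - 1 / v)) has_contour_integral
      0 + F a * ((2 * of_real pi * \<i> * 1 + 2 * of_real pi * \<i> * 1) - 2 * of_real pi * \<i> * 1)) (circlepath 0 r)"
  proof (rule has_contour_integral_eq[OF i3])
    fix v assume "v \<in> path_image (circlepath 0 r)"
    then have v: "cmod v = r" using r by simp
    have ne: "v \<noteq> 0" "v \<noteq> w" "v \<noteq> inverse w" using v w iwr r by auto
    have l: "1 / (v - w) + 1 / (v - inverse w) - 1 / v = Jou' v / (Jou v - a)"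
      unfolding a_def by (rule Jou_log_deriv) (use ne w0 in auto)
    have "Jou v - Jou w = (v - w) * (v - inverse w) / (2 * v)"
      using ne w0 by (simp add: Jou_def field_simps)
    then have "Jou v - a \<noteq> 0" using ne unfolding a_def by simp
    then have "g (Jou v) * Jou' v + F a * (Jou' v / (Jou v - a)) = F (Jou v) * (Jou' v / (Jou v - a))"
      by (simp add: g_def divide_simps) (simp add: algebra_simps)
    then show "g (Jou v) * Jou' v + F a * ((1 / (v - w) + 1 / (v - inverse w)) - 1 / (v - 0)) = F (Jou v) * (1 / (v - w) + 1 / (v - inverse w) - 1 / v)"
      unfolding l by (simp add: l)
  qed
  then show ?thesis by (simp add: a_def mult_ac)
qed

lemma cheb_sums:
  assumes \<rho>: "1 < \<rho>" and F: "F holomorphic_on open_ellipse \<rho>" and r: "1 < r" "r < \<rho>"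
    and w: "1 \<le> cmod w" "cmod w < r"
  shows "(\<lambda>n. cheb r F n * EL n w) sums F (Jou w)"
proof -
  let ?g = "\<lambda>n v. F (Jou v) / v ^ Suc n * EL n w"
  let ?l = "\<lambda>v. F (Jou v) * (1 / (v - w) + 1 / (v - inverse w) - 1 / v)"
  have sub: "sphere 0 r \<subseteq> {v. 1 / \<rho> < cmod v \<and> cmod v < \<rho>}"
  proof -
    have "1 / \<rho> < 1" using \<rho> by simp
    then have "1 / \<rho> < r" using r by linarith
    then show ?thesis using r by auto
  qed
  have hol: "(\<lambda>v. F (Jou v) / v ^ Suc n) holomorphic_on sphere 0 r" for n
    using cheb_integrand_holomorphic[OF \<rho> F] sub by (rule holomorphic_on_subset)
  have "(F \<circ> Jou) holomorphic_on sphere 0 r"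
    using r sub Jou_open_ellipse[OF \<rho>] by (intro holomorphic_on_compose_gen[OF Jou_holomorphic F]) auto
  then have cF: "continuous_on (sphere 0 r) (\<lambda>v. F (Jou v))" by (simp add: holomorphic_on_imp_continuous_on o_def)
  then have "bounded ((\<lambda>v. F (Jou v)) ` sphere 0 r)" by (intro compact_imp_bounded compact_continuous_image) auto
  then obtain M where M: "\<And>v. v \<in> sphere 0 r \<Longrightarrow> cmod (F (Jou v)) \<le> M" "M > 0"
    by (metis bounded_pos imageI)
  have ci: "(\<lambda>v. F (Jou v) / v ^ Suc n) contour_integrable_on circlepath 0 r" for n
    using hol r by (intro contour_integrable_continuous_circlepath holomorphic_on_imp_continuous_on) auto
  have lim: "uniform_limit (sphere 0 r) (\<lambda>N v. \<Sum>n<N. ?g n v) (\<lambda>v. suminf (\<lambda>n. ?g n v)) sequentially"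
  proof (rule Weierstrass_m_test)
    show "summable (\<lambda>n. (2 * M / r) * (cmod w / r) ^ n)"
      using w r by (intro summable_mult summable_geometric) auto
    fix n and v :: complex assume v: "v \<in> sphere 0 r"
    then have nv: "cmod v = r" by simp
    have "cmod (?g n v) \<le> (M / r ^ Suc n) * (2 * cmod w ^ n)"
      unfolding norm_mult norm_divide norm_power nv
      using M(1)[OF v] M(2) r w by (intro mult_mono divide_right_mono EL_norm) auto
    then show "cmod (?g n v) \<le> (2 * M / r) * (cmod w / r) ^ n" by (simp add: power_divide mult_ac)
  qed
  have l: "suminf (\<lambda>n. ?g n v) = ?l v" if v: "v \<in> sphere 0 r" for v
  proof -
    have "(\<lambda>n. F (Jou v) * (EL n w / v ^ Suc n)) sums ?l v"
      using v w by (intro sums_mult EL_sums) auto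
    then show ?thesis by (simp add: sums_iff mult_ac)
  qed
  have lim2: "uniform_limit (sphere 0 r) (\<lambda>N v. \<Sum>n<N. ?g n v) ?l sequentially"
    using lim by (rule uniform_limit_cong'[THEN iffD1, rotated -1]) (simp_all only: l)
  have cif: "(\<lambda>v. \<Sum>n<N. ?g n v) contour_integrable_on circlepath 0 r" for N
    by (intro contour_integrable_sum contour_integrable_rmul ci) auto
  have "(\<lambda>N. contour_integral (circlepath 0 r) (\<lambda>v. \<Sum>n<N. ?g n v)) \<longlonglongrightarrow> contour_integral (circlepath 0 r) ?l"
    using cif lim2 r by (intro contour_integral_uniform_limit_circlepath(2)) auto
  moreover have "contour_integral (circlepath 0 r) ?l = 2 * of_real pi * \<i> * F (Jou w)"
    by (rule contour_integral_unique[OF Cauchy_ellipse[OF \<rho> F r w]])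
  moreover have "contour_integral (circlepath 0 r) (\<lambda>v. \<Sum>n<N. ?g n v) = 2 * of_real pi * \<i> * (\<Sum>n<N. cheb r F n * EL n w)" for N
  proof -
    have "contour_integral (circlepath 0 r) (\<lambda>v. \<Sum>n<N. ?g n v) = (\<Sum>n<N. contour_integral (circlepath 0 r) (?g n))"
      by (intro contour_integral_sum contour_integrable_rmul ci) auto
    also have "\<dots> = (\<Sum>n<N. contour_integral (circlepath 0 r) (\<lambda>v. F (Jou v) / v ^ Suc n) * EL n w)"
      by (intro sum.cong refl contour_integral_rmul ci)
    also have "\<dots> = 2 * of_real pi * \<i> * (\<Sum>n<N. cheb r F n * EL n w)"
      unfolding sum_distrib_left by (intro sum.cong refl) (simp add: cheb_def)
    finally show ?thesis .
  qed
  ultimately have "(\<lambda>N. 2 * of_real pi * \<i> * (\<Sum>n<N. cheb r F n * EL n w)) \<longlonglongrightarrow> 2 * of_real pi * \<i> * F (Jou w)" by simp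
  then have "(\<lambda>N. (2 * of_real pi * \<i> * (\<Sum>n<N. cheb r F n * EL n w)) / (2 * of_real pi * \<i>)) \<longlonglongrightarrow> 2 * of_real pi * \<i> * F (Jou w) / (2 * of_real pi * \<i>)"
    by (intro tendsto_divide tendsto_const) auto
  then show ?thesis by (simp add: sums_def)
qed

text \<open>The faster decay in the first claim depends on \<open>f\<close>; it serves for convergence near the boundary, while the bound
  by the norm is used for continuity.\<close>

lemma A_space_cheb:
  assumes \<rho>: "1 < \<rho>" and f: "f \<in> A_space \<rho>"
  shows "\<exists>\<rho>'>\<rho>. \<exists>K. \<forall>n. cmod (cheb \<rho> f n) \<le> K / \<rho>' ^ n"
    and "1 \<le> cmod w \<Longrightarrow> cmod w \<le> \<rho> \<Longrightarrow> (\<lambda>n. cheb \<rho> f n * EL n w) sums f (Jou w)"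
    and "cmod (cheb \<rho> f n) \<le> A_norm \<rho> f / \<rho> ^ n"
    and "(\<lambda>v. f (Jou v) / v ^ Suc n) contour_integrable_on circlepath 0 \<rho>"
proof -
  obtain F where F: "F analytic_on bernstein_region \<rho>" "\<And>z. z \<in> bernstein_region \<rho> \<Longrightarrow> f z = F z"
    using f by (auto simp: A_space_def)
  obtain \<rho>1 where \<rho>1: "\<rho>1 > \<rho>" "F holomorphic_on open_ellipse \<rho>1" using analytic_on_larger_ellipse[OF \<rho> F(1)] by blast
  define r where "r = (\<rho> + \<rho>1) / 2"
  have r: "\<rho> < r" "r < \<rho>1" "1 < \<rho>1" using \<rho>1(1) \<rho> by (simp_all add: r_def)
  have reg: "Jou v \<in> bernstein_region \<rho>" if "cmod v = \<rho>" for v using Jou_region[of \<rho> v] that \<rho> by simp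
  have eq: "cheb \<rho> f n = cheb \<rho> F n" for n
    unfolding cheb_def using \<rho> by (intro arg_cong2[of _ _ _ _ "(/)"] contour_integral_cong) (auto simp: F(2) reg)
  have eq2: "cheb \<rho> F n = cheb r F n" for n
    using r \<rho> by (intro cheb_radius_independent[OF r(3) \<rho>1(2)]) auto
  have cont: "continuous_on (sphere 0 t) (\<lambda>v. F (Jou v))" if t: "1 \<le> t" "t < \<rho>1" for t
  proof -
    have "1 / \<rho>1 < 1" using r by simp
    then have "1 / \<rho>1 < t" using t by linarith
    then have "(F \<circ> Jou) holomorphic_on sphere 0 t"
      using t Jou_open_ellipse[OF r(3)] by (intro holomorphic_on_compose_gen[OF Jou_holomorphic \<rho>1(2)]) auto
    then show ?thesis by (simp add: holomorphic_on_imp_continuous_on o_def)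
  qed
  have "bounded ((\<lambda>v. F (Jou v)) ` sphere 0 r)"
    using cont[of r] r \<rho> by (intro compact_imp_bounded compact_continuous_image) auto
  then obtain K where K: "\<And>v. v \<in> sphere 0 r \<Longrightarrow> cmod (F (Jou v)) \<le> K" by (metis bounded_pos imageI)
  have "cmod (cheb \<rho> f n) \<le> K / r ^ n" for n
    unfolding eq eq2 using cont[of r] K r \<rho> by (intro cheb_bound) auto
  then show "\<exists>\<rho>'>\<rho>. \<exists>K. \<forall>n. cmod (cheb \<rho> f n) \<le> K / \<rho>' ^ n" using r(1) by blast
  show "(\<lambda>n. cheb \<rho> f n * EL n w) sums f (Jou w)" if w: "1 \<le> cmod w" "cmod w \<le> \<rho>"
  proof -
    have "Jou w \<in> bernstein_region \<rho>" using Jou_region[of \<rho> w] w \<rho> by simp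
    then show ?thesis unfolding eq eq2 using r w \<rho> by (simp only: F(2)) (intro cheb_sums[OF r(3) \<rho>1(2)], auto)
  qed
  have "(\<lambda>_. 0) \<in> A_space \<rho>" by (auto simp: A_space_def intro!: exI[of _ "\<lambda>_. 0"])
  then have bdd: "bdd_above ((\<lambda>z. cmod (f z)) ` bernstein_region \<rho>)" using bdd_above_A_space[OF f, of "\<lambda>_. 0"] by simp
  show "cmod (cheb \<rho> f n) \<le> A_norm \<rho> f / \<rho> ^ n"
    unfolding eq
  proof (rule cheb_bound)
    show "cmod (F (Jou v)) \<le> A_norm \<rho> f" if "cmod v = \<rho>" for v
      unfolding A_norm_def using cSUP_upper[OF reg[OF that] bdd] F(2)[OF reg[OF that]] by simp
  qed (use \<rho> cont[of \<rho>] \<rho>1 in auto)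
  have "(\<lambda>v. F (Jou v) / v ^ Suc n) contour_integrable_on circlepath 0 \<rho>"
    using cont[of \<rho>] \<rho> \<rho>1(1) by (intro contour_integrable_continuous_circlepath continuous_intros) auto
  then show "(\<lambda>v. f (Jou v) / v ^ Suc n) contour_integrable_on circlepath 0 \<rho>"
    by (rule contour_integrable_eq) (use \<rho> F(2) reg in auto)
qed

lemma cheb_diff:
  assumes \<rho>: "1 < \<rho>" and f: "f \<in> A_space \<rho>" and g: "g \<in> A_space \<rho>"
  shows "cheb \<rho> (\<lambda>z. f z - g z) n = cheb \<rho> f n - cheb \<rho> g n"
  unfolding cheb_def diff_divide_distrib
  using A_space_cheb(4)[OF \<rho> f] A_space_cheb(4)[OF \<rho> g]
  by (simp add: contour_integral_diff del: power_Suc) (simp add: diff_divide_distrib)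

section \<open>The inverse on analytic functions\<close>

lemma open_ellipse_Jou:
  assumes "1 < \<rho>" "z \<in> open_ellipse \<rho>"
  shows "\<exists>w. 1 \<le> cmod w \<and> cmod w < \<rho> \<and> z = Jou w"
proof -
  obtain w where w: "1 \<le> cmod w" "z = Jou w" using Jou_surj by blast
  then have "w \<noteq> 0" by auto
  then have "cmod w + 1 / cmod w < \<rho> + 1 / \<rho>" using assms(2) by (simp add: w(2) open_ellipse_def Jou_norm_sum)
  then have "cmod w < \<rho>"
    using add_inverse_strict_mono[of \<rho> "cmod w"] assms(1) by (cases "cmod w" \<rho> rule: linorder_cases) auto
  then show ?thesis using w by blast
qed

lemma A_space_diff:
  assumes "f \<in> A_space \<rho>" "g \<in> A_space \<rho>" shows "(\<lambda>z. f z - g z) \<in> A_space \<rho>"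
proof -
  obtain F G where "F analytic_on bernstein_region \<rho>" "\<forall>z\<in>bernstein_region \<rho>. f z = F z"
     "G analytic_on bernstein_region \<rho>" "\<forall>z\<in>bernstein_region \<rho>. g z = G z"
    using assms by (auto simp: A_space_def)
  then have "(\<lambda>z. F z - G z) analytic_on bernstein_region \<rho> \<and> (\<forall>z\<in>bernstein_region \<rho>. f z - g z = F z - G z)"
    by (auto intro: analytic_on_diff)
  then show ?thesis using assms unfolding A_space_def by auto
qed

lemma norm_le_A_norm:
  assumes f: "f \<in> A_space \<rho>" and z: "z \<in> bernstein_region \<rho>"
  shows "cmod (f z) \<le> A_norm \<rho> f"
proof -
  have "(\<lambda>_. 0) \<in> A_space \<rho>" by (auto simp: A_space_def intro!: exI[of _ "\<lambda>_. 0"])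
  then have "bdd_above ((\<lambda>z. cmod (f z)) ` bernstein_region \<rho>)" using bdd_above_A_space[OF f, of "\<lambda>_. 0"] by simp
  then show ?thesis unfolding A_norm_def by (rule cSUP_upper[OF z])
qed

text \<open>The polynomials \<open>Dpol\<close> and \<open>Epol\<close> at complex arguments.\<close>

fun Dc :: "nat \<Rightarrow> complex \<Rightarrow> complex" where
  "Dc 0 z = 2"
| "Dc (Suc 0) z = 2 * z"
| "Dc (Suc (Suc n)) z = 2 * z * Dc (Suc n) z - Dc n z"

definition Ec :: "nat \<Rightarrow> complex \<Rightarrow> complex" where "Ec n z = (if n = 0 then 1 else Dc n z)"

lemma Dc_Jou: "w \<noteq> 0 \<Longrightarrow> Dc n (Jou w) = w ^ n + inverse w ^ n"
proof (induction n rule: Dpol.induct)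
  case (3 n)
  have "(p + q) * (p * p ^ n + q * q ^ n) - (p ^ n + q ^ n) = p * (p * p ^ n) + q * (q * q ^ n)"
    if "p * q = 1" for p q :: complex
  proof -
    have e: "p * (q * x) = x" "q * (p * x) = x" for x
      using that by (simp_all add: mult.assoc[symmetric] mult.commute[of q p])
    show ?thesis by (simp only: distrib_left distrib_right e) simp
  qed
  moreover have "2 * Jou w = w + inverse w" by (simp add: Jou_def)
  ultimately show ?case using 3 by simp
qed (simp_all add: Jou_def)

lemma Ec_Jou: "w \<noteq> 0 \<Longrightarrow> Ec n (Jou w) = EL n w"
  by (simp add: Ec_def EL_def Dc_Jou)

lemma Dc_of_real: "Dc n (complex_of_real x) = complex_of_real (poly (Dpol n) x)"
  by (induction n rule: Dpol.induct) simp_all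

lemma Ec_of_real: "Ec n (complex_of_real x) = complex_of_real (poly (Epol n) x)"
  by (simp add: Ec_def Epol_def Dc_of_real)

lemma Dc_holomorphic: "Dc n holomorphic_on S"
  by (induction n rule: Dpol.induct) (auto intro!: holomorphic_intros simp: Dc.simps[abs_def])

lemma Ec_holomorphic: "Ec n holomorphic_on S"
  using Dc_holomorphic by (cases "n = 0") (simp_all add: Ec_def[abs_def])

context fractional_order
begin

text \<open>Up to the factor \<open>2s\<close>, which normalises the measure \<open>(1 - t) powr (2s - 1) dt\<close> on \<open>[0, 1]\<close>, the moments are
  Beta integrals.\<close>

lemma inv_gam_integral: "((\<lambda>t. t ^ n * (1 - t) powr (2 * s - 1)) has_integral 1 / (2 * s * gam n)) {0..1}"
proof -
  have "((\<lambda>t. t powr (real (Suc n) - 1) * (1 - t) powr (2 * s - 1)) has_integral Beta (real (Suc n)) (2 * s)) {0..1}"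
    using s_pos by (intro has_integral_Beta_real) auto
  moreover have "Beta (real (Suc n)) (2 * s) = 1 / (2 * s * gam n)"
  proof -
    have np: "x \<notin> \<int>\<^sub>\<le>\<^sub>0" if "x > 0" for x :: real
      using that by (metis nonpos_Ints_nonpos not_le)
    have g: "gam n = Gamma (1 + 2 * s + real n) / Gamma (1 + 2 * s) / fact n"
      unfolding gam_def using s_pos by (subst pochhammer_Gamma[OF np]) auto
    have "Gamma (1 + 2 * s) = 2 * s * Gamma (2 * s)"
      using s_pos Gamma_plus1[OF np, of "2 * s"] by (simp add: add.commute)
    moreover have "Gamma (real (Suc n)) = fact n" using Gamma_fact[of n, where 'a = real] by (simp add: add.commute)
    moreover have "Gamma (2 * s) > 0" "Gamma (1 + 2 * s + real n) > 0" using s_pos by (auto intro!: Gamma_real_pos)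
    moreover have "real (Suc n) + 2 * s = 1 + 2 * s + real n" by simp
    ultimately show ?thesis using s_pos unfolding Beta_def g by (simp only:) (simp add: field_simps)
  qed
  ultimately have "((\<lambda>t. t powr (real (Suc n) - 1) * (1 - t) powr (2 * s - 1)) has_integral 1 / (2 * s * gam n)) {0..1}" by simp
  then show ?thesis
    by (rule has_integral_spike_finite[rotated 2, of _ _ _ "{0}"]) (auto simp: powr_realpow)
qed

lemma gam_multiplier_finite:
  assumes M: "\<And>t. 0 \<le> t \<Longrightarrow> t \<le> 1 \<Longrightarrow> cmod (\<Sum>n<N. a n * complex_of_real t ^ n) \<le> M"
  shows "cmod (\<Sum>n<N. a n / complex_of_real (gam n)) \<le> M"
proof -
  let ?w = "\<lambda>t. (1 - t) powr (2 * s - 1)"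
  let ?f = "\<lambda>t. \<Sum>n<N. complex_of_real (t ^ n * ?w t) * a n"
  have f: "(?f has_integral (\<Sum>n<N. complex_of_real (1 / (2 * s * gam n)) * a n)) {0..1}"
    using has_integral_linear[OF inv_gam_integral bounded_linear_of_real[where 'a = complex], unfolded o_def]
    by (intro has_integral_sum has_integral_mult_left) auto
  have w: "(?w has_integral 1 / (2 * s)) {0..1}" using inv_gam_integral[of 0] by (simp add: gam_0)
  have g: "((\<lambda>t. ?w t * M) has_integral 1 / (2 * s) * M) {0..1}" by (rule has_integral_mult_left[OF w])
  have "cmod (integral {0..1} ?f) \<le> integral {0..1} (\<lambda>t. ?w t * M)"
  proof (rule integral_norm_bound_integral)
    fix t :: real assume t: "t \<in> {0..1}"
    have "?f t = complex_of_real (?w t) * (\<Sum>n<N. a n * complex_of_real t ^ n)"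
      by (simp add: sum_distrib_left sum_distrib_right mult_ac)
    then have "cmod (?f t) = ?w t * cmod (\<Sum>n<N. a n * complex_of_real t ^ n)"
      by (simp only: norm_mult norm_of_real) simp
    also have "\<dots> \<le> ?w t * M" using M[of t] t by (intro mult_left_mono) auto
    finally show "cmod (?f t) \<le> ?w t * M" .
  qed (use f g in auto)
  then have "cmod (\<Sum>n<N. complex_of_real (1 / (2 * s * gam n)) * a n) \<le> 1 / (2 * s) * M"
    unfolding integral_unique[OF f] integral_unique[OF g] .
  moreover have "(\<Sum>n<N. complex_of_real (1 / (2 * s * gam n)) * a n) = complex_of_real (1 / (2 * s)) * (\<Sum>n<N. a n / complex_of_real (gam n))"
    by (simp add: sum_distrib_left field_simps)
  ultimately have "1 / (2 * s) * cmod (\<Sum>n<N. a n / complex_of_real (gam n)) \<le> 1 / (2 * s) * M"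
    using s_pos by (simp only: norm_mult norm_of_real) simp
  then show ?thesis using s_pos by (simp add: divide_le_cancel)
qed

lemma gam_ge_1: "1 \<le> gam n" using gam_mono[of 0 n] by (simp add: gam_0)

lemma summable_div_gam: "summable (\<lambda>n. cmod (a n)) \<Longrightarrow> summable (\<lambda>n. a n / complex_of_real (gam n))"
proof (rule summable_comparison_test')
  fix n
  have "cmod (a n) * 1 \<le> cmod (a n) * gam n" using gam_ge_1 by (intro mult_left_mono) auto
  then show "cmod (a n / complex_of_real (gam n)) \<le> cmod (a n)"
    using gam_pos[of n] by (simp add: norm_divide divide_le_eq)
qed

text \<open>Division of the coefficients by \<open>gam n\<close> averages the values of a power series on a radius.\<close>

lemma gam_multiplier:
  assumes a: "summable (\<lambda>n. cmod (a n))"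
    and M: "\<And>t. 0 \<le> t \<Longrightarrow> t \<le> 1 \<Longrightarrow> cmod (\<Sum>n. a n * complex_of_real t ^ n) \<le> M"
  shows "cmod (\<Sum>n. a n / complex_of_real (gam n)) \<le> M"
proof -
  \<comment> \<open>the partial sums exceed the bound for the full series by at most this tail\<close>
  define tail where "tail N = (\<Sum>n. cmod (a n)) - (\<Sum>n<N. cmod (a n))" for N
  have p: "cmod (\<Sum>n<N. a n / complex_of_real (gam n)) \<le> M + tail N" for N
  proof (rule gam_multiplier_finite)
    fix t :: real assume t: "0 \<le> t" "t \<le> 1"
    have le: "cmod (a n * complex_of_real t ^ n) \<le> cmod (a n)" for n
      using t by (simp add: norm_mult norm_power mult_left_le power_le_one)
    have sn: "summable (\<lambda>n. cmod (a n * complex_of_real t ^ n))"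
      by (rule summable_comparison_test'[OF a]) (use le in simp)
    have sm: "summable (\<lambda>n. a n * complex_of_real t ^ n)"
      using sn by (rule summable_norm_cancel)
    have e: "(\<Sum>n<N. a n * complex_of_real t ^ n) = (\<Sum>n. a n * complex_of_real t ^ n) - (\<Sum>n. a (n + N) * complex_of_real t ^ (n + N))"
      using suminf_split_initial_segment[OF sm, of N] by simp
    have "cmod (\<Sum>n. a (n + N) * complex_of_real t ^ (n + N)) \<le> (\<Sum>n. cmod (a (n + N) * complex_of_real t ^ (n + N)))"
      using sn by (intro summable_norm) (simp add: summable_iff_shift[of "\<lambda>n. cmod (a n * complex_of_real t ^ n)"])
    also have "\<dots> \<le> (\<Sum>n. cmod (a (n + N)))"
      using le sn a by (intro suminf_le) (simp_all only: summable_iff_shift[of "\<lambda>n. cmod (a n * complex_of_real t ^ n)"] summable_iff_shift[of "\<lambda>n. cmod (a n)"])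
    also have "\<dots> = tail N" using suminf_split_initial_segment[OF a, of N] by (simp add: tail_def)
    finally show "cmod (\<Sum>n<N. a n * complex_of_real t ^ n) \<le> M + tail N"
      unfolding e by (intro order_trans[OF norm_triangle_ineq4] add_mono M t)
  qed
  have "(\<lambda>N. M + tail N) \<longlonglongrightarrow> M + ((\<Sum>n. cmod (a n)) - (\<Sum>n. cmod (a n)))"
    unfolding tail_def by (intro tendsto_intros summable_LIMSEQ a)
  moreover have "(\<lambda>N. cmod (\<Sum>n<N. a n / complex_of_real (gam n))) \<longlonglongrightarrow> cmod (\<Sum>n. a n / complex_of_real (gam n))"
    by (intro tendsto_norm summable_LIMSEQ summable_div_gam a)
  ultimately show ?thesis using p LIMSEQ_le by fastforce
qed

text \<open>The polynomials \<open>Qpol\<close> at complex arguments.\<close>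

definition Qc :: "nat \<Rightarrow> complex \<Rightarrow> complex" where
  "Qc n z = (\<Sum>k\<le>n div 2. complex_of_real (qc n k) * Ec (n - 2 * k) z)"

lemma Qc_of_real: "Qc n (complex_of_real x) = complex_of_real (poly (Qpol n) x)"
  by (simp add: Qc_def Qpol_def Ec_of_real poly_sum)

lemma Qc_holomorphic: "Qc n holomorphic_on S"
  unfolding Qc_def[abs_def] by (intro holomorphic_intros Ec_holomorphic)

text \<open>The size, relative to \<open>R\<^sup>n\<close>, of the lower order terms of \<open>Qc n\<close>.\<close>

definition dgam :: "nat \<Rightarrow> real" where "dgam n = 1 / ((real n + 1) * gam n)"

lemma dgam_nonneg: "0 \<le> dgam n" using gam_pos[of n] by (simp add: dgam_def)

lemma summable_dgam: "summable dgam"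
proof -
  obtain c where c: "c > 0" "\<And>n. c * (real n + 1) powr (2 * s) \<le> gam n" using gam_lower by blast
  have "summable (\<lambda>n. real n powr (- 1 - 2 * s))" using s_pos by (subst summable_real_powr_iff) simp
  then have "summable (\<lambda>n. real (Suc n) powr (- 1 - 2 * s))" by (subst summable_Suc_iff)
  then have "summable (\<lambda>n. 1 / c * real (Suc n) powr (- 1 - 2 * s))" by (rule summable_mult)
  then show ?thesis
  proof (rule summable_comparison_test')
    fix n
    have "dgam n \<le> 1 / ((real n + 1) * (c * (real n + 1) powr (2 * s)))"
      unfolding dgam_def using c gam_pos[of n] by (intro divide_left_mono mult_left_mono mult_pos_pos) auto
    also have "\<dots> = 1 / c * real (Suc n) powr (- 1 - 2 * s)"
      using c(1) by (simp add: powr_diff powr_minus field_simps add.commute)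
    finally show "norm (dgam n) \<le> 1 / c * real (Suc n) powr (- 1 - 2 * s)" using dgam_nonneg[of n] by simp
  qed
qed

text \<open>On \<open>\<bar>w\<bar> \<le> R\<close> the term of degree \<open>n - 2k\<close> is of size \<open>R\<^sup>n / R powr 2k\<close>, which beats the growth \<open>\<rho>\<^sup>k\<close> allowed in
  \<open>qc_bound\<close>.\<close>

lemma Qc_tail_bound:
  assumes \<rho>: "1 < \<rho>"
  shows "\<exists>K\<ge>0. \<forall>n w R. 1 \<le> cmod w \<longrightarrow> cmod w \<le> R \<longrightarrow> \<rho> \<le> R \<longrightarrow>
     cmod (Qc n (Jou w) - EL n w / complex_of_real (ell0 * gam n)) \<le> K * (R ^ n * dgam n)"
proof -
  obtain C where C: "C > 0" "\<And>n k. 1 \<le> k \<Longrightarrow> 2 * k \<le> n \<Longrightarrow> \<bar>qc n k\<bar> \<le> C * ((2 * real k + 1) * \<rho> ^ k) / ((real n + 1) * gam n)"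
    using qc_bound[OF \<rho>] by blast
  define q where "q k = (2 * real k + 1) * (1 / \<rho>) ^ k" for k
  have q0: "q k \<ge> 0" for k using \<rho> by (simp add: q_def)
  have sq: "summable q"
  proof -
    have "summable (\<lambda>k. diffs (\<lambda>_. 1 :: real) k * (1 / \<rho>) ^ k)"
      using \<rho> by (intro termdiff_converges[of "1 / \<rho>" 1]) (auto intro!: summable_geometric)
    then have "summable (\<lambda>k. 2 * (diffs (\<lambda>_. 1 :: real) k * (1 / \<rho>) ^ k) - (1 / \<rho>) ^ k)"
      using \<rho> by (intro summable_diff summable_mult summable_geometric) auto
    moreover have "2 * (diffs (\<lambda>_. 1 :: real) k * (1 / \<rho>) ^ k) - (1 / \<rho>) ^ k = q k" for k
      by (simp add: diffs_def q_def algebra_simps)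
    ultimately show ?thesis by simp
  qed
  define S where "S = (\<Sum>k. q k)"
  have S0: "S \<ge> 0" unfolding S_def by (intro suminf_nonneg sq q0)
  have "cmod (Qc n (Jou w) - EL n w / complex_of_real (ell0 * gam n)) \<le> (2 * C * S) * (R ^ n * dgam n)"
    if w: "1 \<le> cmod w" and wR: "cmod w \<le> R" and R: "\<rho> \<le> R" for n w R
  proof -
    have w0: "w \<noteq> 0" using w by auto
    have R0: "R > 1" using R \<rho> by simp
    have "Qc n (Jou w) = complex_of_real (qc n 0) * EL n w + (\<Sum>k\<in>{1..n div 2}. complex_of_real (qc n k) * EL (n - 2 * k) w)"
      unfolding Qc_def using w0 by (simp add: Ec_Jou sum.atMost_shift atMost_atLeast0 sum.atLeast_Suc_atMost)
    then have "Qc n (Jou w) - EL n w / complex_of_real (ell0 * gam n) = (\<Sum>k\<in>{1..n div 2}. complex_of_real (qc n k) * EL (n - 2 * k) w)"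
      by (simp add: qc_0)
    also have "cmod \<dots> \<le> (\<Sum>k\<in>{1..n div 2}. (2 * C * (R ^ n * dgam n)) * q k)"
    proof (rule sum_norm_le)
      fix k assume "k \<in> {1..n div 2}"
      then have k: "1 \<le> k" "2 * k \<le> n" by auto
      have "cmod (EL (n - 2 * k) w) \<le> 2 * cmod w ^ (n - 2 * k)" by (rule EL_norm[OF w])
      also have "\<dots> \<le> 2 * R ^ (n - 2 * k)" using wR by (intro mult_left_mono power_mono) auto
      also have "\<dots> = 2 * (R ^ n * (1 / R\<^sup>2) ^ k)"
        using R0 k by (simp add: power_diff power_mult power_one_over divide_simps)
      finally have "cmod (EL (n - 2 * k) w) \<le> 2 * (R ^ n * (1 / R\<^sup>2) ^ k)" .
      then have "cmod (complex_of_real (qc n k) * EL (n - 2 * k) w) \<le> (C * ((2 * real k + 1) * \<rho> ^ k) / ((real n + 1) * gam n)) * (2 * (R ^ n * (1 / R\<^sup>2) ^ k))"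
        unfolding norm_mult norm_of_real using C(2)[OF k] R0 C(1) \<rho> gam_pos[of n] by (intro mult_mono) auto
      also have "\<dots> = (2 * C * (R ^ n * dgam n)) * ((2 * real k + 1) * (\<rho> * (1 / R\<^sup>2)) ^ k)"
        unfolding power_mult_distrib by (simp add: dgam_def)
      also have "\<dots> \<le> (2 * C * (R ^ n * dgam n)) * q k"
      proof -
        have "\<rho> * \<rho> \<le> R * R" using R \<rho> by (intro mult_mono) auto
        then have "\<rho> * (1 / R\<^sup>2) \<le> 1 / \<rho>" using R0 \<rho> by (simp add: power2_eq_square divide_simps)
        then show ?thesis unfolding q_def using R0 C(1) \<rho> dgam_nonneg[of n]
          by (intro mult_left_mono power_mono) auto
      qed
      finally show "cmod (complex_of_real (qc n k) * EL (n - 2 * k) w) \<le> (2 * C * (R ^ n * dgam n)) * q k" .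
    qed
    also have "\<dots> = (2 * C * (R ^ n * dgam n)) * (\<Sum>k\<in>{1..n div 2}. q k)" by (simp add: sum_distrib_left)
    also have "\<dots> \<le> (2 * C * (R ^ n * dgam n)) * S"
      unfolding S_def using C(1) R0 dgam_nonneg[of n] q0 by (intro mult_left_mono sum_le_suminf sq) auto
    finally show ?thesis by (simp add: mult_ac)
  qed
  moreover have "2 * C * S \<ge> 0" using C(1) S0 by simp
  ultimately show ?thesis by blast
qed

lemma Qc_bound:
  assumes \<rho>: "1 < \<rho>"
  shows "\<exists>K\<ge>0. \<forall>n w R. 1 \<le> cmod w \<longrightarrow> cmod w \<le> R \<longrightarrow> \<rho> \<le> R \<longrightarrow> cmod (Qc n (Jou w)) \<le> K * R ^ n"
proof -
  obtain K where K: "K \<ge> 0" "\<And>n w R. 1 \<le> cmod w \<Longrightarrow> cmod w \<le> R \<Longrightarrow> \<rho> \<le> R \<Longrightarrow>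
     cmod (Qc n (Jou w) - EL n w / complex_of_real (ell0 * gam n)) \<le> K * (R ^ n * dgam n)"
    using Qc_tail_bound[OF \<rho>] by blast
  have "cmod (Qc n (Jou w)) \<le> (K + 2 / \<bar>ell0\<bar>) * R ^ n" if w: "1 \<le> cmod w" "cmod w \<le> R" "\<rho> \<le> R" for n w R
  proof -
    have R0: "R > 1" using that \<rho> by simp
    have "(real n + 1) * gam n \<ge> 1 * 1" using gam_ge_1[of n] by (intro mult_mono) auto
    then have d: "dgam n \<le> 1" by (simp add: dgam_def divide_le_eq)
    have "K * (R ^ n * dgam n) \<le> K * (R ^ n * 1)" using d K(1) R0 by (intro mult_left_mono) auto
    moreover have "cmod (EL n w / complex_of_real (ell0 * gam n)) \<le> 2 / \<bar>ell0\<bar> * R ^ n"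
    proof -
      have "cmod (EL n w) \<le> 2 * R ^ n" using EL_norm[OF w(1), of n] power_mono[OF w(2), of n] by simp
      moreover have "\<bar>ell0\<bar> * 1 \<le> \<bar>ell0\<bar> * gam n" using gam_ge_1[of n] by (intro mult_left_mono) auto
      ultimately have "cmod (EL n w) / (\<bar>ell0\<bar> * gam n) \<le> 2 * R ^ n / \<bar>ell0\<bar>"
        using ell0_nonzero gam_pos[of n] R0 by (intro frac_le) auto
      then show ?thesis using gam_pos[of n] by (simp add: norm_divide norm_mult)
    qed
    moreover have "cmod (Qc n (Jou w)) \<le> cmod (Qc n (Jou w) - EL n w / complex_of_real (ell0 * gam n)) + cmod (EL n w / complex_of_real (ell0 * gam n))"
      using norm_triangle_sub by (metis add.commute)
    ultimately show ?thesis using K(2)[OF w, of n] by (simp add: algebra_simps)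
  qed
  moreover have "K + 2 / \<bar>ell0\<bar> \<ge> 0" using K(1) by simp
  ultimately show ?thesis by blast
qed

text \<open>The preimage of \<open>f\<close> under the operator.\<close>

definition Tser :: "real \<Rightarrow> (complex \<Rightarrow> complex) \<Rightarrow> complex \<Rightarrow> complex" where
  "Tser \<rho> f z = (\<Sum>n. cheb \<rho> f n * Qc n z)"

lemma Tser_majorant:
  assumes \<rho>: "1 < \<rho>" and f: "f \<in> A_space \<rho>"
  shows "\<exists>R>\<rho>. \<exists>M. summable M \<and> summable (\<lambda>n. cmod (cheb \<rho> f n) * R ^ n) \<and>
    (\<forall>n w. 1 \<le> cmod w \<longrightarrow> cmod w \<le> R \<longrightarrow> cmod (cheb \<rho> f n * Qc n (Jou w)) \<le> M n)"
proof -
  obtain K where K: "K \<ge> 0" "\<And>n w R. 1 \<le> cmod w \<Longrightarrow> cmod w \<le> R \<Longrightarrow> \<rho> \<le> R \<Longrightarrow> cmod (Qc n (Jou w)) \<le> K * R ^ n"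
    using Qc_bound[OF \<rho>] by blast
  obtain \<rho>' B where B: "\<rho>' > \<rho>" "\<And>n. cmod (cheb \<rho> f n) \<le> B / \<rho>' ^ n"
    using A_space_cheb(1)[OF \<rho> f] by blast
  \<comment> \<open>strictly between \<open>\<rho>\<close> and the radius \<open>\<rho>'\<close> up to which the coefficients decay\<close>
  define R where "R = (\<rho> + \<rho>') / 2"
  have R: "\<rho> < R" "R < \<rho>'" "0 < R" "1 < \<rho>'" using B(1) \<rho> by (simp_all add: R_def)
  have g: "summable (\<lambda>n. B * (R / \<rho>') ^ n)" using R by (intro summable_mult summable_geometric) auto
  have le: "cmod (cheb \<rho> f n) * R ^ n \<le> B * (R / \<rho>') ^ n" for n
    using mult_right_mono[OF B(2)[of n], of "R ^ n"] R by (simp add: power_divide)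
  have s1: "summable (\<lambda>n. cmod (cheb \<rho> f n) * R ^ n)"
    by (rule summable_comparison_test'[OF g]) (use le R in simp)
  have "cmod (cheb \<rho> f n * Qc n (Jou w)) \<le> K * (cmod (cheb \<rho> f n) * R ^ n)" if "1 \<le> cmod w" "cmod w \<le> R" for n w
  proof -
    have "cmod (Qc n (Jou w)) \<le> K * R ^ n" using K(2)[OF that] R by simp
    then have "cmod (cheb \<rho> f n) * cmod (Qc n (Jou w)) \<le> cmod (cheb \<rho> f n) * (K * R ^ n)"
      by (intro mult_left_mono) auto
    then show ?thesis by (simp add: norm_mult mult_ac)
  qed
  then show ?thesis using s1 R(1) by (intro exI[of _ R] conjI exI[of _ "\<lambda>n. K * (cmod (cheb \<rho> f n) * R ^ n)"] summable_mult) auto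
qed

lemma Tser_analytic:
  assumes \<rho>: "1 < \<rho>" and f: "f \<in> A_space \<rho>"
  shows "Tser \<rho> f analytic_on bernstein_region \<rho>"
proof -
  obtain R M where R: "R > \<rho>" "summable M" "\<And>n w. 1 \<le> cmod w \<Longrightarrow> cmod w \<le> R \<Longrightarrow> cmod (cheb \<rho> f n * Qc n (Jou w)) \<le> M n"
    using Tser_majorant[OF \<rho> f] by blast
  have R1: "1 < R" using R(1) \<rho> by simp
  have M: "cmod (cheb \<rho> f n * Qc n z) \<le> M n" if "z \<in> open_ellipse R" for n z
    using open_ellipse_Jou[OF R1 that] R(3) by force
  have ul: "uniform_limit (open_ellipse R) (\<lambda>N z. \<Sum>n<N. cheb \<rho> f n * Qc n z) (Tser \<rho> f) sequentially"
    unfolding Tser_def[abs_def] by (rule Weierstrass_m_test[OF M R(2)])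
  have hol: "(\<lambda>z. \<Sum>n<N. cheb \<rho> f n * Qc n z) holomorphic_on open_ellipse R" for N
    by (intro holomorphic_intros Qc_holomorphic)
  have "Tser \<rho> f holomorphic_on open_ellipse R"
  proof (rule holomorphic_uniform_sequence[OF open_open_ellipse, rotated])
    fix z assume "z \<in> open_ellipse R"
    then obtain d where "d > 0" "cball z d \<subseteq> open_ellipse R"
      using open_contains_cball open_open_ellipse by blast
    then show "\<exists>d>0. cball z d \<subseteq> open_ellipse R \<and>
        uniform_limit (cball z d) (\<lambda>N z. \<Sum>n<N. cheb \<rho> f n * Qc n z) (Tser \<rho> f) sequentially"
      using uniform_limit_on_subset[OF ul] by blast
  qed (rule hol)
  then show ?thesis
    unfolding analytic_on_holomorphic using \<rho> R(1) open_open_ellipse bernstein_subset_open_ellipse[of \<rho> R] by auto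
qed

text \<open>For \<open>\<bar>u\<bar> \<ge> 1\<close> the part with positive powers is the value \<open>f (Jou u)\<close> minus the part with negative powers, which
  is bounded by a geometric series.\<close>

lemma plus_part_bound:
  assumes \<rho>: "1 < \<rho>" and f: "f \<in> A_space \<rho>" and u: "cmod u \<le> \<rho>"
  shows "cmod (\<Sum>n. cheb \<rho> f n * u ^ n) \<le> (1 + 1 / (1 - 1 / \<rho>)) * A_norm \<rho> f"
proof -
  let ?c = "cheb \<rho> f" and ?A = "A_norm \<rho> f"
  have c: "cmod (?c n) \<le> ?A * (1 / \<rho>) ^ n" for n using A_space_cheb(3)[OF \<rho> f, of n] by (simp add: power_divide)
  have g: "(\<lambda>n. ?A * (1 / \<rho>) ^ n) sums (?A * (1 / (1 - 1 / \<rho>)))"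
    using \<rho> by (intro sums_mult geometric_sums) auto
  have gs: "summable (\<lambda>n. ?A * (1 / \<rho>) ^ n)" using g by (rule sums_summable)
  have A0: "?A \<ge> 0" using order_trans[OF norm_ge_zero c[of 0]] by simp
  have bd: "cmod (suminf a) \<le> ?A * (1 / (1 - 1 / \<rho>)) \<and> summable a" if "\<And>n. cmod (a n) \<le> cmod (?c n)" for a :: "nat \<Rightarrow> complex"
  proof -
    have le: "cmod (a n) \<le> ?A * (1 / \<rho>) ^ n" for n using that[of n] c[of n] by linarith
    have sn: "summable (\<lambda>n. cmod (a n))" by (rule summable_comparison_test'[OF gs]) (use le in simp)
    have "cmod (suminf a) \<le> (\<Sum>n. cmod (a n))" by (rule summable_norm[OF sn])
    also have "\<dots> \<le> (\<Sum>n. ?A * (1 / \<rho>) ^ n)" by (rule suminf_le[OF le sn gs])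
    finally show ?thesis using g summable_norm_cancel[OF sn] by (simp add: sums_iff)
  qed
  show ?thesis
  proof (cases "cmod u \<le> 1")
    case True
    have "cmod (?c n * u ^ n) \<le> cmod (?c n)" for n
      using True by (simp add: norm_mult norm_power mult_left_le power_le_one)
    from bd[OF this] A0 show ?thesis by (simp add: algebra_simps)
  next
    case False
    then have u0: "u \<noteq> 0" "1 \<le> cmod u" by auto
    \<comment> \<open>the part with negative powers\<close>
    let ?m = "\<lambda>n. if n = 0 then 0 else ?c n * inverse u ^ n"
    have "cmod (?m n) \<le> cmod (?c n)" for n
      using u0 by (simp add: norm_mult norm_power norm_inverse mult_left_le power_le_one inverse_le_1_iff)
    from bd[OF this] have m: "cmod (suminf ?m) \<le> ?A * (1 / (1 - 1 / \<rho>))" "summable ?m" by auto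
    have S: "(\<lambda>n. ?c n * EL n u) sums f (Jou u)" by (rule A_space_cheb(2)[OF \<rho> f u0(2) u])
    have "(\<lambda>n. ?c n * EL n u - ?m n) sums (f (Jou u) - suminf ?m)"
      by (intro sums_diff S summable_sums m)
    moreover have "?c n * EL n u - ?m n = ?c n * u ^ n" for n by (simp add: EL_def algebra_simps)
    ultimately have e: "(\<Sum>n. ?c n * u ^ n) = f (Jou u) - suminf ?m" by (simp add: sums_iff)
    have "cmod (f (Jou u)) \<le> ?A" using Jou_region[of \<rho> u] \<rho> u0 u by (intro norm_le_A_norm[OF f]) auto
    then have "cmod (\<Sum>n. ?c n * u ^ n) \<le> ?A + ?A * (1 / (1 - 1 / \<rho>))"
      unfolding e by (intro order_trans[OF norm_triangle_ineq4] add_mono m(1))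
    then show ?thesis by (simp add: algebra_simps)
  qed
qed

lemma Tser_bound:
  assumes \<rho>: "1 < \<rho>"
  shows "\<exists>C>0. \<forall>f\<in>A_space \<rho>. \<forall>z\<in>bernstein_region \<rho>. cmod (Tser \<rho> f z) \<le> C * A_norm \<rho> f"
proof -
  obtain K where K: "K \<ge> 0" "\<And>n w R. 1 \<le> cmod w \<Longrightarrow> cmod w \<le> R \<Longrightarrow> \<rho> \<le> R \<Longrightarrow>
     cmod (Qc n (Jou w) - EL n w / complex_of_real (ell0 * gam n)) \<le> K * (R ^ n * dgam n)"
    using Qc_tail_bound[OF \<rho>] by blast
  define G where "G = 1 / (1 - 1 / \<rho>)"
  define C where "C = K * suminf dgam + ((1 + G) + (1 + G) + 1) / \<bar>ell0\<bar>"
  have G: "G > 0" using \<rho> by (simp add: G_def)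
  have C: "C > 0" unfolding C_def using K(1) G ell0_nonzero suminf_nonneg[OF summable_dgam dgam_nonneg]
    by (intro add_nonneg_pos mult_nonneg_nonneg divide_pos_pos) auto
  have "cmod (Tser \<rho> f z) \<le> C * A_norm \<rho> f" if f: "f \<in> A_space \<rho>" and z: "z \<in> bernstein_region \<rho>" for f z
  proof -
    let ?c = "cheb \<rho> f" and ?A = "A_norm \<rho> f"
    obtain w where w: "1 \<le> cmod w" "z = Jou w" using Jou_surj by blast
    have w\<rho>: "cmod w \<le> \<rho>" using Jou_region[of \<rho> w] w z \<rho> by simp
    have w0: "w \<noteq> 0" using w by auto
    have c: "cmod (?c n) \<le> ?A / \<rho> ^ n" for n using A_space_cheb(3)[OF \<rho> f] .
    have A0: "?A \<ge> 0" using order_trans[OF norm_ge_zero c[of 0]] by simp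
    obtain R M where R: "R > \<rho>" "summable (\<lambda>n. cmod (?c n) * R ^ n)" using Tser_majorant[OF \<rho> f] by blast
    have sc: "summable (\<lambda>n. cmod (?c n * u ^ n))" if "cmod u \<le> \<rho>" for u
    proof (rule summable_comparison_test'[OF R(2)])
      fix n show "norm (cmod (?c n * u ^ n)) \<le> cmod (?c n) * R ^ n"
        using that R(1) by (simp add: norm_mult norm_power) (intro mult_left_mono power_mono, auto)
    qed
    have plus: "cmod (\<Sum>n. ?c n * u ^ n / complex_of_real (gam n)) \<le> (1 + G) * ?A" if u: "cmod u \<le> \<rho>" for u
    proof (rule gam_multiplier[OF sc[OF u]])
      fix t :: real assume t: "0 \<le> t" "t \<le> 1"
      have "cmod (u * complex_of_real t) \<le> \<rho>" using u t mult_mono[of "cmod u" \<rho> t 1] \<rho> by (simp add: norm_mult)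
      from plus_part_bound[OF \<rho> f this] show "cmod (\<Sum>n. ?c n * u ^ n * complex_of_real t ^ n) \<le> (1 + G) * ?A"
        by (simp add: G_def power_mult_distrib mult.assoc)
    qed
    have iw: "cmod (inverse w) \<le> \<rho>" using w(1) \<rho> by (simp add: norm_inverse) (meson inverse_le_1_iff less_imp_le order_trans)
    have ss: "summable (\<lambda>n. ?c n * u ^ n / complex_of_real (gam n))" if "cmod u \<le> \<rho>" for u
      using summable_div_gam[OF sc[OF that]] .
    \<comment> \<open>the leading part; the degree \<open>0\<close> occurs in both series and is subtracted once\<close>
    define H where "H = (\<Sum>n. ?c n * w ^ n / complex_of_real (gam n)) + (\<Sum>n. ?c n * inverse w ^ n / complex_of_real (gam n)) - ?c 0"
    have "cmod H \<le> (1 + G) * ?A + (1 + G) * ?A + ?A"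
      unfolding H_def using c[of 0]
      by (intro order_trans[OF norm_triangle_ineq4] add_mono order_trans[OF norm_triangle_ineq] plus w\<rho> iw) auto
    then have Hb: "cmod H \<le> ((1 + G) + (1 + G) + 1) * ?A" by (simp add: algebra_simps)
    have "(\<lambda>n. ?c n * w ^ n / complex_of_real (gam n) + ?c n * inverse w ^ n / complex_of_real (gam n) - (if n = 0 then ?c 0 else 0)) sums H"
      unfolding H_def by (intro sums_diff sums_add summable_sums ss w\<rho> iw sums_single)
    moreover have "?c n * w ^ n / complex_of_real (gam n) + ?c n * inverse w ^ n / complex_of_real (gam n) - (if n = 0 then ?c 0 else 0)
        = ?c n * (EL n w / complex_of_real (gam n))" for n
      by (simp add: EL_def gam_0 add_divide_distrib algebra_simps)
    ultimately have H: "(\<lambda>n. ?c n * (EL n w / complex_of_real (gam n))) sums H" by simp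
    \<comment> \<open>the contribution of the lower order terms\<close>
    define t where "t n = ?c n * (Qc n (Jou w) - EL n w / complex_of_real (ell0 * gam n))" for n
    have tb: "cmod (t n) \<le> (K * ?A) * dgam n" for n
    proof -
      have "cmod (t n) \<le> ?A / \<rho> ^ n * (K * (\<rho> ^ n * dgam n))"
        unfolding t_def norm_mult using c[of n] K(2)[OF w(1) w\<rho> order_refl, of n] A0 \<rho> by (intro mult_mono) auto
      then show ?thesis using \<rho> by (simp add: mult_ac)
    qed
    have ds: "summable (\<lambda>n. (K * ?A) * dgam n)" by (intro summable_mult summable_dgam)
    have tn: "summable (\<lambda>n. cmod (t n))" by (rule summable_comparison_test'[OF ds]) (use tb in simp)
    have "cmod (suminf t) \<le> (\<Sum>n. cmod (t n))" by (rule summable_norm[OF tn])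
    also have "\<dots> \<le> (\<Sum>n. (K * ?A) * dgam n)" by (rule suminf_le[OF tb tn ds])
    also have "\<dots> = K * ?A * suminf dgam" by (rule suminf_mult[OF summable_dgam])
    finally have tS: "cmod (suminf t) \<le> K * suminf dgam * ?A" by (simp add: mult_ac)
    have "(\<lambda>n. t n + inverse (complex_of_real ell0) * (?c n * (EL n w / complex_of_real (gam n)))) sums (suminf t + inverse (complex_of_real ell0) * H)"
      by (intro sums_add sums_mult H summable_sums summable_norm_cancel[OF tn])
    moreover have "t n + inverse (complex_of_real ell0) * (?c n * (EL n w / complex_of_real (gam n))) = ?c n * Qc n z" for n
      using ell0_nonzero by (simp add: t_def w(2) field_simps)
    ultimately have "Tser \<rho> f z = suminf t + inverse (complex_of_real ell0) * H" by (simp add: Tser_def sums_iff)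
    then have "cmod (Tser \<rho> f z) \<le> cmod (suminf t) + cmod H / \<bar>ell0\<bar>"
      using norm_triangle_ineq[of "suminf t" "inverse (complex_of_real ell0) * H"] by (simp add: norm_mult norm_inverse norm_divide field_simps)
    also have "\<dots> \<le> K * suminf dgam * ?A + ((1 + G) + (1 + G) + 1) * ?A / \<bar>ell0\<bar>"
      using tS Hb by (intro add_mono divide_right_mono) auto
    also have "\<dots> = C * ?A" by (simp add: C_def field_simps)
    finally show ?thesis .
  qed
  then show ?thesis using C by blast
qed

lemma Tser_diff:
  assumes \<rho>: "1 < \<rho>" and f: "f \<in> A_space \<rho>" and g: "g \<in> A_space \<rho>" and z: "z \<in> bernstein_region \<rho>"
  shows "Tser \<rho> f z - Tser \<rho> g z = Tser \<rho> (\<lambda>z. f z - g z) z"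
proof -
  obtain w where w: "1 \<le> cmod w" "z = Jou w" using Jou_surj by blast
  have w\<rho>: "cmod w \<le> \<rho>" using Jou_region[of \<rho> w] w z \<rho> by simp
  have s: "summable (\<lambda>n. cheb \<rho> h n * Qc n z)" if h: "h \<in> A_space \<rho>" for h
  proof -
    obtain R M where R: "R > \<rho>" "summable M" "\<And>n w. 1 \<le> cmod w \<Longrightarrow> cmod w \<le> R \<Longrightarrow> cmod (cheb \<rho> h n * Qc n (Jou w)) \<le> M n"
      using Tser_majorant[OF \<rho> h] by blast
    have "cmod w \<le> R" using w\<rho> R(1) by linarith
    from R(3)[OF w(1) this] show ?thesis
      unfolding w(2) by (rule summable_comparison_test'[OF R(2), of 0])
  qed
  have "Tser \<rho> f z - Tser \<rho> g z = (\<Sum>n. cheb \<rho> f n * Qc n z - cheb \<rho> g n * Qc n z)"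
    unfolding Tser_def by (rule suminf_diff[OF s[OF f] s[OF g]])
  then show ?thesis unfolding Tser_def cheb_diff[OF \<rho> f g] by (simp add: left_diff_distrib)
qed

lemma weighted_frac_lap_sum:
  assumes "\<And>n. weighted_frac_lap s (\<phi> n) (h n)"
  shows "weighted_frac_lap s (\<lambda>x. \<Sum>n<(N::nat). \<phi> n x) (\<lambda>x. \<Sum>n<N. h n x)"
proof (induction N)
  case 0 show ?case using weighted_frac_lap_poly[of 0] by simp
next
  case (Suc N) show ?case using weighted_frac_lap_add[OF Suc assms[of N]] by simp
qed

text \<open>The partial sums of both Chebyshev series converge uniformly on \<open>[-1, 1]\<close>, where \<open>\<bar>w\<bar> = 1\<close>.\<close>

lemma Tser_ext:
  assumes \<rho>: "1 < \<rho>" and f: "f \<in> A_space \<rho>"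
  shows "weighted_frac_lap_ext s (on_real (Tser \<rho> f)) (on_real f)"
proof -
  obtain R M where R: "R > \<rho>" "summable M" "summable (\<lambda>n. cmod (cheb \<rho> f n) * R ^ n)"
      "\<And>n w. 1 \<le> cmod w \<Longrightarrow> cmod w \<le> R \<Longrightarrow> cmod (cheb \<rho> f n * Qc n (Jou w)) \<le> M n"
    using Tser_majorant[OF \<rho> f] by blast
  define \<phi> h where "\<phi> N x = (\<Sum>n<N. cheb \<rho> f n * complex_of_real (poly (Qpol n) x))"
    and "h N x = (\<Sum>n<N. cheb \<rho> f n * complex_of_real (poly (Epol n) x))" for N and x :: real
  have x: "\<exists>t. complex_of_real x = Jou (cis t)" if "x \<in> {-1..1}" for x
    using that by (intro exI[of _ "arccos x"]) (simp add: Jou_cis)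
  have bQ: "cmod (cheb \<rho> f n * complex_of_real (poly (Qpol n) x)) \<le> M n" if xI: "x \<in> {-1..1}" for n x
  proof -
    obtain t where "complex_of_real x = Jou (cis t)" using x[OF xI] by blast
    then show ?thesis using R(4)[of "cis t" n] R(1) \<rho> by (simp flip: Qc_of_real)
  qed
  have bE: "cmod (cheb \<rho> f n * complex_of_real (poly (Epol n) x)) \<le> 2 * (cmod (cheb \<rho> f n) * R ^ n)" if xI: "x \<in> {-1..1}" for n x
  proof -
    have "complex_of_real (poly (Epol n) x) = EL n (cis (arccos x))" using Epol_cos[of n "arccos x"] xI by simp
    moreover have "1 \<le> R ^ n" using R(1) \<rho> by (intro one_le_power) simp
    ultimately have "cmod (complex_of_real (poly (Epol n) x)) \<le> 2 * R ^ n"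
      using EL_norm[of "cis (arccos x)" n] by simp
    then have "cmod (cheb \<rho> f n) * cmod (complex_of_real (poly (Epol n) x)) \<le> cmod (cheb \<rho> f n) * (2 * R ^ n)"
      by (intro mult_left_mono) auto
    then show ?thesis by (simp add: norm_mult mult_ac)
  qed
  have vE: "(\<Sum>n. cheb \<rho> f n * complex_of_real (poly (Epol n) x)) = on_real f x" if xI: "x \<in> {-1..1}" for x
  proof -
    have "(\<lambda>n. cheb \<rho> f n * EL n (cis (arccos x))) sums f (Jou (cis (arccos x)))"
      using \<rho> by (intro A_space_cheb(2)[OF \<rho> f]) auto
    then show ?thesis using xI Epol_cos[of _ "arccos x"] by (simp add: sums_iff on_real_def Jou_cis)
  qed
  have "uniform_limit {-1..1} \<phi> (\<lambda>x. \<Sum>n. cheb \<rho> f n * complex_of_real (poly (Qpol n) x)) sequentially"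
    unfolding \<phi>_def[abs_def] by (rule Weierstrass_m_test[OF bQ R(2)])
  then have lQ: "uniform_limit {-1..1} \<phi> (on_real (Tser \<rho> f)) sequentially"
    by (simp add: on_real_def[abs_def] Tser_def Qc_of_real)
  have "uniform_limit {-1..1} h (\<lambda>x. \<Sum>n. cheb \<rho> f n * complex_of_real (poly (Epol n) x)) sequentially"
    unfolding h_def[abs_def] by (rule Weierstrass_m_test[OF bE summable_mult[OF R(3)]])
  then have lE: "uniform_limit {-1..1} h (on_real f) sequentially"
    by (rule uniform_limit_cong'[THEN iffD1, rotated -1]) (simp_all only: vE)
  have c\<phi>: "continuous_on {-1..1} (\<phi> N)" for N unfolding \<phi>_def[abs_def] by (intro continuous_intros)
  have ch: "continuous_on {-1..1} (h N)" for N unfolding h_def[abs_def] by (intro continuous_intros)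
  show ?thesis
  proof (rule ext_from_uniform_limits[OF _ c\<phi> ch _ _ lQ lE])
    show "weighted_frac_lap s (\<phi> N) (h N)" for N
      unfolding \<phi>_def[abs_def] h_def[abs_def]
      by (intro weighted_frac_lap_sum weighted_frac_lap_cmult weighted_frac_lap_poly[of "Qpol _", unfolded LP_Qpol])
    show "continuous_on {-1..1} (on_real (Tser \<rho> f))"
      by (rule uniform_limit_theorem[OF always_eventually lQ]) (simp_all add: c\<phi>)
    show "continuous_on {-1..1} (on_real f)"
      by (rule uniform_limit_theorem[OF always_eventually lE]) (simp_all add: ch)
  qed
qed

end

theorem theorem4p18:
  fixes s \<rho> :: real
  assumes "0 < s" and "s < 1" and "1 < \<rho>"
  shows "\<exists>T. (\<forall>f\<in>A_space \<rho>. T f \<in> A_space \<rho> \<and>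
               (AE x in lborel. x \<in> {-1<..<1} \<longrightarrow>
                  on_real (T f) x = weighted_frac_lap_inv s (on_real f) x)) \<and>
             continuous_map (A_topology \<rho>) (A_topology \<rho>) T"
proof -
  interpret fractional_order s using assms(1,2) by unfold_locales
  note \<rho> = assms(3)
  interpret A: Metric_space "A_space \<rho>" "A_dist \<rho>" by (rule Metric_space_A_space[OF \<rho>])
  \<comment> \<open>elements of \<open>A_space \<rho>\<close> vanish off the region\<close>
  define T where "T f z = (if z \<in> bernstein_region \<rho> then Tser \<rho> f z else 0)" for f z
  have T_A: "T f \<in> A_space \<rho>" if "f \<in> A_space \<rho>" for f
    unfolding A_space_def T_def[abs_def] using Tser_analytic[OF \<rho> that] by auto
  have T_inv: "AE x in lborel. x \<in> {-1<..<1} \<longrightarrow> on_real (T f) x = weighted_frac_lap_inv s (on_real f) x"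
    if f: "f \<in> A_space \<rho>" for f
  proof -
    have "on_real (T f) x = on_real (Tser \<rho> f) x" if "x \<in> {-1<..<1}" for x
      using real_mem_bernstein_region[OF \<rho>, of x] that by (simp add: on_real_def T_def)
    then show ?thesis using inv_eq_AE[OF Tser_ext[OF \<rho> f]] by (auto elim!: AE_mp)
  qed
  obtain C where C: "C > 0" "\<And>f z. f \<in> A_space \<rho> \<Longrightarrow> z \<in> bernstein_region \<rho> \<Longrightarrow> cmod (Tser \<rho> f z) \<le> C * A_norm \<rho> f"
    using Tser_bound[OF \<rho>] by blast
  have lip: "A_dist \<rho> (T f) (T g) \<le> C * A_dist \<rho> f g" if f: "f \<in> A_space \<rho>" and g: "g \<in> A_space \<rho>" for f g
  proof -
    have ne: "bernstein_region \<rho> \<noteq> {}" using real_mem_bernstein_region[OF \<rho>, of 0] by auto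
    have "A_norm \<rho> (\<lambda>z. T f z - T g z) \<le> C * A_norm \<rho> (\<lambda>z. f z - g z)"
      unfolding A_norm_def[of \<rho> "\<lambda>z. T f z - T g z"]
    proof (rule cSUP_least[OF ne])
      fix z assume z: "z \<in> bernstein_region \<rho>"
      then show "cmod (T f z - T g z) \<le> C * A_norm \<rho> (\<lambda>z. f z - g z)"
        using C(2)[OF A_space_diff[OF f g] z] Tser_diff[OF \<rho> f g z] by (simp add: T_def)
    qed
    then show ?thesis using f g T_A by (simp add: A_dist_def)
  qed
  have "continuous_map A.mtopology A.mtopology T"
    unfolding A.continuous_map_to_metric
  proof (intro ballI allI impI)
    fix f and \<epsilon> :: real assume f: "f \<in> topspace A.mtopology" and \<epsilon>: "\<epsilon> > 0"
    have "T g \<in> A.mball (T f) \<epsilon>" if "g \<in> A.mball f (\<epsilon> / C)" for g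
    proof -
      have g: "g \<in> A_space \<rho>" "A_dist \<rho> f g < \<epsilon> / C" using that by auto
      have "A_dist \<rho> (T f) (T g) \<le> C * A_dist \<rho> f g" using lip f g(1) by simp
      also have "\<dots> < \<epsilon>" using g(2) C(1) by (simp add: pos_less_divide_eq mult.commute)
      finally show ?thesis using T_A f g(1) by simp
    qed
    moreover have "f \<in> A.mball f (\<epsilon> / C)" using f \<epsilon> C(1) by simp
    ultimately show "\<exists>U. openin A.mtopology U \<and> f \<in> U \<and> (\<forall>g\<in>U. T g \<in> A.mball (T f) \<epsilon>)"
      using A.openin_mball by blast
  qed
  then have "continuous_map (A_topology \<rho>) (A_topology \<rho>) T" by (simp only: A_topology_def)
  then show ?thesis using T_A T_inv by (intro exI[of _ T]) blast
qed

end
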